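(* Let $f:\mathbb{C}\to\widehat{\mathbb{C}}$ be a meromorphic map and $U\subset\mathbb{C}$ a simply connected invariant Fatou component of $f$. Let $\varphi:\mathbb{D}\to U$ be a Riemann map and $g=\varphi^{-1}\circ f\circ\varphi:\mathbb{D}\to\mathbb{D}$ the inner function associated to $f|_U$. Then the following hold. (a) If $\mathcal{A}$ is an invariant access from $U$ to a point $v\in\partial U$, then $v$ is either infinity or a fixed point of $f$, and $\mathcal{A}$ corresponds to a boundary fixed point $\zeta\in\partial\mathbb{D}$ of $g$. (b) If $\zeta\in\partial\mathbb{D}$ is a regular boundary fixed point of $g$, then the radial limit of $\varphi$ at $\zeta$ exists and is equal to $v$, where $v$ is either infinity or a weakly repelling fixed point of $f$ in $\partial U$. Moreover, $\zeta$ corresponds to an invariant access $\mathcal{A}$ from $U$ to $v$.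
   Context: $\widehat{\mathbb{C}}$ is the Riemann sphere, $\mathbb{D}$ the open unit disc; $\partial U$ is the boundary of $U$ in $\widehat{\mathbb{C}}$. The Fatou set of $f$ is the set of points having a neighbourhood on which all iterates $f^n$ are defined and form a normal family; its connected components are the Fatou components; $U$ is invariant if $f(U)\subset U$. Landing: a curve $\gamma:[0,1)\to U$ lands at $v\in\partial U$ if $\lim_{t\to1^-}\gamma(t)=v$ (then set $\gamma(1)=v$). Access: fix $z_0=\varphi(0)$. An access from $U$ to $v\in\partial U$ is a homotopy class (with fixed endpoints) of curves $\gamma:[0,1]\to\widehat{\mathbb{C}}$ with $\gamma([0,1))\subset U$, $\gamma(0)=z_0$, $\gamma(1)=v$; a homotopy here is a continuous map $H:[0,1]^2\to U\cup\{v\}$ with $H([0,1)\times[0,1])\subset U$, $H(0,s)=z_0$, $H(1,s)=v$ for all $s$. Invariant access: $\mathcal{A}$ is invariant if there exists $\gamma\in\mathcal{A}$ such that $f(\gamma)\cup\eta\in\mathcal{A}$, where $\eta$ is a curve in $U$ connecting $z_0$ to $f(z_0)$ (and $f(\gamma)\cup\eta$ is $\eta$ followed by $f\circ\gamma$; the choice of $\eta$ is irrelevant as $U$ is simply connected). Correspondence: an access $\mathcal{A}$ to $v$ and a point $\zeta\in\partial\mathbb{D}$ correspond to each other if the radial limit of $\varphi$ at $\zeta$ exists and equals $v$, and for every $\gamma\in\mathcal{A}$ the curve $\varphi^{-1}(\gamma)$ lands at $\zeta$. (Equivalently, $\mathcal{A}$ is the access containing $t\mapsto\varphi(t\zeta)$.)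 Radial limit of $h$ at $\zeta$: $\lim_{t\to1^-}h(t\zeta)$. A boundary fixed point of $g$ is a point $\zeta\in\partial\mathbb{D}$ such that the radial limit of $g$ at $\zeta$ exists and equals $\zeta$. At such a point the angular derivative $\lim_{t\to1^-}\frac{g(t\zeta)-\zeta}{(t-1)\zeta}$ exists in $(0,+\infty)\cup\{\infty\}$; $\zeta$ is regular if the angular derivative is finite. A fixed point $z$ of $f$ is weakly repelling if $|f'(z)|>1$ or $f'(z)=1$. *)

theory Defs
  imports "HOL-Complex_Analysis.Complex_Analysis"
begin

section \<open>The Riemann sphere\<close>

datatype csphere = Fin (to_complex: complex) | Infty
  where "to_complex Infty = 0"

(* Inverse stereographic projection onto the unit sphere of the Euclidean space C x R;
   the metric pulled back along it is the chordal metric. *)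
primrec stereo :: "csphere \<Rightarrow> complex \<times> real" where
  "stereo (Fin z) = ((2 / (1 + (cmod z)\<^sup>2)) *\<^sub>R z, ((cmod z)\<^sup>2 - 1) / ((cmod z)\<^sup>2 + 1))"
| "stereo Infty = (0, 1)"

lemma inj_stereo: "inj stereo"
proof -
  have pos: "1 + (cmod z)\<^sup>2 > 0" for z
    by (simp add: add_pos_nonneg)
  have third: "((cmod z)\<^sup>2 - 1) / ((cmod z)\<^sup>2 + 1) = 1 - 2 / (1 + (cmod z)\<^sup>2)" for z
    using pos[of z] by (simp add: field_simps)
  have "z = w" if "stereo (Fin z) = stereo (Fin w)" for z w
  proof -
    from that have eq: "2 / (1 + (cmod z)\<^sup>2) = 2 / (1 + (cmod w)\<^sup>2)"
      by (simp add: third)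
    moreover have "(2 / (1 + (cmod z)\<^sup>2)) *\<^sub>R z = (2 / (1 + (cmod w)\<^sup>2)) *\<^sub>R w"
      using that by simp
    ultimately have "(2 / (1 + (cmod w)\<^sup>2)) *\<^sub>R z = (2 / (1 + (cmod w)\<^sup>2)) *\<^sub>R w"
      by metis
    then show ?thesis
      using pos[of w] by (simp only: real_vector.scale_cancel_left) simp
  qed
  moreover have "stereo (Fin z) \<noteq> stereo Infty" for z
    using pos[of z] by (simp add: third)
  ultimately show ?thesis
    by (intro injI) (metis csphere.exhaust)
qed

instantiation csphere :: metric_space
begin

definition dist_csphere :: "csphere \<Rightarrow> csphere \<Rightarrow> real" where
  "dist_csphere p q = dist (stereo p) (stereo q)"

definition uniformity_csphere :: "(csphere \<times> csphere) filter" where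
  "uniformity_csphere = (INF e\<in>{0 <..}. principal {(p, q). dist p q < e})"

definition open_csphere :: "csphere set \<Rightarrow> bool" where
  "open_csphere S \<longleftrightarrow> (\<forall>p\<in>S. eventually (\<lambda>(p', q). p' = p \<longrightarrow> q \<in> S) uniformity)"

instance
proof
  fix p q r :: csphere
  show "dist p q = 0 \<longleftrightarrow> p = q"
    using inj_stereo by (simp add: dist_csphere_def inj_eq)
  show "dist p q \<le> dist p r + dist q r"
    by (simp add: dist_csphere_def dist_triangle2)
qed (simp_all add: uniformity_csphere_def open_csphere_def)

end


section \<open>Meromorphic maps and their Fatou components\<close>

definition meromorphic_map :: "(complex \<Rightarrow> csphere) \<Rightarrow> bool" where
  "meromorphic_map f \<longleftrightarrow>
     (\<lambda>z. to_complex (f z)) nicely_meromorphic_on UNIV \<and>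
     (\<forall>z. f z = Infty \<longleftrightarrow> is_pole (\<lambda>z. to_complex (f z)) z)"

(* f itself has no value at Infty; the value chosen here is a dummy that marks an orbit
   as having run into Infty. *)
fun sphere_map :: "(complex \<Rightarrow> csphere) \<Rightarrow> csphere \<Rightarrow> csphere" where
  "sphere_map f (Fin z) = f z"
| "sphere_map f Infty = Infty"

definition iterate :: "(complex \<Rightarrow> csphere) \<Rightarrow> nat \<Rightarrow> complex \<Rightarrow> csphere" where
  "iterate f n z = (sphere_map f ^^ n) (Fin z)"

definition iterate_defined :: "(complex \<Rightarrow> csphere) \<Rightarrow> nat \<Rightarrow> complex \<Rightarrow> bool" where
  "iterate_defined f n z \<longleftrightarrow> (\<forall>k<n. iterate f k z \<noteq> Infty)"

(* Normality with respect to the spherical metric, so the limit may take the value Infty. *)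
definition normal_on :: "complex set \<Rightarrow> (complex \<Rightarrow> csphere) set \<Rightarrow> bool" where
  "normal_on V \<F> \<longleftrightarrow>
     (\<forall>s :: nat \<Rightarrow> complex \<Rightarrow> csphere. range s \<subseteq> \<F> \<longrightarrow>
        (\<exists>r l. strict_mono r \<and>
           (\<forall>K. K \<subseteq> V \<and> compact K \<longrightarrow> uniform_limit K (s \<circ> r) l sequentially)))"

definition fatou_set :: "(complex \<Rightarrow> csphere) \<Rightarrow> complex set" where
  "fatou_set f = {z. \<exists>V. open V \<and> z \<in> V \<and> (\<forall>n. \<forall>w\<in>V. iterate_defined f n w) \<and>
                       normal_on V (range (iterate f))}"

definition invariant_fatou_component :: "(complex \<Rightarrow> csphere) \<Rightarrow> complex set \<Rightarrow> bool" where
  "invariant_fatou_component f U \<longleftrightarrow> U \<in> components (fatou_set f) \<and> f ` U \<subseteq> Fin ` U"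

definition fixed_point :: "(complex \<Rightarrow> csphere) \<Rightarrow> complex \<Rightarrow> bool" where
  "fixed_point f z \<longleftrightarrow> f z = Fin z"

definition weakly_repelling_fixed_point :: "(complex \<Rightarrow> csphere) \<Rightarrow> complex \<Rightarrow> bool" where
  "weakly_repelling_fixed_point f z \<longleftrightarrow> fixed_point f z \<and>
     (let d = deriv (\<lambda>w. to_complex (f w)) z in cmod d > 1 \<or> d = 1)"


section \<open>Riemann maps and boundary behaviour\<close>

definition riemann_map :: "(complex \<Rightarrow> complex) \<Rightarrow> complex set \<Rightarrow> bool" where
  "riemann_map \<phi> U \<longleftrightarrow> \<phi> holomorphic_on ball 0 1 \<and> bij_betw \<phi> (ball 0 1) U"

definition has_radial_limit :: "(complex \<Rightarrow> 'a::topological_space) \<Rightarrow> complex \<Rightarrow> 'a \<Rightarrow> bool" where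
  "has_radial_limit h \<zeta> l \<longleftrightarrow> ((\<lambda>t::real. h (of_real t * \<zeta>)) \<longlongrightarrow> l) (at_left 1)"

definition boundary_fixed_point :: "(complex \<Rightarrow> complex) \<Rightarrow> complex \<Rightarrow> bool" where
  "boundary_fixed_point g \<zeta> \<longleftrightarrow> \<zeta> \<in> sphere 0 1 \<and> has_radial_limit g \<zeta> \<zeta>"

definition has_angular_derivative :: "(complex \<Rightarrow> complex) \<Rightarrow> complex \<Rightarrow> complex \<Rightarrow> bool" where
  "has_angular_derivative g \<zeta> L \<longleftrightarrow>
     ((\<lambda>t::real. (g (of_real t * \<zeta>) - \<zeta>) / ((of_real t - 1) * \<zeta>)) \<longlongrightarrow> L) (at_left 1)"

definition regular_boundary_fixed_point :: "(complex \<Rightarrow> complex) \<Rightarrow> complex \<Rightarrow> bool" where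
  "regular_boundary_fixed_point g \<zeta> \<longleftrightarrow>
     boundary_fixed_point g \<zeta> \<and> (\<exists>L. has_angular_derivative g \<zeta> L)"


section \<open>Accesses\<close>

definition access_curve :: "complex set \<Rightarrow> complex \<Rightarrow> csphere \<Rightarrow> (real \<Rightarrow> csphere) \<Rightarrow> bool" where
  "access_curve U z0 v \<gamma> \<longleftrightarrow>
     path \<gamma> \<and> \<gamma> ` {0..<1} \<subseteq> Fin ` U \<and> pathstart \<gamma> = Fin z0 \<and> pathfinish \<gamma> = v"

(* Every stage of the homotopy is again an access curve: this encodes both that endpoints
   stay fixed and that v may be reached only at the final parameter value. *)
definition access_homotopic ::
  "complex set \<Rightarrow> complex \<Rightarrow> csphere \<Rightarrow> (real \<Rightarrow> csphere) \<Rightarrow> (real \<Rightarrow> csphere) \<Rightarrow> bool" where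
  "access_homotopic U z0 v \<gamma> \<delta> \<longleftrightarrow>
     homotopic_with_canon (access_curve U z0 v) {0..1} (insert v (Fin ` U)) \<gamma> \<delta>"

definition is_access ::
  "complex set \<Rightarrow> complex \<Rightarrow> csphere \<Rightarrow> (real \<Rightarrow> csphere) set \<Rightarrow> bool" where
  "is_access U z0 v \<A> \<longleftrightarrow> v \<in> frontier (Fin ` U) \<and>
     (\<exists>\<gamma>. access_curve U z0 v \<gamma> \<and> \<A> = {\<delta>. access_homotopic U z0 v \<gamma> \<delta>})"

(* The image under f of a curve ending at v. At the final parameter f need not be defined;
   the value v is put there, so that continuity of the result means that the image of
   the half-open curve lands at v. *)
definition image_curve ::
  "(complex \<Rightarrow> csphere) \<Rightarrow> csphere \<Rightarrow> (real \<Rightarrow> csphere) \<Rightarrow> real \<Rightarrow> csphere" where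
  "image_curve f v \<gamma> t = (if t < 1 then sphere_map f (\<gamma> t) else v)"

definition invariant_access ::
  "(complex \<Rightarrow> csphere) \<Rightarrow> complex set \<Rightarrow> complex \<Rightarrow> csphere \<Rightarrow> (real \<Rightarrow> csphere) set \<Rightarrow> bool" where
  "invariant_access f U z0 v \<A> \<longleftrightarrow> is_access U z0 v \<A> \<and>
     (\<exists>\<gamma>\<in>\<A>. \<exists>\<eta>. path \<eta> \<and> path_image \<eta> \<subseteq> Fin ` U \<and>
        pathstart \<eta> = Fin z0 \<and> pathfinish \<eta> = f z0 \<and>
        \<eta> +++ image_curve f v \<gamma> \<in> \<A>)"

definition corresponds ::
  "(complex \<Rightarrow> complex) \<Rightarrow> csphere \<Rightarrow> (real \<Rightarrow> csphere) set \<Rightarrow> complex \<Rightarrow> bool" where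
  "corresponds \<phi> v \<A> \<zeta> \<longleftrightarrow> \<zeta> \<in> sphere 0 1 \<and>
     has_radial_limit (\<lambda>z. Fin (\<phi> z)) \<zeta> v \<and>
     (\<forall>\<gamma>\<in>\<A>. ((\<lambda>t. inv_into (ball 0 1) \<phi> (to_complex (\<gamma> t))) \<longlongrightarrow> \<zeta>) (at_left 1))"

end

(* Let v be a boundary point of U, possibly infinity. A square root of phi - a (with a = v, or a
   outside U) omits a disc, so a Moebius image of it is a bounded non-vanishing function h on the
   disc that tends to 0 exactly where phi tends to v. Koebe's lemma on arcs and Lindelof's theorem
   for h show that the preimage of an access curve lands at a point zeta independent of the curve
   in its homotopy class, and that phi has radial limit v at zeta. Both facts come from one estimate:
   if a curve joins opposite sides of a square and |h| <= e on it, then |h|^4 <= e at the centre,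
   because the four rotated copies of the curve enclose the centre.
   For (a), the preimages of gamma and of f(gamma) both land at zeta, so g tends to zeta along a
   curve ending at zeta and hence radially.
   For (b), regularity makes the pseudo-hyperbolic distance of r zeta and g(r zeta) bounded away
   from 1. By the distortion estimate for univalent non-vanishing functions (from Schottky's
   theorem), phi(r zeta) and f(phi(r zeta)) accumulate at the same points, so finite cluster points
   are fixed points; these are isolated, hence the radial limit v exists. It lies outside the Fatou
   set, so its multiplier satisfies |mu| >= 1; if |mu| = 1 but mu <> 1, a logarithm of phi - v would
   advance by almost the same imaginary amount at each step, which Dirichlet approximation turns
   into a contradiction. *)
theory Submission
  imports Defs
begin

section \<open>Curves crossing a square\<close>

text \<open>The fourth power in the crossing estimate is the price of arguing with four rotated
  copies: three of the four factors are only known to be at most 1. It does no harm, because each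
  application either lets the bound tend to 0 or compares it with a fixed lower bound. Koebe's lemma
  takes that lower bound from the minimum of |h| on a compact subdisc, which is why the test
  function must not vanish. The same lemma handles homotopies: near the end of the curves every
  transversal of a homotopy has a preimage on which \<open>h\<close> is small, hence with endpoints
  close together. Of the angular derivative the proof keeps the boundedness of the difference
  quotient along the radius; with the Schwarz-Pick bound for 1 - |g| it confines the radius and its
  image under \<open>g\<close> to one Stolz region.\<close>

lemma complex_fashoda:
  fixes f g :: "real \<Rightarrow> complex"
  assumes "path f" "path g"
    and "path_image f \<subseteq> cbox a b" "path_image g \<subseteq> cbox a b"
    and "Re (pathstart f) = Re a" "Re (pathfinish f) = Re b"
    and "Im (pathstart g) = Im a" "Im (pathfinish g) = Im b"
  obtains z where "z \<in> path_image f" "z \<in> path_image g"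
proof -
  define e :: "complex \<Rightarrow> real^2" where "e = (\<lambda>z. vector [Re z, Im z])"
  have e1: "e z $ 1 = Re z" and e2: "e z $ 2 = Im z" for z
    by (simp_all add: e_def)
  have lin: "linear e"
    by (rule linearI) (simp_all add: e_def vec_eq_iff forall_2)
  have cont: "continuous_on A e" for A
    by (rule linear_continuous_on[OF linear_conv_bounded_linear[THEN iffD1, OF lin]])
  have box: "e z \<in> cbox (e a) (e b)" if "z \<in> cbox a b" for z
    using that by (auto simp: mem_box_cart forall_2 e1 e2 in_cbox_complex_iff)
  obtain w where w: "w \<in> path_image (e \<circ> f)" "w \<in> path_image (e \<circ> g)"
  proof (rule fashoda[of "e \<circ> f" "e \<circ> g" "e a" "e b"])
    show "path (e \<circ> f)" "path (e \<circ> g)"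
      using assms cont by (auto intro: path_continuous_image)
    show "path_image (e \<circ> f) \<subseteq> cbox (e a) (e b)" "path_image (e \<circ> g) \<subseteq> cbox (e a) (e b)"
      using assms box by (auto simp: path_image_compose)
  qed (use assms in \<open>auto simp: e1 e2 pathstart_compose pathfinish_compose\<close>)
  then obtain y z where "y \<in> path_image f" "z \<in> path_image g" "e y = e z"
    by (auto simp: path_image_compose)
  then have "y = z"
    by (metis complex_eq_iff e1 e2)
  with that \<open>y \<in> path_image f\<close> \<open>z \<in> path_image g\<close> show ?thesis by blast
qed

abbreviation unit_square :: "complex set" where
  "unit_square \<equiv> cbox (- 1 - \<i>) (1 + \<i>)"

lemma in_unit_square_iff: "z \<in> unit_square \<longleftrightarrow> \<bar>Re z\<bar> \<le> 1 \<and> \<bar>Im z\<bar> \<le> 1"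
  by (auto simp: in_cbox_complex_iff)

lemma i_times_in_unit_square_iff: "\<i> ^ k * z \<in> unit_square \<longleftrightarrow> z \<in> unit_square"
proof (induction k)
  case (Suc k)
  have "\<i> ^ Suc k * z \<in> unit_square \<longleftrightarrow> \<i> ^ k * z \<in> unit_square"
    unfolding in_unit_square_iff by (auto simp: mult.assoc)
  then show ?case using Suc.IH by (simp only:)
qed simp

lemma i_power4_mod: "\<i> ^ (4 * m + k) = \<i> ^ k"
  by (simp add: power_add power_mult)

text \<open>Among the four rotations of \<open>p\<close> one ends on the top side and the opposite
  one on the bottom side. Joined at the centre they form a vertical crossing that still avoids
  \<open>T\<close>; the Fashoda theorem will turn this into a contradiction.\<close>

lemma rotation_invariant_path_to_side:
  fixes T :: "complex set"
  assumes inv: "\<And>z. z \<in> T \<Longrightarrow> \<i> * z \<in> T"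
    and p: "path p" "path_image p \<subseteq> unit_square" "path_image p \<inter> T = {}" "pathstart p = 0"
    and fin: "\<bar>Re (pathfinish p)\<bar> = 1 \<or> \<bar>Im (pathfinish p)\<bar> = 1"
  obtains q where "path q" "path_image q \<subseteq> unit_square" "path_image q \<inter> T = {}"
    "Im (pathstart q) = -1" "Im (pathfinish q) = 1"
proof -
  have inv': "\<i> ^ k * z \<in> T" if "z \<in> T" for k z
    using that by (induction k) (auto simp: mult.assoc inv)
  have inv'': "z \<in> T" if "\<i> ^ k * z \<in> T" for k z
  proof -
    have "\<i> ^ (3 * k) * (\<i> ^ k * z) = z"
      using i_power4_mod[of k 0] by (simp flip: power_add mult.assoc)
    then show ?thesis using inv'[OF that, of "3 * k"] by (simp only:)
  qed
  have rot: "path (\<lambda>t. \<i> ^ k * p t) \<and> path_image (\<lambda>t. \<i> ^ k * p t) \<subseteq> unit_square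
        \<and> path_image (\<lambda>t. \<i> ^ k * p t) \<inter> T = {}" for k
  proof -
    have "path_image (\<lambda>t. \<i> ^ k * p t) = (\<lambda>z. \<i> ^ k * z) ` path_image p"
      by (auto simp: path_image_def)
    moreover have "path (\<lambda>t. \<i> ^ k * p t)"
      using p(1) unfolding path_def by (intro continuous_intros)
    ultimately show ?thesis
      using p(2,3) i_times_in_unit_square_iff inv'' by (auto simp del: cbox_complex_eq; blast)
  qed
  obtain k where k: "Im (\<i> ^ k * pathfinish p) = 1"
  proof -
    consider "Im (pathfinish p) = 1" | "Re (pathfinish p) = 1" | "Im (pathfinish p) = -1" | "Re (pathfinish p) = -1"
      using fin by linarith
    then show ?thesis
    proof cases
      case 1 then show ?thesis using that[of 0] by simp
    next
      case 2 then show ?thesis using that[of 1] by simp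
    next
      case 3 then show ?thesis using that[of 2] by (simp add: power2_eq_square)
    next
      case 4 then show ?thesis using that[of 3] by (simp add: power3_eq_cube)
    qed
  qed
  define u where "u = (\<lambda>t. \<i> ^ k * p t)"
  define l where "l = (\<lambda>t. \<i> ^ (k + 2) * p t)"
  have st: "pathstart u = 0" "pathstart l = 0" and fi: "Im (pathfinish u) = 1" "Im (pathfinish l) = -1"
    using k p(4) by (simp_all add: u_def l_def pathstart_def pathfinish_def power_add)
  have rot_u: "path u" "path_image u \<subseteq> unit_square" "path_image u \<inter> T = {}"
    and rot_l: "path l" "path_image l \<subseteq> unit_square" "path_image l \<inter> T = {}"
    using rot[of k] rot[of "k + 2"] unfolding u_def l_def by blast+
  show ?thesis
  proof (rule that[of "reversepath l +++ u"])
    show "path (reversepath l +++ u)"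
      using rot_u(1) rot_l(1) st by simp
    have "path_image (reversepath l +++ u) \<subseteq> path_image l \<union> path_image u"
      using path_image_join_subset[of "reversepath l" u] by (simp only: path_image_reversepath)
    then show "path_image (reversepath l +++ u) \<subseteq> unit_square" "path_image (reversepath l +++ u) \<inter> T = {}"
      using rot_u rot_l by blast+
  qed (simp_all add: fi)
qed

text \<open>The four rotated copies of a crossing curve enclose the centre of the square, and the product
  of the four rotated copies of the function is small on all of them.\<close>

lemma unit_square_crossing_bound:
  fixes h :: "complex \<Rightarrow> complex"
  assumes V: "open V" "unit_square \<subseteq> V" and hol: "h holomorphic_on V"
    and le1: "\<And>z. z \<in> unit_square \<Longrightarrow> cmod (h z) \<le> 1"
    and \<tau>: "path \<tau>" "path_image \<tau> \<subseteq> unit_square"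
      "Re (pathstart \<tau>) = -1" "Re (pathfinish \<tau>) = 1"
    and le: "\<And>z. z \<in> path_image \<tau> \<Longrightarrow> cmod (h z) \<le> e"
  shows "cmod (h 0) ^ 4 \<le> e"
proof -
  define T where "T = (\<Union>k<4. (\<lambda>z. \<i> ^ k * z) ` path_image \<tau>)"
  define P where "P = (\<lambda>z. \<Prod>k<4. h (\<i> ^ k * z))"
  have "compact T"
    unfolding T_def using \<tau>(1)
    by (intro compact_UN finite_lessThan compact_continuous_image continuous_intros compact_path_image) auto
  have T_sub: "T \<subseteq> unit_square"
    unfolding T_def using \<tau>(2) i_times_in_unit_square_iff by (auto simp del: cbox_complex_eq)
  have P_le1: "cmod (P z) \<le> 1" if "z \<in> unit_square" for z
    unfolding P_def prod_norm[symmetric]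
    using le1 that i_times_in_unit_square_iff by (intro prod_le_1) auto
  have P_T: "cmod (P z) \<le> e" if "z \<in> T" for z
  proof -
    from that obtain k y where k: "k < 4" and y: "y \<in> path_image \<tau>" "z = \<i> ^ k * y"
      by (auto simp: T_def)
    \<comment> \<open>The rotation that undoes the \<open>k\<close>-th one; \<open>mod 4\<close>
      covers \<open>k = 0\<close>. The factor of \<open>P\<close> with index \<open>j\<close> is
      evaluated on \<open>\<tau>\<close>, the others are at most 1.\<close>
    define j where "j = (4 - k) mod 4"
    have "j < 4" and jk: "\<i> ^ j * z = y"
    proof -
      show "j < 4" by (simp add: j_def)
      have "k \<in> {0,1,2,3}" using k by auto
      then have "\<i> ^ j * \<i> ^ k = 1"
        by (auto simp: j_def power2_eq_square power3_eq_cube)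
      then show "\<i> ^ j * z = y"
        by (simp add: y flip: mult.assoc)
    qed
    have zs: "z \<in> unit_square" using that T_sub by blast
    have "cmod (P z) = cmod (h (\<i> ^ j * z)) * (\<Prod>k\<in>{..<4} - {j}. cmod (h (\<i> ^ k * z)))"
      unfolding P_def prod_norm[symmetric] using \<open>j < 4\<close> by (subst prod.remove[of _ j]) auto
    also have "\<dots> \<le> cmod (h (\<i> ^ j * z)) * 1"
      using le1 zs i_times_in_unit_square_iff by (intro mult_left_mono prod_le_1) auto
    also have "\<dots> \<le> e"
      using le[OF y(1)] by (simp only: jk mult_1_right)
    finally show ?thesis .
  qed
  have P0: "cmod (P 0) = cmod (h 0) ^ 4"
    by (simp add: P_def norm_power)
  show ?thesis
  proof (cases "0 \<in> T")
    case True
    then show ?thesis using P_T[OF True] P0 by simp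
  next
    case False
    have inv: "\<i> * z \<in> T" if "z \<in> T" for z
    proof -
      from that obtain k y where k: "k < 4" and y: "y \<in> path_image \<tau>" "z = \<i> ^ k * y"
        by (auto simp: T_def)
      have "\<i> * z = \<i> ^ (Suc k mod 4) * y"
        using i_power4_mod[of "Suc k div 4" "Suc k mod 4"] by (simp add: y)
      moreover have "Suc k mod 4 \<in> {..<4}" by simp
      ultimately show ?thesis unfolding T_def using y(1) by blast
    qed
    \<comment> \<open>The maximum principle is applied on the component of the complement of
      \<open>T\<close> around the centre. Its frontier lies in \<open>T\<close>, so it remains to
      see that it does not leave the square, where \<open>P\<close> is controlled.\<close>
    define \<Omega> where "\<Omega> = connected_component_set (- T) 0"
    have "open (- T)" using \<open>compact T\<close> compact_imp_closed by blast
    then have "open \<Omega>" unfolding \<Omega>_def by (rule open_connected_component)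
    have "0 \<in> \<Omega>" using False by (simp add: \<Omega>_def)
    have "\<Omega> \<subseteq> unit_square"
    proof (rule ccontr)
      assume "\<not> \<Omega> \<subseteq> unit_square"
      then obtain x where x: "x \<in> \<Omega>" "x \<notin> unit_square" by blast
      have "path_component (- T) 0 x"
        using x(1) \<open>open (- T)\<close> unfolding \<Omega>_def
        by (simp add: open_path_connected_component)
      then obtain p where p: "path p" "path_image p \<subseteq> - T" "pathstart p = 0" "pathfinish p = x"
        unfolding path_component_def by blast
      have in0: "0 \<in> interior unit_square"
        by (simp add: interior_cbox in_box_complex_iff)
      obtain r where r: "path r" "pathstart r = 0" "path_image r \<subseteq> path_image p"
          "path_image r - {pathfinish r} \<subseteq> interior unit_square" "pathfinish r \<in> frontier unit_square"
      proof (rule exists_path_subpath_to_frontier[OF p(1), of unit_square])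
        show "pathstart p \<in> closure unit_square" "pathfinish p \<notin> unit_square"
          using p(3,4) x(2) in0 interior_subset closure_subset by (simp_all only:) blast+
      qed (use p(3) that in simp)
      have fin: "\<bar>Re (pathfinish r)\<bar> = 1 \<or> \<bar>Im (pathfinish r)\<bar> = 1"
        using r(5) unfolding frontier_def closure_cbox interior_cbox
        by (auto simp: in_box_complex_iff in_cbox_complex_iff)
      have sub: "path_image r \<subseteq> unit_square"
        using r(4,5) interior_subset frontier_subset_closed[OF closed_cbox] by blast
      obtain q where q: "path q" "path_image q \<subseteq> unit_square" "path_image q \<inter> T = {}"
          "Im (pathstart q) = -1" "Im (pathfinish q) = 1"
        using rotation_invariant_path_to_side[OF inv r(1) sub _ r(2) fin] p(2) r(3) by blast
      obtain z where "z \<in> path_image \<tau>" "z \<in> path_image q"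
        using complex_fashoda[of \<tau> q "-1 - \<i>" "1 + \<i>"] \<tau> q by auto
      moreover have "path_image \<tau> \<subseteq> T"
        unfolding T_def by (force intro: bexI[of _ 0])
      ultimately show False using q(3) by blast
    qed
    have clos: "closure \<Omega> \<subseteq> unit_square"
      using \<open>\<Omega> \<subseteq> unit_square\<close> closed_cbox closure_minimal by blast
    have P_hol: "P holomorphic_on unit_square"
    proof -
      have "(\<lambda>z. h (\<i> ^ k * z)) holomorphic_on unit_square" for k
        by (rule holomorphic_on_compose_gen[of "\<lambda>z. \<i> ^ k * z" _ h, unfolded o_def, OF _ hol])
          (use V i_times_in_unit_square_iff in \<open>auto intro!: holomorphic_intros\<close>)
      then show ?thesis unfolding P_def by (intro holomorphic_intros)
    qed
    have "cmod (P 0) \<le> e"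
    proof (rule maximum_modulus_frontier[of P \<Omega>])
      show "P holomorphic_on interior \<Omega>"
        using P_hol \<open>\<Omega> \<subseteq> _\<close> interior_subset holomorphic_on_subset by blast
      show "continuous_on (closure \<Omega>) P"
        using P_hol clos holomorphic_on_imp_continuous_on continuous_on_subset by blast
      show "bounded \<Omega>" using \<open>\<Omega> \<subseteq> _\<close> bounded_cbox bounded_subset by blast
      show "cmod (P z) \<le> e" if "z \<in> frontier \<Omega>" for z
      proof -
        have "\<Omega> \<in> components (- T)"
          using False by (auto simp: \<Omega>_def components_def)
        then have "frontier \<Omega> \<subseteq> T"
          using frontier_of_components_closed_complement[of T] \<open>compact T\<close> compact_imp_closed by blast
        then show ?thesis using that P_T by blast
      qed
    qed (fact \<open>0 \<in> \<Omega>\<close>)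
    then show ?thesis using P0 by simp
  qed
qed

text \<open>Cutting once at \<open>Re z = b\<close> from the front and then once at
  \<open>Re z = a\<close> from the back leaves a piece confined to the vertical strip in
  between.\<close>

lemma crossing_subpath:
  fixes \<tau> :: "real \<Rightarrow> complex"
  assumes \<tau>: "path \<tau>" "Re (pathstart \<tau>) < a" "Re (pathfinish \<tau>) > b" and ab: "a \<le> b"
  obtains \<kappa> where "path \<kappa>" "path_image \<kappa> \<subseteq> path_image \<tau>" "Re (pathstart \<kappa>) = a" "Re (pathfinish \<kappa>) = b"
    "\<And>z. z \<in> path_image \<kappa> \<Longrightarrow> a \<le> Re z \<and> Re z \<le> b"
proof -
  have cl: "closed {z. Re z \<le> b}" "closed {z. Re z \<ge> a}"
    by (intro closed_Collect_le continuous_intros)+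
  have op: "open {z. Re z < b}" "open {z. Re z > a}"
    by (intro open_Collect_less continuous_intros)+
  have fr: "Re z = b" if "z \<in> frontier {z. Re z \<le> b}" for z
    using that frontier_subset_closed[OF cl(1)] interior_maximal[OF _ op(1), of "{z. Re z \<le> b}"]
    by (force simp: frontier_def)
  have fr': "Re z = a" if "z \<in> frontier {z. Re z \<ge> a}" for z
    using that frontier_subset_closed[OF cl(2)] interior_maximal[OF _ op(2), of "{z. Re z \<ge> a}"]
    by (force simp: frontier_def)
  obtain h where h: "path h" "pathstart h = pathstart \<tau>" "path_image h \<subseteq> path_image \<tau> \<inter> {z. Re z \<le> b}"
      "pathfinish h \<in> frontier {z. Re z \<le> b}"
    by (rule exists_path_subpath_to_frontier_closed[OF cl(1) \<tau>(1)]) (use \<tau> ab in auto)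
  obtain k where k: "path k" "pathstart k = pathstart (reversepath h)"
      "path_image k \<subseteq> path_image (reversepath h) \<inter> {z. Re z \<ge> a}" "pathfinish k \<in> frontier {z. Re z \<ge> a}"
    by (rule exists_path_subpath_to_frontier_closed[OF cl(2), of "reversepath h"])
      (use h fr[OF h(4)] \<tau> ab in auto)
  show ?thesis
    by (rule that[of "reversepath k"]) (use h k fr[OF h(4)] fr'[OF k(4)] in auto)
qed

text \<open>The strip is open, whereas the crossing bound asks for a closed square inside the
  domain. By compactness the curve stays at height at most some \<open>\<rho> < 1\<close>; the
  square of half-side \<open>\<rho>\<close> around \<open>x\<close> is still crossed and fits into
  the strip.\<close>

lemma strip_crossing_bound:
  fixes h :: "complex \<Rightarrow> complex"
  assumes hol: "h holomorphic_on {z. \<bar>Im z\<bar> < 1}"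
    and le1: "\<And>z. \<bar>Im z\<bar> < 1 \<Longrightarrow> cmod (h z) \<le> 1"
    and \<tau>: "path \<tau>" "\<And>z. z \<in> path_image \<tau> \<Longrightarrow> \<bar>Im z\<bar> < 1"
      "Re (pathstart \<tau>) \<le> x - 1" "Re (pathfinish \<tau>) \<ge> x + 1"
    and le: "\<And>z. z \<in> path_image \<tau> \<Longrightarrow> cmod (h z) \<le> e"
  shows "cmod (h (of_real x)) ^ 4 \<le> e"
proof -
  have "compact ((\<lambda>z. \<bar>Im z\<bar>) ` path_image \<tau>)"
    using \<tau>(1) by (intro compact_continuous_image continuous_intros compact_path_image)
  moreover have "path_image \<tau> \<noteq> {}" by simp
  ultimately obtain w where w: "w \<in> path_image \<tau>" "\<And>z. z \<in> path_image \<tau> \<Longrightarrow> \<bar>Im z\<bar> \<le> \<bar>Im w\<bar>"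
    using compact_attains_sup[of "(\<lambda>z. \<bar>Im z\<bar>) ` path_image \<tau>"] by auto
  define \<rho> where "\<rho> = (1 + \<bar>Im w\<bar>) / 2"
  have \<rho>: "0 < \<rho>" "\<rho> < 1" "\<bar>Im w\<bar> \<le> \<rho>"
    using \<tau>(2)[OF w(1)] by (auto simp: \<rho>_def)
  obtain \<kappa> where \<kappa>: "path \<kappa>" "path_image \<kappa> \<subseteq> path_image \<tau>" "Re (pathstart \<kappa>) = x - \<rho>" "Re (pathfinish \<kappa>) = x + \<rho>"
    "\<And>z. z \<in> path_image \<kappa> \<Longrightarrow> x - \<rho> \<le> Re z \<and> Re z \<le> x + \<rho>"
    by (rule crossing_subpath[OF \<tau>(1), of "x - \<rho>" "x + \<rho>"]) (use \<tau> \<rho> in auto)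
  define h' where "h' = (\<lambda>z. h (of_real x + of_real \<rho> * z))"
  define \<kappa>' where "\<kappa>' = (\<lambda>t. (\<kappa> t - of_real x) / of_real \<rho>)"
  define V where "V = {z. \<bar>Im (of_real x + of_real \<rho> * z)\<bar> < 1}"
  have im: "path_image \<kappa>' = (\<lambda>z. (z - of_real x) / of_real \<rho>) ` path_image \<kappa>"
    by (auto simp: path_image_def \<kappa>'_def)
  have VV: "\<bar>Im (of_real x + of_real \<rho> * z)\<bar> < 1" if "z \<in> unit_square" for z
  proof -
    have "\<bar>Im z\<bar> \<le> 1" using that in_unit_square_iff by blast
    then have "\<rho> * \<bar>Im z\<bar> \<le> \<rho> * 1" using \<rho> by (intro mult_left_mono) auto
    then have "\<rho> * \<bar>Im z\<bar> < 1" using \<rho> by linarith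
    then show ?thesis using \<rho> by (simp add: abs_mult)
  qed
  have bk: "of_real x + of_real \<rho> * ((z - of_real x) / of_real \<rho>) = z" for z :: complex
    using \<rho>(1) by (simp add: field_simps)
  have "cmod (h' 0) ^ 4 \<le> e"
  proof (rule unit_square_crossing_bound[of V h' \<kappa>'])
    show "open V" unfolding V_def by (intro open_Collect_less continuous_intros)
    show "unit_square \<subseteq> V" unfolding V_def using VV by blast
    show "h' holomorphic_on V" unfolding h'_def
      by (rule holomorphic_on_compose_gen[of "\<lambda>z. of_real x + of_real \<rho> * z" _ h, unfolded o_def, OF _ hol])
        (auto intro!: holomorphic_intros simp: V_def)
    show "cmod (h' z) \<le> 1" if "z \<in> unit_square" for z
      unfolding h'_def using VV[OF that] by (rule le1)
    show "path \<kappa>'" using \<kappa>(1) \<rho> unfolding path_def \<kappa>'_def by (intro continuous_intros) auto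
    show "path_image \<kappa>' \<subseteq> unit_square"
    proof -
      have "(z - of_real x) / of_real \<rho> \<in> unit_square" if z: "z \<in> path_image \<kappa>" for z
        unfolding in_unit_square_iff using \<kappa>(5)[OF z] w(2)[OF subsetD[OF \<kappa>(2) z]] \<rho>
        by (auto simp: abs_le_iff divide_simps)
      then show ?thesis unfolding im by blast
    qed
    show "Re (pathstart \<kappa>') = -1" "Re (pathfinish \<kappa>') = 1"
      using \<kappa>(3,4) \<rho> by (simp_all add: \<kappa>'_def pathstart_def pathfinish_def)
    show "cmod (h' z) \<le> e" if "z \<in> path_image \<kappa>'" for z
    proof -
      obtain w where "w \<in> path_image \<kappa>" "z = (w - of_real x) / of_real \<rho>"
        using \<open>z \<in> path_image \<kappa>'\<close> unfolding im by blast
      then show ?thesis unfolding h'_def using le \<kappa>(2) by (simp only: bk) blast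
    qed
  qed
  then show ?thesis by (simp add: h'_def)
qed

section \<open>Koebe's lemma and Lindelof's theorem\<close>

text \<open>The derivative of \<open>exp\<close> has modulus at most 1 on the left half-plane. Hence
  a curve in the disc with endpoints far apart has a logarithm with endpoints at least as far
  apart.\<close>

lemma norm_exp_diff_le:
  assumes "Re a \<le> 0" "Re b \<le> 0"
  shows "cmod (exp a - exp b) \<le> cmod (a - b)"
proof -
  have "cmod (exp a - exp b) \<le> 1 * cmod (a - b)"
  proof (rule field_differentiable_bound[of "{z. Re z \<le> 0}" exp exp])
    show "convex {z. Re z \<le> 0}" by (rule convex_halfspace_Re_le)
  qed (use assms in \<open>auto intro!: derivative_eq_intros\<close>)
  then show ?thesis by simp
qed

text \<open>Koebe's lemma. In the coordinate \<open>log z\<close> a long curve near the unit circle crosses a square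
  of fixed size; hence a small value on the curve forces a small value at the centre.\<close>

lemma Koebe_arc_lemma:
  fixes h :: "complex \<Rightarrow> complex"
  assumes hol: "h holomorphic_on ball 0 1" and le1: "\<And>z. cmod z < 1 \<Longrightarrow> cmod (h z) \<le> 1"
    and nz: "\<And>z. cmod z < 1 \<Longrightarrow> h z \<noteq> 0" and "d > 0"
  obtains e where "e > 0"
    "\<And>s. path s \<Longrightarrow> path_image s \<subseteq> ball 0 1 \<Longrightarrow> (\<And>z. z \<in> path_image s \<Longrightarrow> cmod (h z) < e)
       \<Longrightarrow> dist (pathstart s) (pathfinish s) < d"
proof -
  \<comment> \<open>The curve will lie in the annulus between radii exp(-2R) and 1, where its
    logarithm has real part in an interval of length 2R. Endpoints at distance at least d = 8R then
    force the imaginary part to vary by at least 6R, more than the 2R that crosses a square of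
    half-side R.\<close>
  define R where "R = d / 8"
  have "R > 0" using \<open>d > 0\<close> by (simp add: R_def)
  have cont: "continuous_on (cball 0 (exp (-R))) (\<lambda>z. cmod (h z))"
    by (intro continuous_intros continuous_on_subset[OF holomorphic_on_imp_continuous_on[OF hol]])
      (use \<open>R > 0\<close> in \<open>auto simp: subset_iff intro: le_less_trans\<close>)
  obtain z0 where z0: "cmod z0 \<le> exp (-R)" "\<And>z. cmod z \<le> exp (-R) \<Longrightarrow> cmod (h z0) \<le> cmod (h z)"
    using continuous_attains_inf[OF compact_cball _ cont] by auto
  define m where "m = cmod (h z0)"
  have z0': "cmod z0 < 1" using z0(1) \<open>R > 0\<close> by (auto intro: le_less_trans)
  have m: "0 < m" "m \<le> 1" using nz[OF z0'] le1[OF z0'] by (auto simp: m_def)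
  have m_le: "m \<le> cmod (h z)" if "cmod z \<le> exp (-R)" for z
    using z0(2) that by (simp add: m_def)
  \<comment> \<open>Below \<open>m\<close>, which keeps the curve out of the disc of radius
    \<open>exp (-R)\<close>, and below \<open>m ^ 4\<close>, which contradicts the crossing bound at
    a point of the circle of that radius.\<close>
  define e where "e = m ^ 4 / 2"
  have "e > 0" using m by (simp add: e_def)
  have "m ^ 4 \<le> m" using m power_decreasing[of 1 4 m] by simp
  have "e < m ^ 4" and "e < m" using m \<open>m ^ 4 \<le> m\<close> by (simp_all add: e_def)
  have main: False
    if s: "path s" "path_image s \<subseteq> ball 0 1" "\<And>z. z \<in> path_image s \<Longrightarrow> cmod (h z) < e"
      and far: "d \<le> dist (pathstart s) (pathfinish s)" for s
  proof -
    have big: "exp (-2 * R) < cmod z" "cmod z < 1" if "z \<in> path_image s" for z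
    proof -
      have "\<not> cmod z \<le> exp (-R)" using m_le[of z] s(3)[OF that] \<open>e < m\<close> by linarith
      moreover have "exp (-2 * R) \<le> exp (-R)" using \<open>R > 0\<close> by simp
      ultimately show "exp (-2 * R) < cmod z" by linarith
      show "cmod z < 1" using s(2) that by auto
    qed
    have nz0: "s t \<noteq> 0" if "t \<in> {0..1}" for t
    proof -
      have "exp (-2 * R) < cmod (s t)" using big(1)[of "s t"] that by (auto simp: path_image_def)
      then show ?thesis using exp_gt_zero[of "-2 * R"] by (metis norm_zero order.asym)
    qed
    \<comment> \<open>The curve may wind around the origin, so the logarithm is continued along the
      parameter interval instead of being chosen on the disc.\<close>
    obtain g where g: "continuous_on {0..1} g" "\<And>t. t \<in> {0..1} \<Longrightarrow> s t = exp (g t)"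
      using continuous_logarithm_on_contractible[OF s(1)[unfolded path_def] convex_imp_contractible[OF convex_closed_interval] nz0]
      by auto
    have Re_g: "-2 * R < Re (g t)" "Re (g t) < 0" if "t \<in> {0..1}" for t
    proof -
      have "exp (-2 * R) < exp (Re (g t))" "exp (Re (g t)) < 1"
        using big[of "s t"] imageI[OF that, of s] g(2)[OF that] by (simp_all add: path_image_def)
      then show "-2 * R < Re (g t)" "Re (g t) < 0" by simp_all
    qed
    have "d \<le> cmod (g 0 - g 1)"
      using far norm_exp_diff_le[of "g 0" "g 1"] Re_g[of 0] Re_g[of 1] g(2)[of 0] g(2)[of 1]
      by (simp add: dist_norm pathstart_def pathfinish_def)
    also have "\<dots> \<le> \<bar>Re (g 0 - g 1)\<bar> + \<bar>Im (g 0 - g 1)\<bar>"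
      by (rule cmod_le)
    finally have gap: "d - 2 * R \<le> \<bar>Im (g 0) - Im (g 1)\<bar>"
      using Re_g[of 0] Re_g[of 1] by simp
    obtain g' where g': "path g'" "path_image g' = path_image g" "Im (pathstart g') + 6 * R \<le> Im (pathfinish g')"
    proof (cases "Im (g 0) \<le> Im (g 1)")
      case True
      then show ?thesis using that[of g] g(1) gap by (simp add: path_def pathstart_def pathfinish_def R_def)
    next
      case False
      then show ?thesis using that[of "reversepath g"] g(1) gap
        by (simp add: path_def[symmetric]) (simp add: pathstart_def pathfinish_def R_def)
    qed
    \<comment> \<open>The coordinate R (i x - 1) maps the strip |Im x| < 1 onto -2R < Re < 0 and the
      real axis onto Re = -R. \<open>T\<close> is the suitably oriented logarithm of the curve in
      this coordinate and \<open>H\<close> is \<open>h\<close> in it; on the real axis |H| is at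
      least \<open>m\<close>.\<close>
    define T where "T = (\<lambda>t. - \<i> * (g' t / of_real R + 1))"
    define H where "H = (\<lambda>x. h (exp (of_real R * (\<i> * x - 1))))"
    define x where "x = (Im (pathstart g') + Im (pathfinish g')) / (2 * R)"
    have less1: "cmod (exp (of_real R * (\<i> * z - 1))) < 1" if "\<bar>Im z\<bar> < 1" for z
      using that \<open>R > 0\<close> by (simp add: mult_less_0_iff)
    have T_im: "path_image T = (\<lambda>w. - \<i> * (w / of_real R + 1)) ` path_image g'"
      by (auto simp: T_def path_image_def)
    have bk: "of_real R * (\<i> * (- \<i> * (w / of_real R + 1)) - 1) = w" for w :: complex
      using \<open>R > 0\<close> by (simp add: field_simps)
    have gg: "\<exists>t\<in>{0..1}. z = g t" if "z \<in> path_image g'" for z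
      using that g'(2) by (auto simp: path_image_def)
    have "cmod (H (of_real x)) ^ 4 \<le> e"
    proof (rule strip_crossing_bound[of H T])
      show "H holomorphic_on {z. \<bar>Im z\<bar> < 1}"
        unfolding H_def
        by (rule holomorphic_on_compose_gen[of "\<lambda>x. exp (of_real R * (\<i> * x - 1))" _ h, unfolded o_def, OF _ hol])
          (use less1 in \<open>auto intro!: holomorphic_intros\<close>)
      show "cmod (H z) \<le> 1" if "\<bar>Im z\<bar> < 1" for z
        unfolding H_def by (rule le1[OF less1[OF that]])
      show "path T" using g'(1) \<open>R > 0\<close> unfolding path_def T_def by (intro continuous_intros) auto
      show "\<bar>Im z\<bar> < 1" if "z \<in> path_image T" for z
      proof -
        obtain t where t: "t \<in> {0..1}" "z = - \<i> * (g t / of_real R + 1)"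
            using \<open>z \<in> path_image T\<close> gg unfolding T_im by blast
        then have "Im z = - (Re (g t) / R + 1)" by simp
        then show ?thesis using divide_strict_right_mono[OF Re_g(1)[OF t(1)] \<open>R > 0\<close>]
          divide_strict_right_mono[OF Re_g(2)[OF t(1)] \<open>R > 0\<close>] \<open>R > 0\<close> by (auto simp: abs_less_iff)
      qed
      have "Re (pathstart T) = Im (pathstart g') / R" "Re (pathfinish T) = Im (pathfinish g') / R"
        by (simp_all add: T_def pathstart_def pathfinish_def)
      moreover have "x = (Im (pathstart g') / R + Im (pathfinish g') / R) / 2"
        by (simp add: x_def add_divide_distrib)
      moreover have "Im (pathstart g') / R + 6 \<le> Im (pathfinish g') / R"
        using divide_right_mono[OF g'(3), of R] \<open>R > 0\<close> by (simp add: add_divide_distrib)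
      ultimately show "Re (pathstart T) \<le> x - 1" "x + 1 \<le> Re (pathfinish T)" by simp_all
      show "cmod (H z) \<le> e" if "z \<in> path_image T" for z
      proof -
        obtain w where w: "w \<in> path_image g'" "z = - \<i> * (w / of_real R + 1)"
          using \<open>z \<in> path_image T\<close> unfolding T_im by blast
        obtain t where t: "t \<in> {0..1}" "w = g t" using gg[OF w(1)] by blast
        have "H z = h (s t)"
          unfolding H_def w(2) bk using g(2)[OF t(1)] t(2) by simp
        moreover have "s t \<in> path_image s" using t(1) by (auto simp: path_image_def)
        ultimately show ?thesis using s(3)[of "s t"] by simp
      qed
    qed
    moreover have "m \<le> cmod (H (of_real x))"
      unfolding H_def by (rule m_le) simp
    then have "m ^ 4 \<le> cmod (H (of_real x)) ^ 4" using m by (intro power_mono) auto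
    ultimately show False using \<open>e < m ^ 4\<close> by linarith
  qed
  show ?thesis
    by (rule that[OF \<open>e > 0\<close>]) (rule ccontr, rule main, auto simp: not_less)
qed

text \<open>Koebe's lemma applied to the tails of the curve is the Cauchy criterion. A limit inside
  the disc would be a zero of \<open>h\<close> by continuity.\<close>

lemma lands_if_tendsto_0:
  fixes h :: "complex \<Rightarrow> complex" and \<sigma> :: "real \<Rightarrow> complex"
  assumes hol: "h holomorphic_on ball 0 1" and le1: "\<And>z. cmod z < 1 \<Longrightarrow> cmod (h z) \<le> 1"
    and nz: "\<And>z. cmod z < 1 \<Longrightarrow> h z \<noteq> 0"
    and \<sigma>: "continuous_on {0..<1} \<sigma>" "\<sigma> ` {0..<1} \<subseteq> ball 0 1"
    and lim: "((\<lambda>t. h (\<sigma> t)) \<longlongrightarrow> 0) (at_left 1)"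
  obtains \<zeta> where "cmod \<zeta> = 1" "(\<sigma> \<longlongrightarrow> \<zeta>) (at_left 1)"
proof -
  have ev: "\<exists>t0. 0 \<le> t0 \<and> t0 < 1 \<and> (\<forall>t u. t0 \<le> t \<longrightarrow> t < 1 \<longrightarrow> t0 \<le> u \<longrightarrow> u < 1 \<longrightarrow> dist (\<sigma> t) (\<sigma> u) < d)" if "d > 0" for d
  proof -
    obtain e where e: "e > 0"
    "\<And>s. path s \<Longrightarrow> path_image s \<subseteq> ball 0 1 \<Longrightarrow> (\<And>z. z \<in> path_image s \<Longrightarrow> cmod (h z) < e)
       \<Longrightarrow> dist (pathstart s) (pathfinish s) < d"
      using Koebe_arc_lemma[OF hol le1 nz \<open>d > 0\<close>] by metis
    have "eventually (\<lambda>t. cmod (h (\<sigma> t)) < e) (at_left 1)"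
      using order_tendstoD(2)[OF tendsto_norm[OF lim], of e] e(1) by simp
    then obtain b where b: "b < 1" "\<And>t. b < t \<Longrightarrow> t < 1 \<Longrightarrow> cmod (h (\<sigma> t)) < e"
      unfolding eventually_at_left_field by blast
    define t0 where "t0 = max 0 ((b + 1) / 2)"
    have t0: "0 \<le> t0" "t0 < 1" "b < t0" using b(1) by (auto simp: t0_def less_max_iff_disj)
    have "dist (\<sigma> t) (\<sigma> u) < d" if tu: "t0 \<le> t" "t < 1" "t0 \<le> u" "u < 1" for t u
    proof -
      define s where "s = \<sigma> \<circ> linepath t u"
      have seg: "linepath t u ` {0..1} \<subseteq> {t0..<1}"
        using tu closed_segment_subset[of t "{t0..<1}" u] convex_real_interval
        by (simp add: linepath_image_01)
      have "path s"
        unfolding s_def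
        by (rule path_continuous_image) (use seg t0 in \<open>auto simp: path_image_def intro!: continuous_on_subset[OF \<sigma>(1)]\<close>)
      moreover have im: "path_image s = \<sigma> ` (linepath t u ` {0..1})"
        by (simp add: s_def path_image_def image_comp)
      moreover have "cmod (h z) < e" if "z \<in> path_image s" for z
      proof -
        obtain w where w: "w \<in> linepath t u ` {0..1}" "z = \<sigma> w" using \<open>z \<in> path_image s\<close> unfolding im by blast
        then have "b < w" "w < 1" using subsetD[OF seg w(1)] t0 by auto
        then show ?thesis using b(2) w(2) by blast
      qed
      moreover have "path_image s \<subseteq> ball 0 1"
      proof -
        have "linepath t u ` {0..1} \<subseteq> {0..<1}" using order_trans[OF seg] t0(1) by auto
        then show ?thesis unfolding im using \<sigma>(2) by blast
      qed
      ultimately show ?thesis using e(2)[of s] by (simp add: s_def pathstart_compose pathfinish_compose)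
    qed
    then show ?thesis using t0 by blast
  qed
  have "cauchy_filter (filtermap \<sigma> (at_left 1))"
    unfolding cauchy_filter_metric_filtermap
  proof (intro allI impI)
    fix d :: real assume "d > 0"
    obtain t0 where t0: "0 \<le> t0" "t0 < 1" "\<And>t u. t0 \<le> t \<Longrightarrow> t < 1 \<Longrightarrow> t0 \<le> u \<Longrightarrow> u < 1 \<Longrightarrow> dist (\<sigma> t) (\<sigma> u) < d"
      using ev[OF \<open>d > 0\<close>] by blast
    show "\<exists>P. eventually P (at_left 1) \<and> (\<forall>x y. P x \<and> P y \<longrightarrow> dist (\<sigma> x) (\<sigma> y) < d)"
      by (rule exI[of _ "\<lambda>t. t0 < t \<and> t < 1"]) (use t0 eventually_at_left_real[OF t0(2)] in \<open>auto simp: less_imp_le\<close>)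
  qed
  then have "\<exists>\<zeta>. filtermap \<sigma> (at_left 1) \<le> nhds \<zeta>"
    by (rule cauchy_filter_complete_converges[of _ UNIV]) (auto simp: complete_UNIV filtermap_bot_iff)
  then obtain \<zeta> where \<zeta>: "(\<sigma> \<longlongrightarrow> \<zeta>) (at_left 1)"
    unfolding filterlim_def by blast
  have evt: "eventually (\<lambda>t. t \<in> {0..<1}) (at_left (1::real))"
    unfolding eventually_at_left_field by (rule exI[of _ 0]) auto
  have "cmod \<zeta> \<le> 1"
    by (rule tendsto_upperbound[OF tendsto_norm[OF \<zeta>]])
      (use evt \<sigma>(2) in \<open>auto elim!: eventually_mono simp: image_subset_iff less_imp_le\<close>)
  moreover have "\<not> cmod \<zeta> < 1"
  proof
    assume l: "cmod \<zeta> < 1"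
    have "isCont h \<zeta>"
      using holomorphic_on_imp_continuous_on[OF hol] l by (simp add: continuous_on_eq_continuous_at)
    then have "((\<lambda>t. h (\<sigma> t)) \<longlongrightarrow> h \<zeta>) (at_left 1)"
      by (rule isCont_tendsto_compose[OF _ \<zeta>])
    then have "h \<zeta> = 0" using lim tendsto_unique[of "at_left (1::real)"] by force
    then show False using nz[OF l] by simp
  qed
  ultimately show ?thesis using that[OF _ \<zeta>] by linarith
qed

section \<open>The Cayley transform and Lindelof's theorem\<close>

lemma Re_Cayley_pos:
  assumes "cmod z < 1" shows "Re ((1 + z) / (1 - z)) > 0"
proof -
  have "(cmod z)\<^sup>2 < 1" using assms by (simp add: power_less_one_iff)
  then have "1 - (Re z)\<^sup>2 - (Im z)\<^sup>2 > 0" by (simp add: cmod_power2)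
  moreover have "z \<noteq> 1" using assms by auto
  then have "(1 - Re z)\<^sup>2 + (Im z)\<^sup>2 > 0"
    by (auto simp: complex_eq_iff sum_power2_gt_zero_iff)
  ultimately show ?thesis
    by (simp add: Re_divide power2_eq_square algebra_simps zero_less_divide_iff)
qed

lemma norm_Cayley_inverse_less_1:
  assumes "Re u > 0" shows "cmod ((u - 1) / (u + 1)) < 1"
proof -
  have "(cmod (u - 1))\<^sup>2 < (cmod (u + 1))\<^sup>2"
    unfolding cmod_power2 using assms by (simp add: power2_eq_square algebra_simps)
  then have "cmod (u - 1) < cmod (u + 1)" by (rule power2_less_imp_less) simp
  then show ?thesis by (simp add: norm_divide divide_less_eq) 
qed

text \<open>The logarithm of the Cayley transform, scaled by 2/pi, maps the disc onto the strip |Im|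
  < 1, the radius into the real axis and the boundary point 1 to the right end. A curve ending at 1
  therefore crosses all squares centred far out on the real axis, and the bound at their centres is
  a bound on the radius.\<close>

lemma Lindelof_at_1:
  fixes k :: "complex \<Rightarrow> complex" and \<sigma> :: "real \<Rightarrow> complex"
  assumes hol: "k holomorphic_on ball 0 1" and le1: "\<And>z. cmod z < 1 \<Longrightarrow> cmod (k z) \<le> 1"
    and \<sigma>: "continuous_on {0..<1} \<sigma>" "\<sigma> ` {0..<1} \<subseteq> ball 0 1" "(\<sigma> \<longlongrightarrow> 1) (at_left 1)"
    and lim: "((\<lambda>t. k (\<sigma> t)) \<longlongrightarrow> 0) (at_left 1)"
  shows "((\<lambda>r::real. k (of_real r)) \<longlongrightarrow> 0) (at_left 1)"
proof -
  \<comment> \<open>\<open>E\<close> leads from the strip back to the disc; \<open>T\<close> is the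
    given curve seen in the strip.\<close>
  define E where "E = (\<lambda>x. (exp (of_real (pi / 2) * x) - 1) / (exp (of_real (pi / 2) * x) + 1) :: complex)"
  define u where "u = (\<lambda>t. (1 + \<sigma> t) / (1 - \<sigma> t))"
  define T where "T = (\<lambda>t. of_real (2 / pi) * Ln (u t))"
  have Re_exp: "Re (exp (of_real (pi / 2) * x)) > 0" if "\<bar>Im x\<bar> < 1" for x
  proof -
    have "cos (pi / 2 * Im x) > 0"
      using that mult_strict_left_mono[of "Im x" 1 "pi / 2"] mult_strict_left_mono[of "-1" "Im x" "pi / 2"]
      by (intro cos_gt_zero_pi) (auto simp: abs_less_iff)
    then show ?thesis by (simp add: Re_exp)
  qed
  have E1: "cmod (E x) < 1" if "\<bar>Im x\<bar> < 1" for x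
    unfolding E_def by (rule norm_Cayley_inverse_less_1[OF Re_exp[OF that]])
  have \<sigma>1: "cmod (\<sigma> t) < 1" if "0 \<le> t" "t < 1" for t
    using \<sigma>(2) that by (auto simp: image_subset_iff)
  have Re_u: "Re (u t) > 0" if "0 \<le> t" "t < 1" for t
    unfolding u_def by (rule Re_Cayley_pos[OF \<sigma>1[OF that]])
  have Im_T: "\<bar>Im (T t)\<bar> < 1" if "0 \<le> t" "t < 1" for t
  proof -
    have "u t \<noteq> 0" using Re_u[OF that] by auto
    then have "\<bar>Im (Ln (u t))\<bar> < pi / 2" using Re_Ln_pos_lt Re_u[OF that] by blast
    then show ?thesis by (simp add: T_def abs_mult field_simps)
  qed
  have Re_T: "Re (T t) = 2 / pi * ln (cmod (u t))" if "0 \<le> t" "t < 1" for t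
    using Re_u[OF that] by (subgoal_tac "u t \<noteq> 0") (auto simp: T_def)
  have ET: "E (T t) = \<sigma> t" if "0 \<le> t" "t < 1" for t
  proof -
    have "u t \<noteq> 0" using Re_u[OF that] by auto
    moreover have "\<sigma> t \<noteq> 1" using \<sigma>1[OF that] by auto
    ultimately have "E (T t) = (u t - 1) / (u t + 1)" by (simp add: E_def T_def)
    also have "\<dots> = \<sigma> t" using \<open>\<sigma> t \<noteq> 1\<close> by (simp add: u_def divide_simps)
    finally show ?thesis .
  qed
  have E_hol: "E holomorphic_on {z. \<bar>Im z\<bar> < 1}"
  proof -
    have "exp (of_real (pi / 2) * x) + 1 \<noteq> 0" if "\<bar>Im x\<bar> < 1" for x
    proof
      assume "exp (of_real (pi / 2) * x) + 1 = 0"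
      then have "Re (exp (of_real (pi / 2) * x)) = -1" by (simp add: eq_neg_iff_add_eq_0[symmetric])
      then show False using Re_exp[OF that] by linarith
    qed
    then show ?thesis unfolding E_def by (intro holomorphic_intros) auto
  qed
  have T_cont: "continuous_on {0..<1} T"
    unfolding T_def u_def
  proof (intro continuous_intros \<sigma>(1) ballI)
    show "1 - \<sigma> t \<noteq> 0" if "t \<in> {0..<1}" for t using \<sigma>1[of t] that by auto
    show "(1 + \<sigma> t) / (1 - \<sigma> t) \<notin> \<real>\<^sub>\<le>\<^sub>0" if "t \<in> {0..<1}" for t
      using Re_u[of t] that by (auto simp: u_def complex_nonpos_Reals_iff)
  qed
  have evt: "eventually (\<lambda>t. t \<in> {0<..<1}) (at_left (1::real))"
    by (rule eventually_at_left_real) simp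
  have u_inf: "filterlim u at_infinity (at_left 1)"
  proof -
    have lim2: "((\<lambda>t. 1 + \<sigma> t) \<longlongrightarrow> 1 + 1) (at_left 1)" by (intro tendsto_intros \<sigma>)
    have "((\<lambda>t. 1 - \<sigma> t) \<longlongrightarrow> 0) (at_left 1)" by (rule tendsto_eq_intros \<sigma> | simp)+
    moreover have "eventually (\<lambda>t. 1 - \<sigma> t \<noteq> 0) (at_left 1)"
      using evt
    proof (rule eventually_mono)
      fix t :: real assume "t \<in> {0<..<1}"
      then have "cmod (\<sigma> t) < 1" by (intro \<sigma>1) auto
      then show "1 - \<sigma> t \<noteq> 0" by auto
    qed
    ultimately have "filterlim (\<lambda>t. 1 - \<sigma> t) (at 0) (at_left 1)"
      by (intro filterlim_atI)
    then have "filterlim (\<lambda>t. inverse (1 - \<sigma> t)) at_infinity (at_left 1)"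
      by (rule filterlim_compose[OF filterlim_inverse_at_infinity])
    from tendsto_mult_filterlim_at_infinity[OF lim2 _ this]
    show ?thesis by (simp add: u_def divide_inverse)
  qed
  show ?thesis
  proof (rule tendstoI)
    fix \<epsilon> :: real assume "\<epsilon> > 0"
    define e where "e = (\<epsilon> / 2) ^ 4"
    have "e > 0" using \<open>\<epsilon> > 0\<close> by (simp add: e_def)
    have "eventually (\<lambda>t. cmod (k (\<sigma> t)) < e) (at_left 1)"
      using order_tendstoD(2)[OF tendsto_norm[OF lim], of e] \<open>e > 0\<close> by simp
    then obtain b where b: "b < 1" "\<And>t. b < t \<Longrightarrow> t < 1 \<Longrightarrow> cmod (k (\<sigma> t)) < e"
      unfolding eventually_at_left_field by blast
    define t0 where "t0 = max 0 ((b + 1) / 2)"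
    have t0: "0 \<le> t0" "t0 < 1" "b < t0" using b(1) by (auto simp: t0_def less_max_iff_disj)
    \<comment> \<open>For \<open>r > 1 - 1 / M\<close> the strip coordinate \<open>x\<close> of
      \<open>r\<close> satisfies \<open>Re (T t0) \<le> x - 1\<close>, so the curve followed from
      \<open>t0\<close> starts to the left of the square around \<open>x\<close>.\<close>
    define M where "M = exp (pi / 2 * (Re (T t0) + 1))"
    have "M > 0" by (simp add: M_def)
    have bound: "cmod (k (of_real r)) < \<epsilon>" if r: "max 0 (1 - 1 / M) < r" "r < 1" for r :: real
    proof -
      have "1 / M > 1 - r" using r by auto
      then have "M < 1 / (1 - r)" using r \<open>M > 0\<close> by (simp add: field_simps)
      also have "\<dots> \<le> (1 + r) / (1 - r)" using r by (intro divide_right_mono) auto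
      finally have M: "M < (1 + r) / (1 - r)" .
      define x where "x = 2 / pi * ln ((1 + r) / (1 - r))"
      have "pi / 2 * (Re (T t0) + 1) < ln ((1 + r) / (1 - r))"
        using M \<open>M > 0\<close> unfolding M_def by (metis exp_gt_zero ln_exp ln_less_cancel_iff order_less_trans)
      then have x1: "Re (T t0) \<le> x - 1" unfolding x_def by (simp add: field_simps)
      have expx: "exp (of_real (pi / 2) * of_real x) = (of_real ((1 + r) / (1 - r)) :: complex)"
      proof -
        have "pi / 2 * x = ln ((1 + r) / (1 - r))" by (simp add: x_def)
        moreover have "(1 + r) / (1 - r) > 0" using r by simp
        ultimately have "exp (pi / 2 * x) = (1 + r) / (1 - r)" by simp
        then show ?thesis by (metis exp_of_real of_real_mult)
      qed
      have Ex: "E (of_real x) = of_real r"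
        unfolding E_def expx using r
        by (simp add: divide_simps complex_eq_iff)
      \<comment> \<open>The Cayley transform of the curve tends to infinity, so some later point
        lies to the right of the square.\<close>
      obtain t1 where t1: "t0 < t1" "t1 < 1" "exp (pi / 2 * (x + 1)) \<le> cmod (u t1)"
      proof -
        have "eventually (\<lambda>t. exp (pi / 2 * (x + 1)) \<le> cmod (u t)) (at_left 1)"
          using u_inf exp_gt_zero by (subst (asm) filterlim_at_infinity[of 0]) auto
        moreover have "eventually (\<lambda>t. t \<in> {t0<..<1}) (at_left 1)"
          by (rule eventually_at_left_real[OF t0(2)])
        ultimately have "eventually (\<lambda>t. exp (pi / 2 * (x + 1)) \<le> cmod (u t) \<and> t \<in> {t0<..<1}) (at_left 1)"
          by eventually_elim auto
        then show thesis using that eventually_happens'[OF trivial_limit_at_left_real] by force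
      qed
      have "pi / 2 * (x + 1) \<le> ln (cmod (u t1))"
        using t1(3) by (metis exp_gt_zero ln_exp ln_le_cancel_iff order_less_le_trans)
      then have x2: "x + 1 \<le> Re (T t1)"
        using Re_T[of t1] t0 t1 by (simp add: pos_le_divide_eq mult.commute distrib_right)
      have seg: "w \<in> linepath t0 t1 ` {0..1} \<Longrightarrow> t0 \<le> w \<and> w \<le> t1" for w
        using closed_segment_eq_real_ivl1[of t0 t1] t1 by (simp add: linepath_image_01)
      have "cmod ((k \<circ> E) (of_real x)) ^ 4 \<le> e"
      proof (rule strip_crossing_bound[of "k \<circ> E" "T \<circ> linepath t0 t1"])
        show "k \<circ> E holomorphic_on {z. \<bar>Im z\<bar> < 1}"
          by (rule holomorphic_on_compose_gen[OF E_hol hol]) (use E1 in auto)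
        show "cmod ((k \<circ> E) z) \<le> 1" if "\<bar>Im z\<bar> < 1" for z
          using le1[OF E1[OF that]] by simp
        show "path (T \<circ> linepath t0 t1)"
        proof (rule path_continuous_image)
          have "path_image (linepath t0 t1) \<subseteq> {0..<1}" using seg t0 t1 by (fastforce simp: path_image_def)
          then show "continuous_on (path_image (linepath t0 t1)) T" using T_cont continuous_on_subset by blast
        qed simp
        have im: "\<exists>t. t0 \<le> t \<and> t \<le> t1 \<and> z = T t" if "z \<in> path_image (T \<circ> linepath t0 t1)" for z
          using that seg by (auto simp: path_image_def)
        show "\<bar>Im z\<bar> < 1" if "z \<in> path_image (T \<circ> linepath t0 t1)" for z
          using im[OF that] Im_T t0 t1 by force
        show "cmod ((k \<circ> E) z) \<le> e" if "z \<in> path_image (T \<circ> linepath t0 t1)" for z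
        proof -
          obtain t where t: "t0 \<le> t" "t \<le> t1" "z = T t" using im[OF \<open>z \<in> _\<close>] by blast
          then show ?thesis using ET[of t] b(2)[of t] t0 t1 by simp
        qed
      qed (use x1 x2 in \<open>simp_all add: pathstart_compose pathfinish_compose\<close>)
      then have "cmod (k (of_real r)) ^ 4 \<le> (\<epsilon> / 2) ^ 4" by (simp add: Ex e_def)
      then have "cmod (k (of_real r)) \<le> \<epsilon> / 2"
        using \<open>\<epsilon> > 0\<close> by (simp add: power_mono_iff)
      then show ?thesis using \<open>\<epsilon> > 0\<close> by linarith
    qed
    have "max 0 (1 - 1 / M) < 1" using \<open>M > 0\<close> by simp
    from eventually_at_left_real[OF this]
    show "eventually (\<lambda>r::real. dist (k (of_real r)) 0 < \<epsilon>) (at_left 1)"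
      by eventually_elim (use bound in auto)
  qed
qed

lemma Lindelof_radial:
  fixes k :: "complex \<Rightarrow> complex" and \<sigma> :: "real \<Rightarrow> complex"
  assumes hol: "k holomorphic_on ball 0 1" and le1: "\<And>z. cmod z < 1 \<Longrightarrow> cmod (k z) \<le> 1"
    and \<sigma>: "continuous_on {0..<1} \<sigma>" "\<sigma> ` {0..<1} \<subseteq> ball 0 1" "(\<sigma> \<longlongrightarrow> \<zeta>) (at_left 1)"
    and \<zeta>: "cmod \<zeta> = 1" and lim: "((\<lambda>t. k (\<sigma> t)) \<longlongrightarrow> 0) (at_left 1)"
  shows "has_radial_limit k \<zeta> 0"
proof -
  have [simp]: "\<zeta> \<noteq> 0" using \<zeta> by auto
  have "((\<lambda>r::real. k (of_real r * \<zeta>)) \<longlongrightarrow> 0) (at_left 1)"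
  proof (rule Lindelof_at_1[of "\<lambda>z. k (z * \<zeta>)" "\<lambda>t. \<sigma> t / \<zeta>"])
    show "(\<lambda>z. k (z * \<zeta>)) holomorphic_on ball 0 1"
      by (rule holomorphic_on_compose_gen[of "\<lambda>z. z * \<zeta>" _ k, unfolded o_def, OF _ hol])
        (auto intro!: holomorphic_intros simp: norm_mult \<zeta>)
    show "cmod (k (z * \<zeta>)) \<le> 1" if "cmod z < 1" for z
      using that by (intro le1) (simp add: norm_mult \<zeta>)
    show "continuous_on {0..<1} (\<lambda>t. \<sigma> t / \<zeta>)" by (intro continuous_intros \<sigma>(1)) auto
    show "(\<lambda>t. \<sigma> t / \<zeta>) ` {0..<1} \<subseteq> ball 0 1"
      using \<sigma>(2) by (auto simp: norm_divide \<zeta>)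
    show "((\<lambda>t. \<sigma> t / \<zeta>) \<longlongrightarrow> 1) (at_left 1)"
      using tendsto_divide[OF \<sigma>(3) tendsto_const, of \<zeta>] by simp
    show "((\<lambda>t. k (\<sigma> t / \<zeta> * \<zeta>)) \<longlongrightarrow> 0) (at_left 1)" using lim by simp
  qed
  then show ?thesis by (simp add: has_radial_limit_def)
qed

section \<open>Convergence in the Riemann sphere\<close>

lemma tendsto_csphere_iff: "(p \<longlongrightarrow> l) F \<longleftrightarrow> ((\<lambda>x. stereo (p x)) \<longlongrightarrow> stereo l) F"
  by (simp add: tendsto_iff dist_csphere_def)

lemma one_plus_norm_sq_pos: "1 + (cmod z)\<^sup>2 > 0"
  by (simp add: add_pos_nonneg)

lemma tendsto_Fin:
  assumes "(a \<longlongrightarrow> z) F" shows "((\<lambda>x. Fin (a x)) \<longlongrightarrow> Fin z) F"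
proof -
  have "1 + (cmod z)\<^sup>2 \<noteq> 0" "(cmod z)\<^sup>2 + 1 \<noteq> 0"
    using one_plus_norm_sq_pos[of z] by auto
  then show ?thesis
    unfolding tendsto_csphere_iff stereo.simps by (intro tendsto_intros assms)
qed

text \<open>Stereographic projection from the north pole, which makes \<open>to_complex\<close>
  continuous away from \<open>Infty\<close>. At \<open>Infty\<close> the formula yields 0, the
  default value of \<open>to_complex\<close> there.\<close>

lemma to_complex_eq_stereo: "to_complex p = (1 / (1 - snd (stereo p))) *\<^sub>R fst (stereo p)"
proof (cases p)
  case (Fin z)
  define c where "c = 2 / (1 + (cmod z)\<^sup>2)"
  have "c \<noteq> 0" using one_plus_norm_sq_pos[of z] by (simp add: c_def)
  have "1 - snd (stereo p) = c"
    unfolding Fin c_def using one_plus_norm_sq_pos[of z] by (simp add: field_simps)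
  moreover have "fst (stereo p) = c *\<^sub>R z" by (simp add: Fin c_def)
  ultimately show ?thesis using Fin \<open>c \<noteq> 0\<close> by (simp only: csphere.sel) simp
qed simp

lemma tendsto_to_complex:
  assumes "(p \<longlongrightarrow> Fin z) F" shows "((\<lambda>x. to_complex (p x)) \<longlongrightarrow> z) F"
proof -
  have "1 - snd (stereo (Fin z)) \<noteq> 0"
    using one_plus_norm_sq_pos[of z] by (simp add: divide_eq_eq add.commute)
  then have "((\<lambda>x. (1 / (1 - snd (stereo (p x)))) *\<^sub>R fst (stereo (p x))) \<longlongrightarrow>
      (1 / (1 - snd (stereo (Fin z)))) *\<^sub>R fst (stereo (Fin z))) F"
    using assms unfolding tendsto_csphere_iff by (intro tendsto_intros)
  then show ?thesis unfolding to_complex_eq_stereo[symmetric] by simp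
qed

lemma tendsto_Fin_iff: "((\<lambda>x. Fin (a x)) \<longlongrightarrow> Fin z) F \<longleftrightarrow> (a \<longlongrightarrow> z) F"
  using tendsto_Fin tendsto_to_complex by fastforce

lemma dist_Fin_Infty: "dist (Fin z) Infty = 2 / sqrt (1 + (cmod z)\<^sup>2)"
proof -
  define r where "r = (cmod z)\<^sup>2"
  have r: "r \<ge> 0" by (simp add: r_def)
  have third: "(r - 1) / (r + 1) - 1 = - (2 / (1 + r))"
    using r by (simp add: field_simps)
  have n: "(cmod ((2 / (1 + r)) *\<^sub>R z))\<^sup>2 = (2 / (1 + r))\<^sup>2 * r"
    by (simp only: norm_scaleR power_mult_distrib r_def power2_abs)
  have "(2 / (1 + r))\<^sup>2 * r + (2 / (1 + r))\<^sup>2 = (2 / (1 + r))\<^sup>2 * (1 + r)"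
    by (simp add: algebra_simps)
  also have "\<dots> = 4 / (1 + r)"
    using r by (simp add: power2_eq_square divide_simps)
  finally have "sqrt ((cmod ((2 / (1 + r)) *\<^sub>R z))\<^sup>2 + ((r - 1) / (r + 1) - 1)\<^sup>2) = sqrt (4 / (1 + r))"
    unfolding n third by simp
  also have "\<dots> = 2 / sqrt (1 + r)"
    by (simp add: real_sqrt_divide)
  finally show ?thesis
    by (simp only: dist_csphere_def dist_Pair_Pair stereo.simps)
      (simp only: dist_norm r_def diff_zero real_norm_def power2_abs)
qed

lemma tendsto_Infty_iff: "((\<lambda>x. Fin (a x)) \<longlongrightarrow> Infty) F \<longleftrightarrow> filterlim a at_infinity F"
proof
  assume L: "((\<lambda>x. Fin (a x)) \<longlongrightarrow> Infty) F"
  show "filterlim a at_infinity F"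
    unfolding filterlim_at_infinity[OF order_refl]
  proof (intro allI impI)
    fix M :: real assume "0 < M"
    have "2 / sqrt (1 + M\<^sup>2) > 0" by (simp add: add_pos_nonneg)
    from tendstoD[OF L this] show "eventually (\<lambda>x. M \<le> cmod (a x)) F"
    proof (rule eventually_mono)
      fix x assume "dist (Fin (a x)) Infty < 2 / sqrt (1 + M\<^sup>2)"
      then have "2 / sqrt (1 + (cmod (a x))\<^sup>2) < 2 / sqrt (1 + M\<^sup>2)"
        by (simp only: dist_Fin_Infty)
      moreover have "2 / sqrt (1 + M\<^sup>2) \<le> 2 / sqrt (1 + (cmod (a x))\<^sup>2)" if "cmod (a x) \<le> M"
        using that one_plus_norm_sq_pos[of "a x"] by (intro frac_le) (auto intro: power_mono)
      ultimately show "M \<le> cmod (a x)" by linarith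
    qed
  qed
next
  assume L: "filterlim a at_infinity F"
  show "((\<lambda>x. Fin (a x)) \<longlongrightarrow> Infty) F"
  proof (rule tendstoI)
    fix e :: real assume "e > 0"
    then have "eventually (\<lambda>x. 2 / e \<le> cmod (a x)) F"
      using L unfolding filterlim_at_infinity[OF order_refl] by simp
    then show "eventually (\<lambda>x. dist (Fin (a x)) Infty < e) F"
    proof (rule eventually_mono)
      fix x assume x: "2 / e \<le> cmod (a x)"
      have "cmod (a x) < sqrt (1 + (cmod (a x))\<^sup>2)"
        by (simp add: real_less_rsqrt)
      with x have "2 / e < sqrt (1 + (cmod (a x))\<^sup>2)" by linarith
      then show "dist (Fin (a x)) Infty < e"
        unfolding dist_Fin_Infty using \<open>e > 0\<close> one_plus_norm_sq_pos[of "a x"]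
        by (subst pos_divide_less_eq) (simp_all add: pos_divide_less_eq mult.commute)
    qed
  qed
qed

lemma open_Fin_image:
  assumes "open U" shows "open (Fin ` U)"
proof -
  have ev: "eventually (\<lambda>q. q \<in> Fin ` U) (nhds p)" if p: "p \<in> Fin ` U" for p
  proof -
    obtain z where z: "z \<in> U" "p = Fin z" using p by blast
    have id: "((\<lambda>q. q) \<longlongrightarrow> Fin z) (nhds p)" unfolding z(2) by (rule filterlim_ident)
    have "eventually (\<lambda>q. to_complex q \<in> U) (nhds p)"
      by (rule topological_tendstoD[OF tendsto_to_complex[OF id] assms z(1)])
    moreover have "eventually (\<lambda>q. q \<noteq> Infty) (nhds p)"
      by (rule tendsto_imp_eventually_ne[OF id]) simp
    ultimately show ?thesis
    proof eventually_elim
      case (elim q)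
      then show ?case by (cases q) auto
    qed
  qed
  show ?thesis
  proof (subst open_subopen, intro ballI)
    fix p assume "p \<in> Fin ` U"
    from ev[OF this] show "\<exists>T. open T \<and> p \<in> T \<and> T \<subseteq> Fin ` U"
      unfolding eventually_nhds subset_eq Ball_def .
  qed
qed

lemma frontier_Fin_image_iff:
  assumes "open U" shows "v \<in> frontier (Fin ` U) \<longleftrightarrow> v \<in> closure (Fin ` U) \<and> v \<notin> Fin ` U"
  by (simp add: frontier_def interior_open open_Fin_image assms)

lemma tendsto_in_frontier:
  assumes "open U" "v \<notin> Fin ` U" "(p \<longlongrightarrow> v) F" "eventually (\<lambda>x. p x \<in> Fin ` U) F" "F \<noteq> bot"
  shows "v \<in> frontier (Fin ` U)"
proof -
  have "v \<in> closure (Fin ` U)"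
  proof (rule Lim_in_closed_set[OF closed_closure _ assms(5,3)])
    show "eventually (\<lambda>x. p x \<in> closure (Fin ` U)) F"
      using assms(4) by (rule eventually_mono) (rule subsetD[OF closure_subset])
  qed
  then show ?thesis using assms(2) by (simp add: frontier_Fin_image_iff[OF assms(1)])
qed

section \<open>Meromorphic maps as continuous maps to the sphere\<close>

lemma meromorphic_map_analytic:
  assumes "meromorphic_map f" "f z \<noteq> Infty"
  shows "(\<lambda>w. to_complex (f w)) analytic_on {z}"
  using assms nicely_meromorphic_on_imp_analytic_at[of "\<lambda>w. to_complex (f w)" UNIV z]
  unfolding meromorphic_map_def by blast

lemma meromorphic_map_isCont:
  assumes f: "meromorphic_map f" shows "isCont f z"
proof (cases "f z = Infty")
  case True
  then have pole: "is_pole (\<lambda>w. to_complex (f w)) z" using f by (simp add: meromorphic_map_def)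
  \<comment> \<open>\<open>to_complex\<close> cannot distinguish \<open>Infty\<close> from
    \<open>Fin 0\<close>; excluding the value 0 near the pole makes \<open>f w\<close> recoverable
    from it.\<close>
  have "eventually (\<lambda>w. to_complex (f w) \<noteq> 0) (at z)"
    by (rule non_zero_neighbour_pole[OF pole])
  then have "eventually (\<lambda>w. Fin (to_complex (f w)) = f w) (at z)"
  proof eventually_elim
    case (elim w)
    then show ?case by (cases "f w") auto
  qed
  moreover have "((\<lambda>w. Fin (to_complex (f w))) \<longlongrightarrow> Infty) (at z)"
    using pole unfolding tendsto_Infty_iff is_pole_def .
  ultimately have "(f \<longlongrightarrow> Infty) (at z)"
    by (rule Lim_transform_eventually[rotated])
  then show ?thesis using True by (simp add: isCont_def)
next
  case False
  then obtain r where r: "r > 0" "(\<lambda>w. to_complex (f w)) holomorphic_on ball z r"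
    using meromorphic_map_analytic[OF f] unfolding analytic_on_def by blast
  have "eventually (\<lambda>w. w \<in> ball z r) (at z)"
    using r(1) by (intro eventually_at_in_open') auto
  then have "eventually (\<lambda>w. Fin (to_complex (f w)) = f w) (at z)"
  proof eventually_elim
    case (elim w)
    then have "\<not> is_pole (\<lambda>w. to_complex (f w)) w"
      using not_is_pole_holomorphic[of "ball z r" w] r(2) by simp
    then have "f w \<noteq> Infty" using f by (simp add: meromorphic_map_def)
    then show ?case by (cases "f w") auto
  qed
  moreover have "((\<lambda>w. to_complex (f w)) \<longlongrightarrow> to_complex (f z)) (at z)"
    using meromorphic_map_analytic[OF f False] analytic_at_imp_isCont isCont_def by blast
  then have "((\<lambda>w. Fin (to_complex (f w))) \<longlongrightarrow> Fin (to_complex (f z))) (at z)"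
    by (rule tendsto_Fin)
  moreover have "Fin (to_complex (f z)) = f z" using False by (cases "f z") auto
  ultimately show ?thesis unfolding isCont_def by (simp add: Lim_transform_eventually)
qed

text \<open>Continuity of \<open>f\<close> at a finite limit. It is used along access curves in one
  half of the theorem and along sequences on the radius in the other.\<close>

lemma fixed_if_orbit_step_same_limit:
  assumes f: "meromorphic_map f" and F: "F \<noteq> bot"
    and z: "((\<lambda>x. Fin (z x)) \<longlongrightarrow> v) F" and fz: "((\<lambda>x. f (z x)) \<longlongrightarrow> v) F"
  shows "v = Infty \<or> (\<exists>w. v = Fin w \<and> fixed_point f w)"
proof (cases v)
  case (Fin w)
  then have "(z \<longlongrightarrow> w) F" using z tendsto_Fin_iff by blast
  then have "((\<lambda>x. f (z x)) \<longlongrightarrow> f w) F"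
    using meromorphic_map_isCont[OF f] isCont_tendsto_compose by blast
  then have "f w = v" using fz F tendsto_unique by blast
  then show ?thesis using Fin by (simp add: fixed_point_def)
qed simp

section \<open>Distortion of univalent functions\<close>

text \<open>The pseudo-hyperbolic distance |z - w| / |1 - cnj w * z|, as the modulus of the image of
  \<open>z\<close> under the disc automorphism that moves \<open>w\<close> to 0.\<close>

definition pdist :: "complex \<Rightarrow> complex \<Rightarrow> real" where
  "pdist w z = cmod (Moebius_function 0 w z)"

lemma one_minus_cnj_mult_neq_0:
  assumes "cmod w < 1" "cmod z < 1" shows "1 - cnj w * z \<noteq> 0"
proof
  assume "1 - cnj w * z = 0"
  then have "cmod (cnj w * z) = 1" by simp
  moreover have "cmod (cnj w * z) < 1"
    using assms mult_strict_mono'[of "cmod w" 1 "cmod z" 1] by (simp add: norm_mult)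
  ultimately show False by simp
qed

text \<open>The identity turns the question whether the pseudo-hyperbolic distance stays away from 1
  into a comparison of Euclidean distances. It underlies both the Stolz-region estimate and the
  boundary growth of self-maps of the disc.\<close>

lemma one_minus_pdist_sq:
  assumes "cmod w < 1" "cmod z < 1"
  shows "1 - (pdist w z)\<^sup>2 = (1 - (cmod w)\<^sup>2) * (1 - (cmod z)\<^sup>2) / (cmod (1 - cnj w * z))\<^sup>2"
proof -
  have "(cmod (1 - cnj w * z))\<^sup>2 - (cmod (z - w))\<^sup>2 = (1 - (cmod w)\<^sup>2) * (1 - (cmod z)\<^sup>2)"
    unfolding cmod_power2 by (simp add: power2_eq_square algebra_simps)
  moreover have "(cmod (1 - cnj w * z))\<^sup>2 > 0"
    using one_minus_cnj_mult_neq_0[OF assms] by simp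
  ultimately show ?thesis
    by (simp add: pdist_def Moebius_function_simple norm_divide power_divide field_simps)
qed

lemma pdist_nonneg: "pdist w z \<ge> 0"
  by (simp add: pdist_def)

lemma pdist_commute: "cmod w < 1 \<Longrightarrow> cmod z < 1 \<Longrightarrow> pdist w z = pdist z w"
proof -
  have "cmod (1 - cnj w * z) = cmod (cnj (1 - cnj w * z))" by (rule complex_mod_cnj[symmetric])
  also have "\<dots> = cmod (1 - cnj z * w)" by (simp add: mult.commute)
  finally show ?thesis by (simp add: pdist_def Moebius_function_simple norm_divide norm_minus_commute)
qed

lemma Moebius_inverse:
  assumes "cmod w < 1" "cmod z < 1"
  shows "Moebius_function 0 (- w) (Moebius_function 0 w z) = z"
  using assms by (intro Moebius_function_compose) auto

text \<open>Disc automorphisms move \<open>w\<close> and \<open>g w\<close> to the origin, where the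
  Schwarz lemma applies.\<close>

lemma Schwarz_Pick:
  fixes g :: "complex \<Rightarrow> complex"
  assumes hol: "g holomorphic_on ball 0 1" and g: "\<And>z. cmod z < 1 \<Longrightarrow> cmod (g z) < 1"
    and w: "cmod w < 1" and z: "cmod z < 1"
  shows "pdist (g w) (g z) \<le> pdist w z"
proof -
  define f where "f = Moebius_function 0 (g w) \<circ> (g \<circ> Moebius_function 0 (- w))"
  have M: "cmod (Moebius_function 0 (- w) \<xi>) < 1" if "cmod \<xi> < 1" for \<xi>
    using w that by (intro Moebius_function_norm_lt_1) auto
  have "g \<circ> Moebius_function 0 (- w) holomorphic_on ball 0 1"
    using w M by (intro holomorphic_on_compose_gen[OF _ hol] Moebius_function_holomorphic) auto
  then have holf: "f holomorphic_on ball 0 1"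
    unfolding f_def
    by (rule holomorphic_on_compose_gen[OF _ Moebius_function_holomorphic]) (use g w M in auto)
  have "f 0 = 0"
    by (simp add: f_def Moebius_function_of_zero Moebius_function_eq_zero)
  moreover have "cmod (f \<xi>) < 1" if "cmod \<xi> < 1" for \<xi>
    unfolding f_def using Moebius_function_norm_lt_1 g w M[OF that] by simp
  moreover have "cmod (Moebius_function 0 w z) < 1"
    using w z by (rule Moebius_function_norm_lt_1)
  ultimately have "cmod (f (Moebius_function 0 w z)) \<le> cmod (Moebius_function 0 w z)"
    using Schwarz_Lemma(1)[OF holf] by blast
  then show ?thesis
    by (simp add: f_def pdist_def Moebius_inverse[OF w z])
qed

text \<open>If \<open>s\<^sup>2 = h\<close> is univalent then \<open>s\<close> never takes two opposite values, so that \<open>- s / s w\<close> omits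
  \<open>0\<close> and \<open>1\<close> and Schottky's theorem applies.\<close>

lemma univalent_nonvanishing_distortion:
  assumes \<rho>: "0 < \<rho>" "\<rho> < 1"
  obtains K where "K \<ge> 1" "\<And>h w z. h holomorphic_on ball 0 1 \<Longrightarrow> inj_on h (ball 0 1) \<Longrightarrow>
     (\<And>z. z \<in> ball 0 1 \<Longrightarrow> h z \<noteq> 0) \<Longrightarrow> cmod w < 1 \<Longrightarrow> cmod z < 1 \<Longrightarrow> pdist w z \<le> \<rho> \<Longrightarrow>
     cmod (h z) \<le> K * cmod (h w)"
proof -
  \<comment> \<open>An intermediate radius: the closed unit disc in Schottky's theorem is scaled to
    the pseudo-hyperbolic disc of radius \<open>\<rho>'\<close> about \<open>w\<close>, so that
    \<open>z\<close> corresponds to a point of modulus at most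
    \<open>t = \<rho> / \<rho>'\<close>.\<close>
  define \<rho>' where "\<rho>' = (1 + \<rho>) / 2"
  have \<rho>': "0 < \<rho>'" "\<rho>' < 1" "\<rho> < \<rho>'" using \<rho> by (auto simp: \<rho>'_def)
  define t where "t = \<rho> / \<rho>'"
  have t: "0 < t" "t < 1" using \<rho> \<rho>' by (auto simp: t_def)
  \<comment> \<open>Schottky's bound for a function of modulus at most 1 at the origin. It controls
    a square root of \<open>h\<close>, so the final constant is \<open>B\<^sup>2\<close>.\<close>
  define B where "B = exp (pi * exp (pi * (2 + 2 * 1 + 12 * t / (1 - t))))"
  have "B \<ge> 1" unfolding B_def using t by simp
  have main: "cmod (h z) \<le> B\<^sup>2 * cmod (h w)"
    if hol: "h holomorphic_on ball 0 1" and inj: "inj_on h (ball 0 1)"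
      and nz: "\<And>z. z \<in> ball 0 1 \<Longrightarrow> h z \<noteq> 0"
      and w: "cmod w < 1" and z: "cmod z < 1" and p: "pdist w z \<le> \<rho>" for h w z
  proof -
    obtain L where L: "L holomorphic_on ball 0 1" "\<And>z. z \<in> ball 0 1 \<Longrightarrow> h z = exp (L z)"
      using contractible_imp_holomorphic_log[OF hol convex_imp_contractible[OF convex_ball] nz] by metis
    define s where "s = (\<lambda>z. exp (L z / 2))"
    have s_hol: "s holomorphic_on ball 0 1" unfolding s_def using L(1) by (intro holomorphic_intros) auto
    have s2: "s z ^ 2 = h z" if "z \<in> ball 0 1" for z
      using L(2)[OF that] by (simp add: s_def flip: exp_double)
    define M where "M = (\<lambda>\<xi>. Moebius_function 0 (- w) (of_real \<rho>' * \<xi>))"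
    have M: "cmod (M \<xi>) < 1" if "cmod \<xi> \<le> 1" for \<xi>
      unfolding M_def
    proof (rule Moebius_function_norm_lt_1)
      have "\<rho>' * cmod \<xi> \<le> \<rho>' * 1" using that \<rho>' by (intro mult_left_mono) auto
      also have "\<dots> < 1" using \<rho>' by simp
      finally show "cmod (of_real \<rho>' * \<xi>) < 1" using \<rho>' by (simp add: norm_mult)
    qed (use w in simp)
    have M_hol: "M holomorphic_on cball 0 1"
    proof -
      have "Moebius_function 0 (- w) \<circ> (\<lambda>\<xi>. of_real \<rho>' * \<xi>) holomorphic_on cball 0 1"
      proof (rule holomorphic_on_compose_gen[OF _ Moebius_function_holomorphic])
        show "(\<lambda>\<xi>. of_real \<rho>' * \<xi>) ` cball 0 1 \<subseteq> (ball 0 1 :: complex set)"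
        proof clarify
          fix \<xi> :: complex assume "\<xi> \<in> cball 0 1"
          then have "\<rho>' * cmod \<xi> \<le> \<rho>' * 1" using \<rho>' by (intro mult_left_mono) auto
          also have "\<dots> < 1" using \<rho>' by simp
          finally show "of_real \<rho>' * \<xi> \<in> ball 0 1" using \<rho>' by (simp add: norm_mult)
        qed
      qed (use w in \<open>auto intro: holomorphic_intros\<close>)
      then show ?thesis by (simp add: M_def o_def)
    qed
    define k where "k = (\<lambda>\<xi>. - s (M \<xi>) / s w)"
    have [simp]: "s x \<noteq> 0" for x by (simp add: s_def)
    have not1: "\<not> (k \<xi> = 0 \<or> k \<xi> = 1)" if "\<xi> \<in> cball 0 1" for \<xi>
    proof -
      have M\<xi>: "M \<xi> \<in> ball 0 1" using M[of \<xi>] that by simp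
      have "s (M \<xi>) \<noteq> - s w"
      proof
        assume e: "s (M \<xi>) = - s w"
        then have "h (M \<xi>) = h w" using s2[OF M\<xi>] s2[of w] w by simp
        then have "M \<xi> = w" using inj_onD[OF inj _ M\<xi>] w by simp
        then show False using e by (simp add: eq_neg_iff_add_eq_0 flip: mult_2)
      qed
      then have "- s (M \<xi>) \<noteq> s w" by (metis minus_minus)
      then have "k \<xi> \<noteq> 1" unfolding k_def by (subst nonzero_divide_eq_eq) auto
      then show ?thesis by (simp add: k_def)
    qed
    define \<xi> where "\<xi> = Moebius_function 0 w z / of_real \<rho>'"
    have M\<xi>: "M \<xi> = z" unfolding M_def \<xi>_def using \<rho>' Moebius_inverse[OF w z] by simp
    have "cmod (k \<xi>) \<le> exp (pi * exp (pi * (2 + 2 * 1 + 12 * t / (1 - t))))"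
    proof (rule Schottky[where r = 1 and t = t and f = k and z = \<xi>])
      show "k holomorphic_on cball 0 1"
        unfolding k_def
        by (intro holomorphic_intros holomorphic_on_compose_gen[OF M_hol s_hol, unfolded o_def])
          (use M in auto)
      show "cmod (k 0) \<le> 1" by (simp add: k_def M_def Moebius_function_of_zero)
      show "cmod \<xi> \<le> t" using p \<rho>' by (simp add: \<xi>_def t_def norm_divide pdist_def divide_right_mono)
    qed (use t not1 in auto)
    then have "cmod (s z) \<le> B * cmod (s w)"
      by (simp add: k_def M\<xi> B_def norm_divide divide_le_eq)
    then have "(cmod (s z))\<^sup>2 \<le> (B * cmod (s w))\<^sup>2" by (intro power_mono) auto
    then show ?thesis using s2[of z] s2[of w] w z by (simp add: power_mult_distrib flip: norm_power)
  qed
  show ?thesis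
  proof (rule that[of "B\<^sup>2"])
    show "B\<^sup>2 \<ge> 1" using \<open>B \<ge> 1\<close> by (rule one_le_power)
  qed (rule main)
qed

section \<open>Riemann maps and the transfer of boundary limits\<close>

lemma riemann_map_inj: "riemann_map \<phi> U \<Longrightarrow> inj_on \<phi> (ball 0 1)"
  by (simp add: riemann_map_def bij_betw_def)

lemma riemann_map_image: "riemann_map \<phi> U \<Longrightarrow> \<phi> ` ball 0 1 = U"
  by (simp add: riemann_map_def bij_betw_def)

lemma riemann_map_open: "riemann_map \<phi> U \<Longrightarrow> open U"
  using open_mapping_thm3[of \<phi> "ball 0 1"] unfolding riemann_map_def bij_betw_def by auto

text \<open>Otherwise the inverse would be a bounded entire function. The lemma supplies a finite
  omitted value when the boundary point is \<open>Infty\<close>.\<close>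

lemma riemann_map_neq_UNIV:
  assumes "riemann_map \<phi> U" shows "U \<noteq> UNIV"
proof
  assume U: "U = UNIV"
  have \<phi>: "\<phi> holomorphic_on ball 0 1" using assms by (simp add: riemann_map_def)
  obtain \<psi> where \<psi>: "\<psi> holomorphic_on \<phi> ` ball 0 1" "\<And>z. z \<in> ball 0 1 \<Longrightarrow> \<psi> (\<phi> z) = z"
    using holomorphic_has_inverse[OF \<phi> open_ball riemann_map_inj[OF assms]] by metis
  have im: "\<phi> ` ball 0 1 = UNIV" using riemann_map_image[OF assms] U by simp
  have "bounded (range \<psi>)"
    unfolding bounded_iff using \<psi>(2) im by (intro exI[of _ 1]) (metis image_iff less_imp_le mem_ball_0 rangeE)
  then have "\<psi> constant_on UNIV"
    using Liouville_theorem[of \<psi>] \<psi>(1) im by (auto simp: constant_on_def)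
  then obtain c where "\<And>w. \<psi> w = c" by (auto simp: constant_on_def)
  then have "z = c" if "z \<in> ball 0 1" for z using \<psi>(2)[OF that] by simp
  from this[of 0] this[of "1/2"] show False by simp
qed

text \<open>Distortion is applied to \<open>\<phi> - a\<close> with \<open>a\<close> outside
  \<open>U\<close>. For finite \<open>v\<close> take \<open>a = v\<close>: convergence to 0 is
  transferred. For \<open>v = Infty\<close> any omitted \<open>a\<close> serves, and the estimate is
  read with the two points exchanged, because now growth is transferred.\<close>

lemma tendsto_transfer_pdist:
  assumes rm: "riemann_map \<phi> U" and v: "v \<notin> Fin ` U" and \<rho>: "0 < \<rho>" "\<rho> < 1"
    and ev: "eventually (\<lambda>x. cmod (w x) < 1 \<and> cmod (z x) < 1 \<and> pdist (w x) (z x) \<le> \<rho>) F"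
    and lim: "((\<lambda>x. Fin (\<phi> (w x))) \<longlongrightarrow> v) F"
  shows "((\<lambda>x. Fin (\<phi> (z x))) \<longlongrightarrow> v) F"
proof -
  have hol: "\<phi> holomorphic_on ball 0 1" using rm by (simp add: riemann_map_def)
  obtain K where K: "K \<ge> 1" "\<And>h w z. h holomorphic_on ball 0 1 \<Longrightarrow> inj_on h (ball 0 1) \<Longrightarrow>
     (\<And>z. z \<in> ball 0 1 \<Longrightarrow> h z \<noteq> 0) \<Longrightarrow> cmod w < 1 \<Longrightarrow> cmod z < 1 \<Longrightarrow> pdist w z \<le> \<rho> \<Longrightarrow>
     cmod (h z) \<le> K * cmod (h w)"
    using univalent_nonvanishing_distortion[OF \<rho>] by metis
  have dist: "cmod (\<phi> z - a) \<le> K * cmod (\<phi> w - a)"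
    if a: "a \<notin> U" and wz: "cmod w < 1" "cmod z < 1" "pdist w z \<le> \<rho>" for a w z
  proof (rule K(2)[of "\<lambda>z. \<phi> z - a"])
    show "(\<lambda>z. \<phi> z - a) holomorphic_on ball 0 1" by (intro holomorphic_intros hol)
    show "inj_on (\<lambda>z. \<phi> z - a) (ball 0 1)"
      using riemann_map_inj[OF rm] by (auto simp: inj_on_def)
    show "\<phi> z - a \<noteq> 0" if "z \<in> ball 0 1" for z
      using riemann_map_image[OF rm] a that by auto
  qed (use wz in auto)
  show ?thesis
  proof (cases v)
    case (Fin a)
    then have "a \<notin> U" using v by auto
    have "((\<lambda>x. \<phi> (w x) - a) \<longlongrightarrow> 0) F"
      using lim unfolding Fin tendsto_Fin_iff by (rule Lim_null[THEN iffD1])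
    then have "((\<lambda>x. K * cmod (\<phi> (w x) - a)) \<longlongrightarrow> 0) F"
      by (intro tendsto_mult_right_zero tendsto_norm_zero)
    then have "((\<lambda>x. \<phi> (z x) - a) \<longlongrightarrow> 0) F"
      by (rule Lim_null_comparison[rotated])
        (use ev in \<open>rule eventually_mono, use dist[OF \<open>a \<notin> U\<close>] in auto\<close>)
    then show ?thesis unfolding Fin tendsto_Fin_iff by (rule Lim_null[THEN iffD2])
  next
    case Infty
    obtain a where "a \<notin> U" using riemann_map_neq_UNIV[OF rm] by auto
    have w_inf: "filterlim (\<lambda>x. \<phi> (w x)) at_infinity F"
      using lim unfolding Infty tendsto_Infty_iff .
    show ?thesis
      unfolding Infty tendsto_Infty_iff filterlim_at_infinity[OF order_refl]
    proof (intro allI impI)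
      fix M :: real assume "M > 0"
      define M' where "M' = K * (M + cmod a) + cmod a + 1"
      have "M' > 0" using K(1) \<open>M > 0\<close> by (simp add: M'_def add_nonneg_pos)
      then have "eventually (\<lambda>x. M' \<le> cmod (\<phi> (w x))) F"
        using w_inf unfolding filterlim_at_infinity[OF order_refl] by blast
      with ev show "eventually (\<lambda>x. M \<le> cmod (\<phi> (z x))) F"
      proof eventually_elim
        case (elim x)
        have "cmod (\<phi> (w x) - a) \<le> K * cmod (\<phi> (z x) - a)"
          using elim pdist_commute[of "w x" "z x"] by (intro dist \<open>a \<notin> U\<close>) auto
        also have "\<dots> \<le> K * (cmod (\<phi> (z x)) + cmod a)"
          using K(1) by (intro mult_left_mono norm_triangle_ineq4) auto
        finally have "M' - cmod a \<le> K * (cmod (\<phi> (z x)) + cmod a)"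
          using elim norm_triangle_ineq2[of "\<phi> (w x)" a] by linarith
        then have "K * (M + cmod a) \<le> K * (cmod (\<phi> (z x)) + cmod a)" by (simp add: M'_def)
        then show ?case using K(1) by simp
      qed
    qed
  qed
qed

section \<open>Landing of access curves\<close>

text \<open>The image of a square root branch is disjoint from its negative, hence omits a disc.\<close>

lemma sqrt_branch_omits_ball:
  assumes rm: "riemann_map \<phi> U" and a: "a \<notin> U"
  obtains s b \<rho> where "s holomorphic_on ball 0 1" "\<rho> > 0" "b \<noteq> 0"
    "\<And>z. cmod z < 1 \<Longrightarrow> s z ^ 2 = \<phi> z - a" "\<And>z. s z \<noteq> 0" "\<And>z. cmod z < 1 \<Longrightarrow> \<rho> \<le> cmod (s z + b)"
proof -
  have nz: "\<phi> z - a \<noteq> 0" if "z \<in> ball 0 1" for z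
    using riemann_map_image[OF rm] a that by auto
  have hol: "(\<lambda>z. \<phi> z - a) holomorphic_on ball 0 1"
    using rm by (intro holomorphic_intros) (simp add: riemann_map_def)
  obtain L where L: "L holomorphic_on ball 0 1" "\<And>z. z \<in> ball 0 1 \<Longrightarrow> \<phi> z - a = exp (L z)"
    using contractible_imp_holomorphic_log[OF hol convex_imp_contractible[OF convex_ball] nz] by metis
  define s where "s = (\<lambda>z. exp (L z / 2))"
  have s_hol: "s holomorphic_on ball 0 1" unfolding s_def using L(1) by (intro holomorphic_intros) auto
  have s2: "s z ^ 2 = \<phi> z - a" if "z \<in> ball 0 1" for z
    using L(2)[OF that] by (simp add: s_def flip: exp_double)
  have snz: "s z \<noteq> 0" for z by (simp add: s_def)
  have same: "z = w" if "z \<in> ball 0 1" "w \<in> ball 0 1" "s z ^ 2 = s w ^ 2" for z w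
    using that s2 riemann_map_inj[OF rm] by (auto simp: inj_on_def)
  have "inj_on s (ball 0 1)" using same by (auto simp: inj_on_def)
  then have "open (s ` ball 0 1)"
    using open_mapping_thm3[OF s_hol open_ball] by blast
  then obtain \<rho> where \<rho>: "\<rho> > 0" "ball (s 0) \<rho> \<subseteq> s ` ball 0 1"
    by (metis centre_in_ball imageI openE zero_less_one)
  have "\<rho> \<le> cmod (s z + s 0)" if "cmod z < 1" for z
  proof (rule ccontr)
    assume "\<not> \<rho> \<le> cmod (s z + s 0)"
    then have "- s z \<in> ball (s 0) \<rho>" by (simp add: dist_norm add.commute)
    then obtain w where w: "w \<in> ball 0 1" "- s z = s w" using \<rho>(2) by blast
    then have "s z ^ 2 = s w ^ 2" by (metis power2_minus)
    then have "z = w" using same w(1) that by simp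
    then show False using w(2) snz[of z] by (simp add: neg_eq_iff_add_eq_0 flip: mult_2)
  qed
  then show ?thesis using that[OF s_hol \<rho>(1) snz[of 0] _ snz] s2 by auto
qed

text \<open>Replaces \<open>\<phi> - v\<close>, which is unbounded in general and meaningless for \<open>v = Infty\<close>.\<close>

lemma boundary_test_function:
  assumes rm: "riemann_map \<phi> U" and v: "v \<notin> Fin ` U"
  obtains h where "h holomorphic_on ball 0 1" "\<And>z. cmod z < 1 \<Longrightarrow> cmod (h z) \<le> 1"
    "\<And>z. cmod z < 1 \<Longrightarrow> h z \<noteq> 0"
    "\<forall>F. F \<le> principal (ball 0 1) \<longrightarrow> (h \<longlongrightarrow> 0) F \<longleftrightarrow> ((\<lambda>z. Fin (\<phi> z)) \<longlongrightarrow> v) F"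
proof (cases v)
  case (Fin a)
  then have "a \<notin> U" using v by auto
  then obtain s b \<rho> where s: "s holomorphic_on ball 0 1" "\<rho> > 0"
    "\<And>z. cmod z < 1 \<Longrightarrow> s z ^ 2 = \<phi> z - a" "\<And>z. s z \<noteq> 0" "\<And>z. cmod z < 1 \<Longrightarrow> \<rho> \<le> cmod (s z + b)" "b \<noteq> 0"
    using sqrt_branch_omits_ball[OF rm] by metis
  have nz: "s z + b \<noteq> 0" if "cmod z < 1" for z using s(2) s(5)[OF that] by auto
  \<comment> \<open>\<open>s / (s + b)\<close> vanishes exactly with \<open>s\<close> and has its
    pole at the centre \<open>- b\<close> of the omitted disc. Written as
    \<open>1 - b / (s + b)\<close> it is bounded by \<open>C\<close>.\<close>
  define C where "C = 1 + cmod b / \<rho>"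
  have "C > 0" using s(2) by (simp add: C_def add_pos_nonneg)
  define h where "h = (\<lambda>z. (s z / (s z + b)) / of_real C)"
  show ?thesis
  proof (rule that[of h, OF _ _ _ allI[OF impI]])
    show "h holomorphic_on ball 0 1"
      unfolding h_def using s(1) nz \<open>C > 0\<close> by (intro holomorphic_intros) auto
    show "cmod (h z) \<le> 1" if z: "cmod z < 1" for z
    proof -
      have "s z / (s z + b) = 1 - b / (s z + b)" using nz[OF z] by (simp add: field_simps)
      then have "cmod (s z / (s z + b)) \<le> cmod 1 + cmod (b / (s z + b))"
        by (simp only: norm_triangle_ineq4)
      also have "cmod (b / (s z + b)) \<le> cmod b / \<rho>"
        using s(2) s(5)[OF z] by (simp add: norm_divide frac_le)
      finally have "cmod (s z / (s z + b)) \<le> C" by (simp add: C_def)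
      moreover have "cmod (h z) = cmod (s z / (s z + b)) / C"
        using \<open>C > 0\<close> by (simp only: h_def norm_divide norm_of_real abs_of_pos)
      ultimately show ?thesis using \<open>C > 0\<close> by simp
    qed
    show "h z \<noteq> 0" if "cmod z < 1" for z using nz[OF that] s(4) \<open>C > 0\<close> by (simp add: h_def)
    fix F :: "complex filter" assume F: "F \<le> principal (ball 0 1)"
    then have ev: "eventually (\<lambda>z. cmod z < 1) F" by (simp add: le_principal)
    show "(h \<longlongrightarrow> 0) F \<longleftrightarrow> ((\<lambda>z. Fin (\<phi> z)) \<longlongrightarrow> v) F"
      unfolding Fin tendsto_Fin_iff
    proof
      assume "(h \<longlongrightarrow> 0) F"
      \<comment> \<open>Solving for \<open>s\<close> gives an expression in \<open>h\<close> that is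
        continuous at 0, so \<open>\<phi>\<close> is recovered from \<open>h\<close> as
        \<open>s\<^sup>2 + a\<close>.\<close>
      then have "((\<lambda>z. (b * (of_real C * h z) / (1 - of_real C * h z))\<^sup>2 + a) \<longlongrightarrow> a) F"
        by (auto intro!: tendsto_eq_intros)
      moreover have "eventually (\<lambda>z. (b * (of_real C * h z) / (1 - of_real C * h z))\<^sup>2 + a = \<phi> z) F"
        using ev
      proof eventually_elim
        case (elim z)
        have Ch: "of_real C * h z = s z / (s z + b)" using \<open>C > 0\<close> by (simp add: h_def)
        have "b * (of_real C * h z) / (1 - of_real C * h z) = s z"
          unfolding Ch using nz[OF elim] s(6) by (simp add: divide_simps)
        then show ?case using s(3)[OF elim] by simp
      qed
      ultimately show "(\<phi> \<longlongrightarrow> a) F" by (rule Lim_transform_eventually)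
    next
      assume "(\<phi> \<longlongrightarrow> a) F"
      then have "((\<lambda>z. cmod (\<phi> z - a)) \<longlongrightarrow> 0) F" by (intro tendsto_norm_zero) (rule Lim_null[THEN iffD1])
      from tendsto_real_sqrt[OF this] have "((\<lambda>z. sqrt (cmod (\<phi> z - a))) \<longlongrightarrow> 0) F" by simp
      moreover have "eventually (\<lambda>z. sqrt (cmod (\<phi> z - a)) = cmod (s z)) F"
        using ev by eventually_elim (simp add: s(3)[symmetric] norm_power)
      ultimately have "((\<lambda>z. cmod (s z)) \<longlongrightarrow> 0) F" by (rule Lim_transform_eventually)
      from tendsto_divide[OF this tendsto_const, of "\<rho> * C"] have "((\<lambda>z. cmod (s z) / (\<rho> * C)) \<longlongrightarrow> 0) F"
        using s(2) \<open>C > 0\<close> by simp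
      then show "(h \<longlongrightarrow> 0) F"
      proof (rule Lim_null_comparison[rotated])
        show "eventually (\<lambda>z. cmod (h z) \<le> cmod (s z) / (\<rho> * C)) F"
          using ev
        proof eventually_elim
          case (elim z)
          then show ?case using s(2) s(5)[OF elim] \<open>C > 0\<close>
            by (simp add: h_def norm_divide divide_right_mono frac_le flip: divide_divide_eq_left)
        qed
      qed
    qed
  qed
next
  case Infty
  obtain a where "a \<notin> U" using riemann_map_neq_UNIV[OF rm] by auto
  then obtain s b \<rho> where s: "s holomorphic_on ball 0 1" "\<rho> > 0"
    "\<And>z. cmod z < 1 \<Longrightarrow> s z ^ 2 = \<phi> z - a" "\<And>z. s z \<noteq> 0" "\<And>z. cmod z < 1 \<Longrightarrow> \<rho> \<le> cmod (s z + b)" "b \<noteq> 0"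
    using sqrt_branch_omits_ball[OF rm] by metis
  have nz: "s z + b \<noteq> 0" if "cmod z < 1" for z using s(2) s(5)[OF that] by auto
  \<comment> \<open>Now the Moebius map sends infinity to 0; it is bounded by 1 because
    \<open>s\<close> stays at distance at least \<open>\<rho>\<close> from
    \<open>- b\<close>.\<close>
  define h where "h = (\<lambda>z. of_real \<rho> * inverse (s z + b))"
  show ?thesis
  proof (rule that[of h, OF _ _ _ allI[OF impI]])
    show "h holomorphic_on ball 0 1"
      unfolding h_def using s(1) nz by (intro holomorphic_intros) auto
    show "h z \<noteq> 0" if "cmod z < 1" for z
      using s(2) nz[OF that] by (simp add: h_def)
    show "cmod (h z) \<le> 1" if "cmod z < 1" for z
    proof -
      have "cmod (h z) = \<rho> * inverse (cmod (s z + b))"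
        using s(2) by (simp only: h_def norm_mult norm_inverse norm_of_real abs_of_pos)
      also have "\<dots> \<le> 1"
        using s(2) s(5)[OF that] by (subst divide_inverse[symmetric]) (simp add: divide_le_eq)
      finally show ?thesis .
    qed
    fix F :: "complex filter" assume F: "F \<le> principal (ball 0 1)"
    then have ev: "eventually (\<lambda>z. cmod z < 1) F" by (simp add: le_principal)
    have "(h \<longlongrightarrow> 0) F \<longleftrightarrow> ((\<lambda>z. inverse (s z + b)) \<longlongrightarrow> 0) F"
    proof
      assume "(h \<longlongrightarrow> 0) F"
      from tendsto_mult_right_zero[OF this, of "inverse (of_real \<rho>)"]
      show "((\<lambda>z. inverse (s z + b)) \<longlongrightarrow> 0) F" using s(2) by (simp add: h_def flip: mult.assoc)
    qed (auto simp: h_def intro: tendsto_mult_right_zero)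
    also have "\<dots> \<longleftrightarrow> filterlim (\<lambda>z. inverse (s z + b)) (at 0) F"
      using ev nz by (auto simp: filterlim_at elim: eventually_mono)
    also have "\<dots> \<longleftrightarrow> filterlim (\<lambda>z. s z + b) at_infinity F"
      by (rule filterlim_inverse_at_iff)
    also have "\<dots> \<longleftrightarrow> filterlim \<phi> at_infinity F"
    proof
      assume "filterlim (\<lambda>z. s z + b) at_infinity F"
      from tendsto_add_filterlim_at_infinity[OF tendsto_const this, of "- b"]
      have "filterlim s at_infinity F" by simp
      from filterlim_at_infinity_times[OF this this] have "filterlim (\<lambda>z. s z * s z) at_infinity F" .
      from tendsto_add_filterlim_at_infinity[OF tendsto_const this, of a]
      have "filterlim (\<lambda>z. a + s z * s z) at_infinity F" .
      moreover have "eventually (\<lambda>z. a + s z * s z = \<phi> z) F"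
        using ev by eventually_elim (use s(3) in \<open>simp add: power2_eq_square\<close>)
      ultimately show "filterlim \<phi> at_infinity F"
        using filterlim_cong[OF refl refl] by metis
    next
      assume "filterlim \<phi> at_infinity F"
      from tendsto_add_filterlim_at_infinity[OF tendsto_const this, of "- a"]
      have "filterlim (\<lambda>z. \<phi> z - a) at_infinity F" by simp
      then have "filterlim (\<lambda>z. sqrt (cmod (\<phi> z - a))) at_top F"
        unfolding filterlim_at_infinity_conv_norm_at_top by (rule filterlim_compose[OF sqrt_at_top])
      moreover have "eventually (\<lambda>z. sqrt (cmod (\<phi> z - a)) = cmod (s z)) F"
        using ev by eventually_elim (simp add: s(3)[symmetric] norm_power)
      ultimately have "filterlim (\<lambda>z. cmod (s z)) at_top F"
        using filterlim_cong[OF refl refl] by metis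
      then have "filterlim s at_infinity F" unfolding filterlim_at_infinity_conv_norm_at_top .
      from tendsto_add_filterlim_at_infinity[OF tendsto_const this, of b]
      show "filterlim (\<lambda>z. s z + b) at_infinity F" by (simp add: add.commute)
    qed
    finally show "(h \<longlongrightarrow> 0) F \<longleftrightarrow> ((\<lambda>z. Fin (\<phi> z)) \<longlongrightarrow> v) F"
      unfolding Infty tendsto_Infty_iff .
  qed
qed

section \<open>Pulling access curves back to the disc\<close>

lemma riemann_map_inverse:
  assumes rm: "riemann_map \<phi> U"
  shows "inv_into (ball 0 1) \<phi> holomorphic_on U"
    and "\<And>w. w \<in> U \<Longrightarrow> cmod (inv_into (ball 0 1) \<phi> w) < 1"
    and "\<And>w. w \<in> U \<Longrightarrow> \<phi> (inv_into (ball 0 1) \<phi> w) = w"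
    and "\<And>z. cmod z < 1 \<Longrightarrow> inv_into (ball 0 1) \<phi> (\<phi> z) = z"
proof -
  have \<phi>: "\<phi> holomorphic_on ball 0 1" using rm by (simp add: riemann_map_def)
  note im = riemann_map_image[OF rm] and inj = riemann_map_inj[OF rm]
  show inv: "inv_into (ball 0 1) \<phi> (\<phi> z) = z" if "cmod z < 1" for z
    using inv_into_f_f[OF inj, of z] that by simp
  obtain \<psi> where \<psi>: "\<psi> holomorphic_on U" "\<And>z. z \<in> ball 0 1 \<Longrightarrow> \<psi> (\<phi> z) = z"
    using holomorphic_has_inverse[OF \<phi> open_ball inj] im by metis
  have "\<psi> w = inv_into (ball 0 1) \<phi> w" if "w \<in> U" for w
    using that \<psi>(2) inv unfolding im[symmetric] by auto
  then show "inv_into (ball 0 1) \<phi> holomorphic_on U"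
    using \<psi>(1) holomorphic_transform by blast
  show "cmod (inv_into (ball 0 1) \<phi> w) < 1" "\<phi> (inv_into (ball 0 1) \<phi> w) = w" if "w \<in> U" for w
    using inv_into_into[of w \<phi> "ball 0 1"] f_inv_into_f[of w \<phi> "ball 0 1"] that im by auto
qed

text \<open>The pull-back that occurs in \<open>corresponds\<close>, as a function on the sphere; it
  inverts \<open>\<phi>\<close> on the image of \<open>U\<close> under \<open>Fin\<close>.\<close>

definition sphere_inv :: "(complex \<Rightarrow> complex) \<Rightarrow> csphere \<Rightarrow> complex" where
  "sphere_inv \<phi> p = inv_into (ball 0 1) \<phi> (to_complex p)"

lemma sphere_inv_in_disc:
  "riemann_map \<phi> U \<Longrightarrow> p \<in> Fin ` U \<Longrightarrow> cmod (sphere_inv \<phi> p) < 1"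
  "riemann_map \<phi> U \<Longrightarrow> p \<in> Fin ` U \<Longrightarrow> Fin (\<phi> (sphere_inv \<phi> p)) = p"
  using riemann_map_inverse(2,3) by (fastforce simp: sphere_inv_def)+

lemma sphere_inv_Fin: "riemann_map \<phi> U \<Longrightarrow> cmod z < 1 \<Longrightarrow> sphere_inv \<phi> (Fin (\<phi> z)) = z"
  using riemann_map_inverse(4) by (simp add: sphere_inv_def)

lemma continuous_on_sphere_inv:
  assumes rm: "riemann_map \<phi> U" shows "continuous_on (Fin ` U) (sphere_inv \<phi>)"
proof -
  have c1: "continuous_on (Fin ` U) to_complex"
    unfolding continuous_on_def
  proof
    fix p assume "p \<in> Fin ` U"
    then obtain z where "p = Fin z" by blast
    then show "(to_complex \<longlongrightarrow> to_complex p) (at p within Fin ` U)"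
      using tendsto_to_complex[OF tendsto_ident_at, of z "Fin ` U"] by simp
  qed
  have c2: "continuous_on U (inv_into (ball 0 1) \<phi>)"
    using riemann_map_inverse(1)[OF rm] by (rule holomorphic_on_imp_continuous_on)
  show ?thesis
    unfolding sphere_inv_def by (rule continuous_on_compose2[OF c2 c1]) auto
qed

lemma access_curve_preimage:
  assumes rm: "riemann_map \<phi> U" and \<gamma>: "access_curve U z0 v \<gamma>"
  shows "continuous_on {0..<1} (\<lambda>t. sphere_inv \<phi> (\<gamma> t))"
    and "(\<lambda>t. sphere_inv \<phi> (\<gamma> t)) ` {0..<1} \<subseteq> ball 0 1"
    and "\<And>t. 0 \<le> t \<Longrightarrow> t < 1 \<Longrightarrow> Fin (\<phi> (sphere_inv \<phi> (\<gamma> t))) = \<gamma> t"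
    and "(\<gamma> \<longlongrightarrow> v) (at_left 1)"
    and "((\<lambda>t. Fin (\<phi> (sphere_inv \<phi> (\<gamma> t)))) \<longlongrightarrow> v) (at_left 1)"
proof -
  have c: "continuous_on {0..1} \<gamma>" and im: "\<gamma> ` {0..<1} \<subseteq> Fin ` U" and fin: "\<gamma> 1 = v"
    using \<gamma> by (auto simp: access_curve_def path_def pathfinish_def)
  show "continuous_on {0..<1} (\<lambda>t. sphere_inv \<phi> (\<gamma> t))"
    by (rule continuous_on_compose2[OF continuous_on_sphere_inv[OF rm] _ im])
      (rule continuous_on_subset[OF c], auto)
  show "(\<lambda>t. sphere_inv \<phi> (\<gamma> t)) ` {0..<1} \<subseteq> ball 0 1"
    using sphere_inv_in_disc(1)[OF rm] im by (auto simp: image_subset_iff)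
  show eq: "Fin (\<phi> (sphere_inv \<phi> (\<gamma> t))) = \<gamma> t" if "0 \<le> t" "t < 1" for t
    using sphere_inv_in_disc(2)[OF rm] im that by (auto simp: image_subset_iff)
  have "(\<gamma> \<longlongrightarrow> \<gamma> 1) (at 1 within {0..1})" using c by (simp add: continuous_on)
  then show lim: "(\<gamma> \<longlongrightarrow> v) (at_left 1)"
    using at_within_Icc_at_left[of 0 "1::real"] fin by simp
  have "eventually (\<lambda>t. t \<in> {0<..<1}) (at_left (1::real))" by (rule eventually_at_left_real) simp
  then have "eventually (\<lambda>t. \<gamma> t = Fin (\<phi> (sphere_inv \<phi> (\<gamma> t)))) (at_left 1)"
    by eventually_elim (simp add: eq)
  with lim show "((\<lambda>t. Fin (\<phi> (sphere_inv \<phi> (\<gamma> t)))) \<longlongrightarrow> v) (at_left 1)"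
    by (rule Lim_transform_eventually)
qed

text \<open>The filter form of the test function, taken at the image filter
  \<open>filtermap z G\<close>, covers curves and radii at once.\<close>

lemma test_function_tendsto_iff:
  assumes h: "\<forall>F. F \<le> principal (ball 0 1) \<longrightarrow> (h \<longlongrightarrow> 0) F \<longleftrightarrow> ((\<lambda>z. Fin (\<phi> z)) \<longlongrightarrow> v) F"
    and ev: "eventually (\<lambda>x. cmod (z x) < 1) G"
  shows "((\<lambda>x. h (z x)) \<longlongrightarrow> 0) G \<longleftrightarrow> ((\<lambda>x. Fin (\<phi> (z x))) \<longlongrightarrow> v) G"
  using h[THEN spec, of "filtermap z G"] ev by (simp add: le_principal eventually_filtermap filterlim_filtermap)

lemma access_curve_lands:
  assumes rm: "riemann_map \<phi> U" and v: "v \<notin> Fin ` U" and \<gamma>: "access_curve U z0 v \<gamma>"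
  obtains \<zeta> where "cmod \<zeta> = 1" "((\<lambda>t. sphere_inv \<phi> (\<gamma> t)) \<longlongrightarrow> \<zeta>) (at_left 1)"
    "has_radial_limit (\<lambda>z. Fin (\<phi> z)) \<zeta> v"
proof -
  obtain h where h: "h holomorphic_on ball 0 1" "\<And>z. cmod z < 1 \<Longrightarrow> cmod (h z) \<le> 1"
    "\<And>z. cmod z < 1 \<Longrightarrow> h z \<noteq> 0"
    "\<forall>F. F \<le> principal (ball 0 1) \<longrightarrow> (h \<longlongrightarrow> 0) F \<longleftrightarrow> ((\<lambda>z. Fin (\<phi> z)) \<longlongrightarrow> v) F"
    using boundary_test_function[OF rm v] by metis
  note p = access_curve_preimage[OF rm \<gamma>]
  have ev: "eventually (\<lambda>t. t \<in> {0<..<1}) (at_left (1::real))" by (rule eventually_at_left_real) simp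
  then have in_disc: "eventually (\<lambda>t. cmod (sphere_inv \<phi> (\<gamma> t)) < 1) (at_left 1)"
    by (rule eventually_mono) (use p(2) in \<open>auto simp: image_subset_iff\<close>)
  have lim: "((\<lambda>t. h (sphere_inv \<phi> (\<gamma> t))) \<longlongrightarrow> 0) (at_left 1)"
    using p(5) by (rule test_function_tendsto_iff[OF h(4) in_disc, THEN iffD2])
  obtain \<zeta> where \<zeta>: "cmod \<zeta> = 1" "((\<lambda>t. sphere_inv \<phi> (\<gamma> t)) \<longlongrightarrow> \<zeta>) (at_left 1)"
    using lands_if_tendsto_0[OF h(1-3) p(1,2) lim] by blast
  have "has_radial_limit h \<zeta> 0"
    by (rule Lindelof_radial[OF h(1,2) p(1,2) \<zeta>(2,1) lim])
  moreover have radius: "eventually (\<lambda>t. cmod (of_real t * \<zeta>) < 1) (at_left 1)"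
    using ev by (rule eventually_mono) (auto simp: norm_mult \<zeta>)
  ultimately have "has_radial_limit (\<lambda>z. Fin (\<phi> z)) \<zeta> v"
    unfolding has_radial_limit_def by (intro test_function_tendsto_iff[OF h(4) radius, THEN iffD1])
  then show ?thesis using that \<zeta> by blast
qed

text \<open>For \<open>t\<close> near 1, uniform continuity puts the points \<open>H (s, t)\<close>
  close to \<open>v\<close> for all \<open>s\<close> at once. As \<open>s\<close> varies, their
  preimages form a path between the two pulled-back curves on which \<open>h\<close> is small, and
  Koebe's lemma makes its endpoints close.\<close>

lemma access_homotopic_same_landing_point:
  assumes rm: "riemann_map \<phi> U" and v: "v \<notin> Fin ` U"
    and hom: "access_homotopic U z0 v \<gamma> \<delta>"
    and lim: "((\<lambda>t. sphere_inv \<phi> (\<gamma> t)) \<longlongrightarrow> \<zeta>) (at_left 1)"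
  shows "((\<lambda>t. sphere_inv \<phi> (\<delta> t)) \<longlongrightarrow> \<zeta>) (at_left 1)"
proof -
  obtain h where h: "h holomorphic_on ball 0 1" "\<And>z. cmod z < 1 \<Longrightarrow> cmod (h z) \<le> 1"
    "\<And>z. cmod z < 1 \<Longrightarrow> h z \<noteq> 0"
    "\<forall>F. F \<le> principal (ball 0 1) \<longrightarrow> (h \<longlongrightarrow> 0) F \<longleftrightarrow> ((\<lambda>z. Fin (\<phi> z)) \<longlongrightarrow> v) F"
    using boundary_test_function[OF rm v] by metis
  have small: "\<exists>d>0. \<forall>z. cmod z < 1 \<and> dist (Fin (\<phi> z)) v < d \<longrightarrow> cmod (h z) < e" if "e > 0" for e
  proof -
    \<comment> \<open>The coarsest filter within the disc along which \<open>\<phi>\<close> tends to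
      \<open>v\<close>; the limit of \<open>h\<close> along it is the required epsilon-delta
      statement.\<close>
    define F where "F = inf (filtercomap (\<lambda>z. Fin (\<phi> z)) (nhds v)) (principal (ball 0 1))"
    have "F \<le> filtercomap (\<lambda>z. Fin (\<phi> z)) (nhds v)" by (simp add: F_def)
    then have "((\<lambda>z. Fin (\<phi> z)) \<longlongrightarrow> v) F"
      using filterlim_filtercomap filterlim_mono by blast
    then have "(h \<longlongrightarrow> 0) F" using h(4)[THEN spec, of F] by (simp add: F_def)
    from tendstoD[OF this \<open>e > 0\<close>] show ?thesis
      unfolding F_def eventually_inf_principal eventually_filtercomap eventually_nhds_metric
      by auto
  qed
  obtain H :: "real \<times> real \<Rightarrow> csphere" where H: "continuous_on ({0..1} \<times> {0..1}) H" "\<And>x. H (0, x) = \<gamma> x" "\<And>x. H (1, x) = \<delta> x"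
    "\<And>s. s \<in> {0..1} \<Longrightarrow> access_curve U z0 v (\<lambda>t. H (s, t))"
    using hom unfolding access_homotopic_def homotopic_with_def by auto
  have H1: "H (s, 1) = v" if "s \<in> {0..1}" for s
    using H(4)[OF that] by (simp add: access_curve_def pathfinish_def)
  have HU: "H (s, t) \<in> Fin ` U" if "s \<in> {0..1}" "0 \<le> t" "t < 1" for s t
    using H(4)[OF that(1)] that(2,3) by (auto simp: access_curve_def image_subset_iff)
  have uc: "uniformly_continuous_on ({0..1} \<times> {0..1}) H"
    by (rule compact_uniformly_continuous[OF H(1)]) (intro compact_Times compact_Icc)
  have "((\<lambda>t. dist (sphere_inv \<phi> (\<gamma> t)) (sphere_inv \<phi> (\<delta> t))) \<longlongrightarrow> 0) (at_left 1)"
  proof (rule tendstoI)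
    fix d :: real assume "d > 0"
    obtain e where e: "e > 0"
      "\<And>s. path s \<Longrightarrow> path_image s \<subseteq> ball 0 1 \<Longrightarrow> (\<And>z. z \<in> path_image s \<Longrightarrow> cmod (h z) < e)
       \<Longrightarrow> dist (pathstart s) (pathfinish s) < d"
      using Koebe_arc_lemma[OF h(1-3) \<open>d > 0\<close>] by metis
    obtain d' where d': "d' > 0" "\<And>z. cmod z < 1 \<Longrightarrow> dist (Fin (\<phi> z)) v < d' \<Longrightarrow> cmod (h z) < e"
      using small[OF e(1)] by blast
    obtain r where r: "r > 0" "\<And>x y. x \<in> {0..1} \<times> {0..1} \<Longrightarrow> y \<in> {0..1} \<times> {0..1} \<Longrightarrow> dist y x < r \<Longrightarrow> dist (H y) (H x) < d'"
      using uc d'(1) unfolding uniformly_continuous_on_def by metis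
    have "max 0 (1 - r) < 1" using r(1) by simp
    from eventually_at_left_real[OF this]
    show "eventually (\<lambda>t. dist (dist (sphere_inv \<phi> (\<gamma> t)) (sphere_inv \<phi> (\<delta> t))) 0 < d) (at_left 1)"
    proof eventually_elim
      case (elim t)
      then have t: "0 \<le> t" "t < 1" "1 - t < r" by auto
      define q where "q = (\<lambda>s. sphere_inv \<phi> (H (s, t)))"
      have "path q" unfolding path_def q_def
      proof (rule continuous_on_compose2[OF continuous_on_sphere_inv[OF rm]])
        show "continuous_on {0..1} (\<lambda>s. H (s, t))"
          using t by (rule_tac continuous_on_compose2[OF H(1)]) (auto intro!: continuous_intros)
        show "(\<lambda>s. H (s, t)) ` {0..1} \<subseteq> Fin ` U" using HU t by auto
      qed
      moreover have "path_image q \<subseteq> ball 0 1"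
        using sphere_inv_in_disc(1)[OF rm] HU t by (auto simp: path_image_def q_def)
      moreover have "cmod (h z) < e" if z: "z \<in> path_image q" for z
      proof -
        obtain s where s: "s \<in> {0..1}" "z = q s" using z by (auto simp: path_image_def)
        have "dist (H (s, t)) (H (s, 1)) < d'"
          using s(1) t by (intro r(2)) (auto simp: dist_Pair_Pair dist_real_def)
        then show ?thesis
          using d'(2)[of z] sphere_inv_in_disc[OF rm HU[OF s(1) t(1,2)]] H1[OF s(1)] s(2) by (simp add: q_def)
      qed
      ultimately have "dist (pathstart q) (pathfinish q) < d" by (rule e(2))
      then show ?case by (simp add: q_def pathstart_def pathfinish_def H(2,3))
    qed
  qed
  then have "((\<lambda>t. sphere_inv \<phi> (\<gamma> t) - sphere_inv \<phi> (\<delta> t)) \<longlongrightarrow> 0) (at_left 1)"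
    unfolding dist_norm by (rule tendsto_norm_zero_cancel)
  from tendsto_diff[OF lim this] show ?thesis by simp
qed

lemma access_corresponds:
  assumes rm: "riemann_map \<phi> U" and v: "v \<notin> Fin ` U" and \<gamma>: "access_curve U z0 v \<gamma>"
    and lim: "((\<lambda>t. sphere_inv \<phi> (\<gamma> t)) \<longlongrightarrow> \<zeta>) (at_left 1)"
  shows "corresponds \<phi> v {\<delta>. access_homotopic U z0 v \<gamma> \<delta>} \<zeta>"
proof -
  obtain \<zeta>' where \<zeta>': "cmod \<zeta>' = 1" "((\<lambda>t. sphere_inv \<phi> (\<gamma> t)) \<longlongrightarrow> \<zeta>') (at_left 1)"
    "has_radial_limit (\<lambda>z. Fin (\<phi> z)) \<zeta>' v"
    using access_curve_lands[OF rm v \<gamma>] by blast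
  have "\<zeta>' = \<zeta>" using tendsto_unique[OF _ \<zeta>'(2) lim] by simp
  then show ?thesis
    using \<zeta>' access_homotopic_same_landing_point[OF rm v _ lim]
    unfolding corresponds_def sphere_inv_def[symmetric] by auto
qed

section \<open>The inner function and invariant accesses\<close>

lemma inner_function_facts:
  assumes mero: "meromorphic_map f" and inv: "f ` U \<subseteq> Fin ` U" and rm: "riemann_map \<phi> U"
    and g: "\<And>z. z \<in> ball 0 1 \<Longrightarrow> g z = inv_into (ball 0 1) \<phi> (to_complex (f (\<phi> z)))"
  shows "g holomorphic_on ball 0 1" and "\<And>z. cmod z < 1 \<Longrightarrow> cmod (g z) < 1"
    and "\<And>z. cmod z < 1 \<Longrightarrow> f (\<phi> z) = Fin (\<phi> (g z))"
proof -
  have \<phi>U: "\<phi> z \<in> U" if "cmod z < 1" for z using riemann_map_image[OF rm] that by auto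
  have fU: "f (\<phi> z) \<in> Fin ` U" if "cmod z < 1" for z using \<phi>U[OF that] inv by blast
  show "cmod (g z) < 1" "f (\<phi> z) = Fin (\<phi> (g z))" if "cmod z < 1" for z
    using sphere_inv_in_disc[OF rm fU[OF that]] g[of z] that by (simp_all add: sphere_inv_def)
  have "(\<lambda>w. to_complex (f w)) analytic_on U"
    unfolding analytic_on_analytic_at[of _ U]
    using meromorphic_map_analytic[OF mero] inv by (metis csphere.distinct(1) image_iff image_subset_iff)
  then have F: "(\<lambda>w. to_complex (f w)) holomorphic_on U" by (rule analytic_imp_holomorphic)
  have "inv_into (ball 0 1) \<phi> \<circ> ((\<lambda>w. to_complex (f w)) \<circ> \<phi>) holomorphic_on ball 0 1"
  proof (rule holomorphic_on_compose_gen[OF _ riemann_map_inverse(1)[OF rm]])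
    show "(\<lambda>w. to_complex (f w)) \<circ> \<phi> holomorphic_on ball 0 1"
      using rm \<phi>U by (intro holomorphic_on_compose_gen[OF _ F]) (auto simp: riemann_map_def)
    show "((\<lambda>w. to_complex (f w)) \<circ> \<phi>) ` ball 0 1 \<subseteq> U"
      using fU by fastforce
  qed
  then show "g holomorphic_on ball 0 1"
    by (rule holomorphic_transform) (simp add: g)
qed

theorem invariant_access_boundary_fixed_point:
  assumes mero: "meromorphic_map f" and inv: "f ` U \<subseteq> Fin ` U" and rm: "riemann_map \<phi> U"
    and g: "\<And>z. z \<in> ball 0 1 \<Longrightarrow> g z = inv_into (ball 0 1) \<phi> (to_complex (f (\<phi> z)))"
    and acc: "invariant_access f U (\<phi> 0) v \<A>"
  shows "v = Infty \<or> (\<exists>z. v = Fin z \<and> fixed_point f z)"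
    and "\<exists>\<zeta>. boundary_fixed_point g \<zeta> \<and> corresponds \<phi> v \<A> \<zeta>"
proof -
  have G: "g holomorphic_on ball 0 1" "\<And>z. cmod z < 1 \<Longrightarrow> cmod (g z) < 1"
    "\<And>z. cmod z < 1 \<Longrightarrow> f (\<phi> z) = Fin (\<phi> (g z))"
    using inner_function_facts[OF mero inv rm, of g] g by blast+
  obtain \<gamma>0 where fr: "v \<in> frontier (Fin ` U)" and \<gamma>0: "access_curve U (\<phi> 0) v \<gamma>0"
    and \<A>: "\<A> = {\<delta>. access_homotopic U (\<phi> 0) v \<gamma>0 \<delta>}"
    using acc unfolding invariant_access_def is_access_def by blast
  have v: "v \<notin> Fin ` U" using fr frontier_Fin_image_iff[OF riemann_map_open[OF rm]] by blast
  obtain \<gamma> \<eta> where \<gamma>: "\<gamma> \<in> \<A>" and \<delta>: "\<eta> +++ image_curve f v \<gamma> \<in> \<A>"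
    using acc unfolding invariant_access_def by blast
  have acurve: "access_curve U (\<phi> 0) v \<delta>" if "\<delta> \<in> \<A>" for \<delta>
    using that homotopic_with_imp_property unfolding \<A> access_homotopic_def by blast
  define \<delta> where "\<delta> = \<eta> +++ image_curve f v \<gamma>"
  obtain \<zeta> where \<zeta>: "cmod \<zeta> = 1" "((\<lambda>t. sphere_inv \<phi> (\<gamma>0 t)) \<longlongrightarrow> \<zeta>) (at_left 1)"
    using access_curve_lands[OF rm v \<gamma>0] by blast
  have land: "((\<lambda>t. sphere_inv \<phi> (\<delta> t)) \<longlongrightarrow> \<zeta>) (at_left 1)" if "\<delta> \<in> \<A>" for \<delta>
    using that access_homotopic_same_landing_point[OF rm v _ \<zeta>(2)] unfolding \<A> by blast
  note p = access_curve_preimage[OF rm acurve[OF \<gamma>]] and q = access_curve_preimage[OF rm acurve[OF \<delta>]]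
  define \<sigma> where "\<sigma> = (\<lambda>t. sphere_inv \<phi> (\<gamma> t))"
  have \<sigma>1: "cmod (\<sigma> t) < 1" if "0 \<le> t" "t < 1" for t
    using p(2) that by (auto simp: \<sigma>_def image_subset_iff)
  have \<delta>eq: "\<delta> ((1 + t) / 2) = f (\<phi> (\<sigma> t))" if "0 < t" "t < 1" for t
  proof -
    have "\<delta> ((1 + t) / 2) = sphere_map f (\<gamma> t)"
      using that by (simp add: \<delta>_def joinpaths_def image_curve_def add_divide_distrib)
    also have "\<gamma> t = Fin (\<phi> (\<sigma> t))" using p(3)[of t] that by (simp add: \<sigma>_def)
    finally show ?thesis by simp
  qed
  have ev: "eventually (\<lambda>t. t \<in> {0<..<1}) (at_left (1::real))" by (rule eventually_at_left_real) simp
  \<comment> \<open>The second half of the joined curve is the image curve, so limits along the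
    image of \<open>\<gamma>\<close> are limits of the joined curve in the parameter
    \<open>(1 + t) / 2\<close>.\<close>
  have half: "filterlim (\<lambda>t::real. (1 + t) / 2) (at_left 1) (at_left 1)"
  proof (rule filterlim_at_withinI)
    show "((\<lambda>t::real. (1 + t) / 2) \<longlongrightarrow> 1) (at_left 1)"
      by (rule tendsto_eq_intros refl | simp)+
    show "eventually (\<lambda>t::real. (1 + t) / 2 \<in> {..<1} - {1}) (at_left 1)"
      using ev by eventually_elim auto
  qed
  have "((\<lambda>t. \<delta> ((1 + t) / 2)) \<longlongrightarrow> v) (at_left 1)"
    using filterlim_compose[OF q(4) half] by (simp add: \<delta>_def)
  then have flim: "((\<lambda>t. f (\<phi> (\<sigma> t))) \<longlongrightarrow> v) (at_left 1)"
    by (rule Lim_transform_eventually) (use ev \<delta>eq in \<open>auto elim: eventually_mono\<close>)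
  show "v = Infty \<or> (\<exists>z. v = Fin z \<and> fixed_point f z)"
    by (rule fixed_if_orbit_step_same_limit[OF mero trivial_limit_at_left_real _ flim]) (use p(5) in \<open>simp add: \<sigma>_def\<close>)
  have "((\<lambda>t. sphere_inv \<phi> (\<delta> ((1 + t) / 2))) \<longlongrightarrow> \<zeta>) (at_left 1)"
    using filterlim_compose[OF land[OF \<delta>] half] by (simp add: \<delta>_def)
  then have glim: "((\<lambda>t. g (\<sigma> t)) \<longlongrightarrow> \<zeta>) (at_left 1)"
  proof (rule Lim_transform_eventually)
    show "eventually (\<lambda>t. sphere_inv \<phi> (\<delta> ((1 + t) / 2)) = g (\<sigma> t)) (at_left 1)"
      using ev
    proof eventually_elim
      case (elim t)
      then have "cmod (\<sigma> t) < 1" by (intro \<sigma>1) auto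
      then show ?case
        using elim by (simp add: \<delta>eq G(2,3) sphere_inv_Fin[OF rm])
    qed
  qed
  \<comment> \<open>Lindelof's theorem was stated for functions bounded by 1 with limit 0, hence the
    shift by \<open>\<zeta>\<close> and the division by 2.\<close>
  have "has_radial_limit (\<lambda>z. (g z - \<zeta>) / 2) \<zeta> 0"
  proof (rule Lindelof_radial[OF _ _ _ _ _ \<zeta>(1)])
    show "continuous_on {0..<1} \<sigma>" "\<sigma> ` {0..<1} \<subseteq> ball 0 1" "(\<sigma> \<longlongrightarrow> \<zeta>) (at_left 1)"
      using p(1,2) land[OF \<gamma>] by (simp_all add: \<sigma>_def)
    show "(\<lambda>z. (g z - \<zeta>) / 2) holomorphic_on ball 0 1" by (intro holomorphic_intros G(1)) auto
    show "cmod ((g z - \<zeta>) / 2) \<le> 1" if "cmod z < 1" for z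
      using norm_triangle_ineq4[of "g z" \<zeta>] G(2)[OF that] \<zeta>(1) by (simp add: norm_divide)
    show "((\<lambda>t. (g (\<sigma> t) - \<zeta>) / 2) \<longlongrightarrow> 0) (at_left 1)"
      by (rule tendsto_eq_intros glim refl | simp)+
  qed
  then have "((\<lambda>t. 2 * ((g (of_real t * \<zeta>) - \<zeta>) / 2) + \<zeta>) \<longlongrightarrow> 2 * 0 + \<zeta>) (at_left 1)"
    unfolding has_radial_limit_def by (intro tendsto_intros)
  then have "boundary_fixed_point g \<zeta>"
    by (simp add: boundary_fixed_point_def has_radial_limit_def \<zeta>(1) diff_divide_distrib)
  moreover have "corresponds \<phi> v \<A> \<zeta>"
    unfolding \<A> by (rule access_corresponds[OF rm v \<gamma>0 \<zeta>(2)])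
  ultimately show "\<exists>\<zeta>. boundary_fixed_point g \<zeta> \<and> corresponds \<phi> v \<A> \<zeta>" by blast
qed

section \<open>Regular boundary fixed points\<close>

text \<open>In the formula for 1 - pdist^2 numerator and denominator are both of order u^2; for the
  denominator, |1 - cnj w * z| \<le> 2 (1 - |w|) + |z - w| \<le> 3 C u. This is the origin of
  \<open>(c / (3 * C))\<^sup>2\<close>; the maximum with 1/2 keeps \<open>\<rho>\<close>
  positive.\<close>

lemma pdist_bound:
  assumes "0 < c" "0 < C"
  obtains \<rho> where "0 < \<rho>" "\<rho> < 1"
    "\<And>u w z. 0 < u \<Longrightarrow> c * u \<le> 1 - cmod w \<Longrightarrow> 1 - cmod w \<le> C * u \<Longrightarrow> c * u \<le> 1 - cmod z \<Longrightarrow>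
       cmod (z - w) \<le> C * u \<Longrightarrow> cmod w < 1 \<and> cmod z < 1 \<and> pdist w z \<le> \<rho>"
proof -
  define q where "q = (c / (3 * C))\<^sup>2"
  have "q > 0" using assms by (simp add: q_def)
  define \<rho> where "\<rho> = max (1 / 2) (sqrt (1 - q))"
  have main: "cmod w < 1 \<and> cmod z < 1 \<and> pdist w z \<le> \<rho>"
    if u: "0 < u" and w: "c * u \<le> 1 - cmod w" "1 - cmod w \<le> C * u" and z: "c * u \<le> 1 - cmod z"
      and wz: "cmod (z - w) \<le> C * u" for u w z
  proof -
    have cu: "c * u > 0" using assms u by simp
    then have w1: "cmod w < 1" and z1: "cmod z < 1" using w z by linarith+
    have "1 - cnj w * z = of_real (1 - (cmod w)\<^sup>2) + cnj w * (w - z)"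
      by (simp only: of_real_diff complex_norm_square of_real_1) (simp add: algebra_simps)
    then have "cmod (1 - cnj w * z) \<le> cmod (of_real (1 - (cmod w)\<^sup>2)) + cmod (cnj w * (w - z))"
      by (metis norm_triangle_ineq)
    also have "\<dots> \<le> 2 * (1 - cmod w) + 1 * cmod (z - w)"
    proof (rule add_mono)
      have "1 - (cmod w)\<^sup>2 = (1 + cmod w) * (1 - cmod w)" by (simp add: power2_eq_square algebra_simps)
      moreover have "(1 + cmod w) * (1 - cmod w) \<le> 2 * (1 - cmod w)" using w1 by (intro mult_right_mono) auto
      moreover have "(cmod w)\<^sup>2 \<le> 1" using w1 by (simp add: power_le_one)
      ultimately show "cmod (of_real (1 - (cmod w)\<^sup>2)) \<le> 2 * (1 - cmod w)" by (simp only: norm_of_real)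
      show "cmod (cnj w * (w - z)) \<le> 1 * cmod (z - w)"
        using w1 by (simp only: norm_mult norm_minus_commute[of w z]) (intro mult_right_mono, auto)
    qed
    also have "\<dots> \<le> 2 * (C * u) + C * u" using mult_left_mono[OF w(2), of 2] wz by simp
    also have "\<dots> = 3 * C * u" by simp
    finally have D: "cmod (1 - cnj w * z) \<le> 3 * C * u" .
    have D0: "cmod (1 - cnj w * z) > 0" using one_minus_cnj_mult_neq_0[OF w1 z1] by simp
    have sq: "c * u \<le> 1 - (cmod y)\<^sup>2" if "c * u \<le> 1 - cmod y" "cmod y < 1" for y :: complex
    proof -
      have "(cmod y)\<^sup>2 \<le> cmod y" using that by (simp add: power2_eq_square mult_left_le)
      then show ?thesis using that by linarith
    qed
    have "q = (c * u)\<^sup>2 / (3 * C * u)\<^sup>2" using u by (simp add: q_def power_divide power_mult_distrib)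
    also have "\<dots> \<le> ((1 - (cmod w)\<^sup>2) * (1 - (cmod z)\<^sup>2)) / (cmod (1 - cnj w * z))\<^sup>2"
    proof (rule frac_le)
      show "(c * u)\<^sup>2 \<le> (1 - (cmod w)\<^sup>2) * (1 - (cmod z)\<^sup>2)"
        unfolding power2_eq_square[of "c * u"] using sq[of w] sq[of z] w z w1 z1 cu
        by (intro mult_mono) auto
      show "(cmod (1 - cnj w * z))\<^sup>2 \<le> (3 * C * u)\<^sup>2" using D by (intro power_mono) auto
      show "0 \<le> (1 - (cmod w)\<^sup>2) * (1 - (cmod z)\<^sup>2)"
        using w1 z1 by (intro mult_nonneg_nonneg) (auto simp: power_le_one)
    qed (use D0 in simp)
    also have "\<dots> = 1 - (pdist w z)\<^sup>2" using one_minus_pdist_sq[OF w1 z1] by simp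
    finally have "(pdist w z)\<^sup>2 \<le> 1 - q" by simp
    then have "pdist w z \<le> sqrt (1 - q)" by (rule real_le_rsqrt)
    then show ?thesis using w1 z1 by (simp add: \<rho>_def)
  qed
  have "sqrt (1 - q) < 1" using \<open>q > 0\<close> by simp
  then show ?thesis using that[of \<rho>] main by (simp add: \<rho>_def)
qed

text \<open>Schwarz-Pick with base point 0 bounds 1 - |z| by a multiple of 1 - |g z|. The factor is
  at most \<open>2 / m\<^sup>2\<close>, because |1 - cnj (g 0) * g z| \<ge> m.\<close>

lemma disc_self_map_boundary_growth:
  assumes hol: "g holomorphic_on ball 0 1" and g: "\<And>z. cmod z < 1 \<Longrightarrow> cmod (g z) < 1"
  obtains c where "0 < c" "c \<le> 1" "\<And>z. cmod z < 1 \<Longrightarrow> c * (1 - cmod z) \<le> 1 - cmod (g z)"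
proof -
  define m where "m = 1 - cmod (g 0)"
  have g0: "cmod (g 0) < 1" using g[of 0] by simp
  then have m: "0 < m" "m \<le> 1" by (auto simp: m_def)
  have "m\<^sup>2 / 2 * (1 - cmod z) \<le> 1 - cmod (g z)" if z: "cmod z < 1" for z
  proof -
    have "pdist (g 0) (g z) \<le> pdist 0 z" using Schwarz_Pick[OF hol g _ z] by simp
    also have "\<dots> = cmod z" by (simp add: pdist_def Moebius_function_simple)
    finally have "(pdist (g 0) (g z))\<^sup>2 \<le> (cmod z)\<^sup>2" by (intro power_mono pdist_nonneg)
    moreover have "(cmod z)\<^sup>2 \<le> cmod z" using z by (simp add: power2_eq_square mult_left_le)
    ultimately have "1 - cmod z \<le> (1 - (cmod (g 0))\<^sup>2) * (1 - (cmod (g z))\<^sup>2) / (cmod (1 - cnj (g 0) * g z))\<^sup>2"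
      using one_minus_pdist_sq[OF g0 g[OF z]] by linarith
    also have "\<dots> \<le> (1 * (1 - (cmod (g z))\<^sup>2)) / m\<^sup>2"
    proof (rule frac_le)
      show "(1 - (cmod (g 0))\<^sup>2) * (1 - (cmod (g z))\<^sup>2) \<le> 1 * (1 - (cmod (g z))\<^sup>2)"
        using g[OF z] by (intro mult_right_mono) (auto simp: power_le_one)
      show "0 \<le> 1 * (1 - (cmod (g z))\<^sup>2)" using g[OF z] by (simp add: power_le_one)
      have "cmod (cnj (g 0) * g z) \<le> cmod (g 0)" using g[OF z] by (simp add: norm_mult mult_left_le)
      then have "m \<le> cmod (1 - cnj (g 0) * g z)"
        using norm_triangle_ineq2[of 1 "cnj (g 0) * g z"] by (simp add: m_def)
      then show "m\<^sup>2 \<le> (cmod (1 - cnj (g 0) * g z))\<^sup>2" using m by (intro power_mono) auto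
    qed (use m in simp)
    also have "\<dots> \<le> (2 * (1 - cmod (g z))) / m\<^sup>2"
    proof (rule divide_right_mono)
      have "1 - (cmod (g z))\<^sup>2 = (1 + cmod (g z)) * (1 - cmod (g z))" by (simp add: power2_eq_square algebra_simps)
      also have "\<dots> \<le> 2 * (1 - cmod (g z))" using g[OF z] by (intro mult_right_mono) auto
      finally show "1 * (1 - (cmod (g z))\<^sup>2) \<le> 2 * (1 - cmod (g z))" by simp
    qed simp
    finally show ?thesis using m by (simp add: pos_le_divide_eq mult.commute)
  qed
  moreover have "0 < m\<^sup>2 / 2" "m\<^sup>2 / 2 \<le> 1" using m power_le_one[of m 2] by auto
  ultimately show ?thesis using that by blast
qed

lemma regular_boundary_fixed_point_Lipschitz:
  assumes "regular_boundary_fixed_point g \<zeta>"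
  obtains C r0 where "1 \<le> C" "0 \<le> r0" "r0 < 1"
    "\<And>r::real. r0 < r \<Longrightarrow> r < 1 \<Longrightarrow> cmod (g (of_real r * \<zeta>) - \<zeta>) \<le> C * (1 - r)"
proof -
  obtain L where L: "((\<lambda>t::real. (g (of_real t * \<zeta>) - \<zeta>) / ((of_real t - 1) * \<zeta>)) \<longlongrightarrow> L) (at_left 1)"
    and \<zeta>: "cmod \<zeta> = 1"
    using assms by (auto simp: regular_boundary_fixed_point_def boundary_fixed_point_def has_angular_derivative_def)
  have "eventually (\<lambda>t::real. cmod ((g (of_real t * \<zeta>) - \<zeta>) / ((of_real t - 1) * \<zeta>)) < cmod L + 1) (at_left 1)"
    by (rule order_tendstoD(2)[OF tendsto_norm[OF L]]) simp
  then obtain b where b: "b < 1" "\<And>t. b < t \<Longrightarrow> t < 1 \<Longrightarrow>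
      cmod ((g (of_real t * \<zeta>) - \<zeta>) / ((of_real t - 1) * \<zeta>)) < cmod L + 1"
    unfolding eventually_at_left_field by blast
  show ?thesis
  proof (rule that[of "cmod L + 1" "max 0 b"])
    fix r :: real assume r: "max 0 b < r" "r < 1"
    have "cmod ((of_real r - 1) * \<zeta>) = 1 - r"
      using r \<zeta> norm_of_real[of "r - 1"] by (simp add: norm_mult)
    then have "cmod (g (of_real r * \<zeta>) - \<zeta>) / (1 - r) < cmod L + 1"
      using b(2)[of r] r by (simp only: norm_divide)
    then show "cmod (g (of_real r * \<zeta>) - \<zeta>) \<le> (cmod L + 1) * (1 - r)"
      using r by (simp add: divide_less_eq less_imp_le)
  qed (use b in auto)
qed

text \<open>Distances are measured in units of u = 1 - r. The growth bound keeps the image of the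
  radial point at distance at least c u from the circle, the Lipschitz bound keeps it within C u of
  \<open>\<zeta>\<close>, and one more u leads from \<open>\<zeta>\<close> to the radial point;
  hence the constant \<open>C + 1\<close>.\<close>

lemma regular_radius_pdist:
  assumes hol: "g holomorphic_on ball 0 1" and g: "\<And>z. cmod z < 1 \<Longrightarrow> cmod (g z) < 1"
    and reg: "regular_boundary_fixed_point g \<zeta>"
  obtains \<rho> r0 where "0 < \<rho>" "\<rho> < 1" "0 \<le> r0" "r0 < 1"
    "\<And>r::real. r0 < r \<Longrightarrow> r < 1 \<Longrightarrow> pdist (of_real r * \<zeta>) (g (of_real r * \<zeta>)) \<le> \<rho>"
proof -
  have \<zeta>: "cmod \<zeta> = 1" using reg by (simp add: regular_boundary_fixed_point_def boundary_fixed_point_def)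
  obtain c where c: "0 < c" "c \<le> 1" "\<And>z. cmod z < 1 \<Longrightarrow> c * (1 - cmod z) \<le> 1 - cmod (g z)"
    using disc_self_map_boundary_growth[OF hol g] by blast
  obtain C r0 where C: "1 \<le> C" "0 \<le> r0" "r0 < 1"
    "\<And>r::real. r0 < r \<Longrightarrow> r < 1 \<Longrightarrow> cmod (g (of_real r * \<zeta>) - \<zeta>) \<le> C * (1 - r)"
    using regular_boundary_fixed_point_Lipschitz[OF reg] by blast
  have "0 < C + 1" using C by simp
  obtain \<rho> where \<rho>: "0 < \<rho>" "\<rho> < 1"
    "\<And>u w z. 0 < u \<Longrightarrow> c * u \<le> 1 - cmod w \<Longrightarrow> 1 - cmod w \<le> (C + 1) * u \<Longrightarrow> c * u \<le> 1 - cmod z \<Longrightarrow>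
       cmod (z - w) \<le> (C + 1) * u \<Longrightarrow> cmod w < 1 \<and> cmod z < 1 \<and> pdist w z \<le> \<rho>"
    using pdist_bound[OF c(1) \<open>0 < C + 1\<close>] by metis
  show ?thesis
  proof (rule that[OF \<rho>(1,2) C(2,3)])
    fix r :: real assume r: "r0 < r" "r < 1"
    define w where "w = of_real r * \<zeta>"
    have w: "cmod w = r" using r C \<zeta> by (simp add: w_def norm_mult)
    have "cmod (\<zeta> - w) = 1 - r"
    proof -
      have "\<zeta> - w = of_real (1 - r) * \<zeta>" by (simp add: w_def algebra_simps)
      then show ?thesis using r \<zeta> by (simp only: norm_mult norm_of_real) simp
    qed
    moreover have "cmod (g w - w) \<le> cmod (g w - \<zeta>) + cmod (\<zeta> - w)"
      using norm_triangle_ineq[of "g w - \<zeta>" "\<zeta> - w"] by simp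
    moreover have "cmod (g w - \<zeta>) \<le> C * (1 - r)" using C(4)[OF r] by (simp add: w_def)
    ultimately have "cmod (g w - w) \<le> (C + 1) * (1 - r)" by (simp add: algebra_simps)
    moreover have "c * (1 - r) \<le> 1 * (1 - r)" "1 * (1 - r) \<le> (C + 1) * (1 - r)"
      using r c C by (intro mult_right_mono; simp)+
    moreover have "c * (1 - r) \<le> 1 - cmod (g w)" using c(3)[of w] w r by simp
    ultimately show "pdist (of_real r * \<zeta>) (g (of_real r * \<zeta>)) \<le> \<rho>"
      using \<rho>(3)[of "1 - r" w "g w"] w r unfolding w_def[symmetric] by simp
  qed
qed

section \<open>Fixed points and the Fatou set\<close>

text \<open>A sequence drawn from the range either uses one index infinitely often and has a
  constant subsequence, or its indices tend to infinity and it inherits the limit.\<close>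

lemma uniform_limit_normal:
  assumes "uniform_limit V F l sequentially"
  shows "normal_on V (range F)"
  unfolding normal_on_def
proof (intro allI impI)
  fix s :: "nat \<Rightarrow> complex \<Rightarrow> csphere" assume "range s \<subseteq> range F"
  then have "\<forall>n. \<exists>k. s n = F k" by blast
  then obtain k where k: "\<And>n. s n = F (k n)" by metis
  show "\<exists>r l. strict_mono r \<and> (\<forall>K. K \<subseteq> V \<and> compact K \<longrightarrow> uniform_limit K (s \<circ> r) l sequentially)"
  proof (cases "\<exists>m. infinite {n. k n = m}")
    case True
    then obtain m where m: "infinite {n. k n = m}" by blast
    define r where "r = enumerate {n. k n = m}"
    have "strict_mono r" unfolding r_def using m by (rule strict_mono_enumerate)
    moreover have "s (r n) = F m" for n
      using enumerate_in_set[OF m, of n] by (simp add: k r_def)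
    then have "uniform_limit K (s \<circ> r) (F m) sequentially" for K
      by (simp add: uniform_limit_iff)
    ultimately show ?thesis by (intro exI[of _ r] exI[of _ "F m"]) simp
  next
    case False
    have "filterlim k at_top sequentially"
      unfolding filterlim_at_top eventually_sequentially
    proof (intro allI)
      fix M
      have "finite (\<Union>m<M. {n. k n = m})" using False by auto
      then obtain N where N: "\<forall>n\<in>(\<Union>m<M. {n. k n = m}). n < N"
        unfolding finite_nat_set_iff_bounded ..
      have "M \<le> k n" if "n \<ge> N" for n
      proof (rule ccontr)
        assume "\<not> M \<le> k n"
        then have "n \<in> (\<Union>m<M. {n. k n = m})" by simp
        then show False using N that by (meson leD)
      qed
      then show "\<exists>N. \<forall>n\<ge>N. M \<le> k n" by blast
    qed
    then have "uniform_limit V (\<lambda>n. F (k n)) l sequentially"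
      by (rule filterlim_compose[OF assms])
    then have "uniform_limit K (s \<circ> id) l sequentially" if "K \<subseteq> V" for K
      using uniform_limit_on_subset[OF _ that] by (simp add: k o_def)
    then show ?thesis using strict_mono_id by (intro exI[of _ id] exI[of _ l]) simp
  qed
qed

text \<open>Serves two cases: a disc on which \<open>f\<close> is the identity and a disc contracted
  towards an attracting fixed point.\<close>

lemma invariant_open_subset_fatou_set:
  assumes B: "open B" "\<And>w. w \<in> B \<Longrightarrow> f w = Fin (F w) \<and> F w \<in> B"
    and lim: "uniform_limit B (\<lambda>n w. Fin ((F ^^ n) w)) l sequentially"
  shows "B \<subseteq> fatou_set f"
proof -
  have it: "iterate f n w = Fin ((F ^^ n) w) \<and> (F ^^ n) w \<in> B" if "w \<in> B" for n w
  proof (induction n)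
    case (Suc n)
    then show ?case using B(2) by (simp add: iterate_def)
  qed (use that in \<open>simp add: iterate_def\<close>)
  have "uniform_limit B (iterate f) l sequentially"
    using lim by (rule uniform_limit_cong'[THEN iffD1, rotated 2]) (use it in auto)
  then have "normal_on B (range (iterate f))" by (rule uniform_limit_normal)
  moreover have "iterate_defined f n w" if "w \<in> B" for n w
    using it[OF that] by (simp add: iterate_defined_def)
  ultimately show ?thesis unfolding fatou_set_def using B(1) by blast
qed

lemma open_fatou_set: "open (fatou_set f)"
proof (subst open_subopen, intro ballI)
  fix z assume "z \<in> fatou_set f"
  then obtain V where V: "open V" "z \<in> V" "\<forall>n. \<forall>w\<in>V. iterate_defined f n w" "normal_on V (range (iterate f))"
    unfolding fatou_set_def by blast
  then have "V \<subseteq> fatou_set f" unfolding fatou_set_def by blast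
  then show "\<exists>T. open T \<and> z \<in> T \<and> T \<subseteq> fatou_set f" using V(1,2) by blast
qed

text \<open>A Fatou disc around such a point would meet \<open>U\<close> and be absorbed by it,
  components being maximal connected subsets.\<close>

lemma component_boundary_not_in_fatou_set:
  assumes "U \<in> components (fatou_set f)" "a \<in> closure U" "a \<notin> U"
  shows "a \<notin> fatou_set f"
proof
  assume "a \<in> fatou_set f"
  then obtain r where r: "r > 0" "ball a r \<subseteq> fatou_set f" using open_fatou_set openE by blast
  then obtain y where "y \<in> U" "dist y a < r" using assms(2) closure_approachable[of a U] by blast
  then have "U \<inter> ball a r \<noteq> {}" by (auto simp: dist_commute)
  then have "ball a r \<subseteq> U" using components_maximal[OF assms(1) connected_ball r(2)] by blast
  then show False using assms(3) r(1) centre_in_ball by blast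
qed

lemma meromorphic_map_finite_near:
  assumes mero: "meromorphic_map f" and fin: "f a \<noteq> Infty"
  obtains r where "r > 0" "(\<lambda>w. to_complex (f w)) holomorphic_on ball a r"
    "\<And>w. w \<in> ball a r \<Longrightarrow> f w = Fin (to_complex (f w))"
proof -
  obtain r where r: "r > 0" "(\<lambda>w. to_complex (f w)) holomorphic_on ball a r"
    using meromorphic_map_analytic[OF mero fin] unfolding analytic_on_def by blast
  have "f w = Fin (to_complex (f w))" if "w \<in> ball a r" for w
  proof -
    have "\<not> is_pole (\<lambda>w. to_complex (f w)) w"
      using not_is_pole_holomorphic[of "ball a r" w] r(2) that by simp
    then have "f w \<noteq> Infty" using mero by (simp add: meromorphic_map_def)
    then show ?thesis by (cases "f w") auto
  qed
  then show ?thesis using that r by blast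
qed

text \<open>If fixed points accumulated at \<open>a\<close>, the identity theorem would make
  \<open>f\<close> the identity near \<open>a\<close>; its iterates are then all equal, which puts
  \<open>a\<close> into the Fatou set.\<close>

lemma boundary_fixed_point_isolated:
  assumes mero: "meromorphic_map f" and a: "f a = Fin a" "a \<notin> fatou_set f"
  obtains r where "r > 0" "\<And>w. w \<in> ball a r \<Longrightarrow> w \<noteq> a \<Longrightarrow> f w \<noteq> Fin w"
proof -
  obtain r where r: "r > 0" "(\<lambda>w. to_complex (f w)) holomorphic_on ball a r"
    "\<And>w. w \<in> ball a r \<Longrightarrow> f w = Fin (to_complex (f w))"
    using meromorphic_map_finite_near[OF mero, of a] a(1) by auto
  define Z where "Z = {w \<in> ball a r. to_complex (f w) - w = 0}"
  have "\<not> a islimpt Z"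
  proof
    assume lim: "a islimpt Z"
    have id: "to_complex (f w) - w = 0" if "w \<in> ball a r" for w
    proof (rule analytic_continuation[of "\<lambda>w. to_complex (f w) - w" "ball a r" Z a])
      show "(\<lambda>w. to_complex (f w) - w) holomorphic_on ball a r" by (intro holomorphic_intros r(2))
    qed (use lim r(1) that in \<open>auto simp: Z_def\<close>)
    have "ball a r \<subseteq> fatou_set f"
    proof (rule invariant_open_subset_fatou_set[where F = id and l = Fin])
      show "f w = Fin (id w) \<and> id w \<in> ball a r" if "w \<in> ball a r" for w
        using r(3)[OF that] id[OF that] that by simp
      show "uniform_limit (ball a r) (\<lambda>n w. Fin ((id ^^ n) w)) Fin sequentially"
        by (simp add: uniform_limit_iff)
    qed simp
    then show False using a(2) r(1) centre_in_ball by blast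
  qed
  then obtain T where T: "open T" "a \<in> T" "\<And>y. y \<in> Z \<Longrightarrow> y \<in> T \<Longrightarrow> y = a"
    unfolding islimpt_def by blast
  then obtain e where e: "e > 0" "ball a e \<subseteq> T" using openE by blast
  show ?thesis
  proof (rule that[of "min r e"])
    fix w assume w: "w \<in> ball a (min r e)" "w \<noteq> a"
    then have "w \<in> ball a r" "w \<in> T" using e(2) by auto
    then have "w \<notin> Z" using T(3) w(2) by blast
    then show "f w \<noteq> Fin w" using \<open>w \<in> ball a r\<close> by (auto simp: Z_def)
  qed (use r e in simp)
qed

lemma attracting_fixed_point_in_fatou_set:
  assumes mero: "meromorphic_map f" and a: "f a = Fin a"
    and less: "cmod (deriv (\<lambda>w. to_complex (f w)) a) < 1"
  shows "a \<in> fatou_set f"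
proof -
  define F where "F = (\<lambda>w. to_complex (f w))"
  obtain r where r: "r > 0" "F holomorphic_on ball a r" "\<And>w. w \<in> ball a r \<Longrightarrow> f w = Fin (F w)"
    using meromorphic_map_finite_near[OF mero, of a] a unfolding F_def by auto
  have Fa: "F a = a" using a by (simp add: F_def)
  define c where "c = (1 + cmod (deriv F a)) / 2"
  have c: "0 < c" "c < 1" "cmod (deriv F a) < c" using less by (auto simp: c_def F_def add_pos_nonneg)
  have "(F has_field_derivative deriv F a) (at a)"
    using r by (intro holomorphic_derivI) auto
  then have "((\<lambda>w. (F w - a) / (w - a)) \<longlongrightarrow> deriv F a) (at a)"
    by (simp add: has_field_derivative_iff Fa)
  from order_tendstoD(2)[OF tendsto_norm[OF this] c(3)]
  obtain e where e: "e > 0" "\<And>w. w \<noteq> a \<Longrightarrow> dist w a < e \<Longrightarrow> cmod ((F w - a) / (w - a)) < c"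
    unfolding eventually_at by auto
  define B where "B = ball a (min r e)"
  have contr: "cmod (F w - a) \<le> c * cmod (w - a)" if "w \<in> B" for w
  proof (cases "w = a")
    case False
    then have "cmod ((F w - a) / (w - a)) < c" using e(2) that by (simp add: B_def dist_commute)
    then show ?thesis using False by (simp add: norm_divide divide_less_eq less_imp_le)
  qed (simp add: Fa)
  have FB: "F w \<in> B" if "w \<in> B" for w
  proof -
    have "c * cmod (w - a) \<le> 1 * cmod (w - a)" using c by (intro mult_right_mono) auto
    then show ?thesis using contr[OF that] that by (auto simp: B_def dist_norm norm_minus_commute)
  qed
  have it: "(F ^^ n) w \<in> B \<and> cmod ((F ^^ n) w - a) \<le> c ^ n * r" if "w \<in> B" for n w
  proof (induction n)
    case 0
    then show ?case using that by (auto simp: B_def dist_norm norm_minus_commute)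
  next
    case (Suc n)
    then have "cmod (F ((F ^^ n) w) - a) \<le> c * cmod ((F ^^ n) w - a)" by (intro contr) auto
    also have "\<dots> \<le> c * (c ^ n * r)" using Suc c by (intro mult_left_mono) auto
    finally show ?case using Suc FB by (simp add: mult.assoc)
  qed
  have "B \<subseteq> fatou_set f"
  proof (rule invariant_open_subset_fatou_set[where F = F and l = "\<lambda>_. Fin a"])
    show "f w = Fin (F w) \<and> F w \<in> B" if "w \<in> B" for w
      using r(3)[of w] FB[OF that] that by (simp add: B_def)
    show "uniform_limit B (\<lambda>n w. Fin ((F ^^ n) w)) (\<lambda>_. Fin a) sequentially"
      unfolding uniform_limit_iff
    proof (intro allI impI)
      fix d :: real assume "d > 0"
      \<comment> \<open>Continuity of \<open>Fin\<close> at the single point \<open>a\<close> yields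
        uniform convergence in the chordal metric, because the limit function is constant.\<close>
      have "(Fin \<longlongrightarrow> Fin a) (nhds a)" by (rule tendsto_Fin) (rule filterlim_ident)
      from tendstoD[OF this \<open>d > 0\<close>] obtain d' where d': "d' > 0" "\<And>x. dist x a < d' \<Longrightarrow> dist (Fin x) (Fin a) < d"
        unfolding eventually_nhds_metric by blast
      have "(\<lambda>n. c ^ n * r) \<longlonglongrightarrow> 0 * r" using c by (intro tendsto_mult LIMSEQ_realpow_zero tendsto_const) auto
      then have "eventually (\<lambda>n. c ^ n * r < d') sequentially" using d'(1) by (simp add: order_tendstoD)
      then show "eventually (\<lambda>n. \<forall>w\<in>B. dist (Fin ((F ^^ n) w)) (Fin a) < d) sequentially"
      proof eventually_elim
        case (elim n)
        show ?case
        proof (intro ballI d'(2))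
          fix w assume "w \<in> B"
          then show "dist ((F ^^ n) w) a < d'" using it[of w n] elim unfolding dist_norm by linarith
        qed
      qed
    qed
  qed (simp add: B_def)
  moreover have "a \<in> B" using r(1) e(1) by (simp add: B_def)
  ultimately show ?thesis by blast
qed

section \<open>Radial limits\<close>

lemma frequently_at_left_sequence:
  fixes q :: "real \<Rightarrow> complex"
  assumes K: "compact K" and fr: "frequently (\<lambda>r. q r \<in> K) (at_left 1)"
  obtains x a where "filterlim x (at_left 1) sequentially" "(\<lambda>n. q (x n)) \<longlonglongrightarrow> a" "a \<in> K"
proof -
  have ex: "\<exists>r. b < r \<and> r < 1 \<and> q r \<in> K" if "b < 1" for b
  proof (rule ccontr)
    assume "\<not> ?thesis"
    then have "eventually (\<lambda>r. \<not> q r \<in> K) (at_left 1)"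
      unfolding eventually_at_left_field using that by blast
    then show False using fr by (simp add: frequently_def)
  qed
  have "\<exists>r. 1 - 1 / real (Suc n) < r \<and> r < 1 \<and> q r \<in> K" for n
    by (rule ex) simp
  then obtain y where y: "\<And>n. 1 - 1 / real (Suc n) < y n \<and> y n < 1 \<and> q (y n) \<in> K" by metis
  obtain a s where a: "a \<in> K" "strict_mono s" "((\<lambda>n. q (y n)) \<circ> s) \<longlonglongrightarrow> a"
    using K y unfolding compact_def by metis
  have "y \<longlonglongrightarrow> 1"
  proof (rule tendsto_sandwich[of "\<lambda>n. 1 - 1 / real (Suc n)" y sequentially "\<lambda>_. 1"])
    show "(\<lambda>n. 1 - 1 / real (Suc n)) \<longlonglongrightarrow> 1"
      using tendsto_diff[OF tendsto_const LIMSEQ_inverse_real_of_nat, of 1] by (simp add: inverse_eq_divide)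
  qed (use y in \<open>auto intro: always_eventually less_imp_le\<close>)
  then have "(y \<circ> s) \<longlonglongrightarrow> 1" using LIMSEQ_subseq_LIMSEQ a(2) by blast
  then have "filterlim (y \<circ> s) (at_left 1) sequentially"
    using y by (intro filterlim_at_withinI) (auto intro!: always_eventually simp: less_imp_neq)
  then show ?thesis using that[of "y \<circ> s" a] a by (simp add: o_def)
qed

text \<open>At a point of \<open>U\<close> the inverse of \<open>\<phi>\<close> is continuous, but
  the radial points tend to the circle. By the transfer of limits, \<phi> along the image under
  \<open>g\<close> has the same limit as along the radius, so \<open>a\<close> is fixed.\<close>

lemma radial_cluster_point:
  assumes mero: "meromorphic_map f" and rm: "riemann_map \<phi> U"
    and g: "\<And>z. cmod z < 1 \<Longrightarrow> cmod (g z) < 1" "\<And>z. cmod z < 1 \<Longrightarrow> f (\<phi> z) = Fin (\<phi> (g z))"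
    and \<zeta>: "cmod \<zeta> = 1" and \<rho>: "0 < \<rho>" "\<rho> < 1" and r0: "0 \<le> r0" "r0 < 1"
    and pd: "\<And>r::real. r0 < r \<Longrightarrow> r < 1 \<Longrightarrow> pdist (of_real r * \<zeta>) (g (of_real r * \<zeta>)) \<le> \<rho>"
    and x: "filterlim x (at_left 1) sequentially" and a: "(\<lambda>n. \<phi> (of_real (x n) * \<zeta>)) \<longlonglongrightarrow> a"
  shows "a \<notin> U" "a \<in> closure U" "f a = Fin a"
proof -
  have ev: "eventually (\<lambda>n. x n \<in> {r0<..<1}) sequentially"
    by (rule eventually_compose_filterlim[OF eventually_at_left_real[OF r0(2)] x])
  have nrm: "cmod (of_real r * \<zeta>) < 1" if "r \<in> {r0<..<1}" for r
    using that r0 \<zeta> by (simp add: norm_mult)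
  have x1: "(\<lambda>n. of_real (x n) * \<zeta>) \<longlonglongrightarrow> of_real 1 * \<zeta>"
    using x by (intro tendsto_intros) (simp add: filterlim_at)
  show aU: "a \<notin> U"
  proof
    assume "a \<in> U"
    have "isCont (inv_into (ball 0 1) \<phi>) a"
      using holomorphic_on_imp_continuous_on[OF riemann_map_inverse(1)[OF rm]] \<open>a \<in> U\<close> riemann_map_open[OF rm]
      by (simp add: continuous_on_eq_continuous_at)
    from isCont_tendsto_compose[OF this a]
    have "(\<lambda>n. of_real (x n) * \<zeta>) \<longlonglongrightarrow> inv_into (ball 0 1) \<phi> a"
      by (rule Lim_transform_eventually)
        (use ev in \<open>rule eventually_mono, use riemann_map_inverse(4)[OF rm] nrm in auto\<close>)
    then have "inv_into (ball 0 1) \<phi> a = \<zeta>" using x1 LIMSEQ_unique by fastforce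
    then show False using riemann_map_inverse(2)[OF rm \<open>a \<in> U\<close>] \<zeta> by simp
  qed
  have inU: "\<phi> z \<in> U" if "cmod z < 1" for z using riemann_map_image[OF rm] that by auto
  show "a \<in> closure U"
  proof (rule Lim_in_closed_set[OF closed_closure _ _ a])
    show "eventually (\<lambda>n. \<phi> (of_real (x n) * \<zeta>) \<in> closure U) sequentially"
      using ev by (rule eventually_mono) (intro subsetD[OF closure_subset] inU nrm)
  qed simp
  have "((\<lambda>n. Fin (\<phi> (g (of_real (x n) * \<zeta>)))) \<longlongrightarrow> Fin a) sequentially"
  proof (rule tendsto_transfer_pdist[OF rm _ \<rho>])
    show "eventually (\<lambda>n. cmod (of_real (x n) * \<zeta>) < 1 \<and> cmod (g (of_real (x n) * \<zeta>)) < 1 \<and>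
        pdist (of_real (x n) * \<zeta>) (g (of_real (x n) * \<zeta>)) \<le> \<rho>) sequentially"
      using ev by (rule eventually_mono) (use nrm g(1) pd in auto)
    show "((\<lambda>n. Fin (\<phi> (of_real (x n) * \<zeta>))) \<longlongrightarrow> Fin a) sequentially" using a by (rule tendsto_Fin)
  qed (use aU in auto)
  then have "((\<lambda>n. f (\<phi> (of_real (x n) * \<zeta>))) \<longlongrightarrow> Fin a) sequentially"
    by (rule Lim_transform_eventually) (use ev in \<open>rule eventually_mono, use g(2) nrm in auto\<close>)
  from fixed_if_orbit_step_same_limit[OF mero _ tendsto_Fin[OF a] this]
  show "f a = Fin a" by (simp add: fixed_point_def)
qed

text \<open>All finite radial cluster points are fixed points, and these are isolated.\<close>

lemma regular_radial_limit_exists: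
  assumes mero: "meromorphic_map f" and comp: "U \<in> components (fatou_set f)" and rm: "riemann_map \<phi> U"
    and g: "\<And>z. cmod z < 1 \<Longrightarrow> cmod (g z) < 1" "\<And>z. cmod z < 1 \<Longrightarrow> f (\<phi> z) = Fin (\<phi> (g z))"
    and \<zeta>: "cmod \<zeta> = 1" and \<rho>: "0 < \<rho>" "\<rho> < 1" and r0: "0 \<le> r0" "r0 < 1"
    and pd: "\<And>r::real. r0 < r \<Longrightarrow> r < 1 \<Longrightarrow> pdist (of_real r * \<zeta>) (g (of_real r * \<zeta>)) \<le> \<rho>"
  obtains v where "has_radial_limit (\<lambda>z. Fin (\<phi> z)) \<zeta> v" "v \<notin> Fin ` U"
    "\<And>a. v = Fin a \<Longrightarrow> a \<in> closure U \<and> a \<notin> fatou_set f \<and> f a = Fin a"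
proof -
  define q where "q = (\<lambda>r::real. \<phi> (of_real r * \<zeta>))"
  have cl: "a \<notin> U" "a \<in> closure U" "f a = Fin a"
    if "filterlim x (at_left 1) sequentially" "(\<lambda>n. q (x n)) \<longlonglongrightarrow> a" for x a
    using radial_cluster_point[OF mero rm g \<zeta> \<rho> r0 pd that(1), of a] that(2) by (auto simp: q_def)
  have qcont: "continuous_on {r0<..<1} q"
    unfolding q_def
  proof (rule continuous_on_compose2[of "ball 0 1" \<phi>])
    show "continuous_on (ball 0 1) \<phi>" using rm holomorphic_on_imp_continuous_on by (auto simp: riemann_map_def)
    show "(\<lambda>r. of_real r * \<zeta>) ` {r0<..<1} \<subseteq> ball 0 1" using r0 \<zeta> by (auto simp: norm_mult)
  qed (intro continuous_intros)
  show ?thesis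
  proof (cases "filterlim q at_infinity (at_left 1)")
    case True
    then show ?thesis
      using that[of Infty] by (auto simp: has_radial_limit_def tendsto_Infty_iff q_def)
  next
    case False
    then obtain M where M: "\<not> eventually (\<lambda>r. M \<le> cmod (q r)) (at_left 1)"
      unfolding filterlim_at_infinity[OF order_refl] by blast
    then have "frequently (\<lambda>r. \<not> M \<le> cmod (q r)) (at_left 1)" by (simp add: frequently_def)
    then have "frequently (\<lambda>r. q r \<in> cball 0 M) (at_left 1)" by (rule frequently_elim1) simp
    then obtain x a where x: "filterlim x (at_left 1) sequentially" "(\<lambda>n. q (x n)) \<longlonglongrightarrow> a"
      using frequently_at_left_sequence[OF compact_cball] by metis
    note a = cl[OF x]
    have nf: "a \<notin> fatou_set f"
      by (rule component_boundary_not_in_fatou_set[OF comp a(2,1)])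
    obtain R where R: "R > 0" "\<And>w. w \<in> ball a R \<Longrightarrow> w \<noteq> a \<Longrightarrow> f w \<noteq> Fin w"
      using boundary_fixed_point_isolated[OF mero a(3) nf] by blast
    have "(q \<longlongrightarrow> a) (at_left 1)"
    proof (rule ccontr)
      assume "\<not> (q \<longlongrightarrow> a) (at_left 1)"
      then obtain e0 where e0: "e0 > 0" "\<not> eventually (\<lambda>r. dist (q r) a < e0) (at_left 1)"
        unfolding tendsto_iff by blast
      define e where "e = min e0 (R / 2)"
      have e: "e > 0" "e < R" using e0 R by (auto simp: e_def)
      \<comment> \<open>The radius comes closer than \<open>e\<close> to \<open>a\<close>
        arbitrarily late and is also at distance at least \<open>e0 \<ge> e\<close> arbitrarily
        late, so it keeps meeting the sphere in between. A cluster point there would be a second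
        fixed point within \<open>R\<close> of \<open>a\<close>.\<close>
      have "\<not> eventually (\<lambda>r. q r \<notin> sphere a e) (at_left 1)"
      proof
        assume "eventually (\<lambda>r. q r \<notin> sphere a e) (at_left 1)"
        then obtain b where b: "b < 1" "\<And>r. b < r \<Longrightarrow> r < 1 \<Longrightarrow> q r \<notin> sphere a e"
          unfolding eventually_at_left_field by blast
        define b' where "b' = max b r0"
        have b': "b' < 1" using b r0 by (simp add: b'_def)
        have "eventually (\<lambda>n. x n \<in> {b'<..<1}) sequentially"
          by (rule eventually_compose_filterlim[OF eventually_at_left_real[OF b'] x(1)])
        moreover have "eventually (\<lambda>n. dist (q (x n)) a < e) sequentially" by (rule tendstoD[OF x(2) e(1)])
        ultimately have "eventually (\<lambda>n. x n \<in> {b'<..<1} \<and> dist (q (x n)) a < e) sequentially"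
          by (rule eventually_conj)
        then obtain n where n: "x n \<in> {b'<..<1}" "dist (q (x n)) a < e"
          using eventually_happens'[OF sequentially_bot] by blast
        have "\<exists>r2. r2 \<in> {b'<..<1} \<and> e0 \<le> dist (q r2) a"
        proof (rule ccontr)
          assume "\<not> ?thesis"
          then have "eventually (\<lambda>r. dist (q r) a < e0) (at_left 1)"
            using eventually_at_left_real[OF b'] by (elim eventually_mono) force
          then show False using e0(2) by simp
        qed
        then obtain r2 where r2: "r2 \<in> {b'<..<1}" "e0 \<le> dist (q r2) a" by blast
        have "connected ((\<lambda>r. dist (q r) a) ` {b'<..<1})"
        proof (rule connected_continuous_image)
          show "continuous_on {b'<..<1} (\<lambda>r. dist (q r) a)"
            by (intro continuous_intros continuous_on_subset[OF qcont]) (auto simp: b'_def)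
        qed simp
        moreover have "e \<in> {dist (q (x n)) a..dist (q r2) a}" using n r2 by (simp add: e_def)
        ultimately have "e \<in> (\<lambda>r. dist (q r) a) ` {b'<..<1}"
          by (intro connectedD_interval[OF _ imageI[OF n(1)] imageI[OF r2(1)]]) auto
        then obtain r where "r \<in> {b'<..<1}" "dist (q r) a = e" by auto
        then show False using b(2)[of r] by (simp add: b'_def dist_commute)
      qed
      then have "frequently (\<lambda>r. q r \<in> sphere a e) (at_left 1)" by (simp add: frequently_def)
      then obtain y w where y: "filterlim y (at_left 1) sequentially" "(\<lambda>n. q (y n)) \<longlonglongrightarrow> w" "w \<in> sphere a e"
        using frequently_at_left_sequence[OF compact_sphere] by metis
      then show False using cl(3)[OF y(1,2)] R(2)[of w] e by auto
    qed
    then show ?thesis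
      using that[of "Fin a"] a nf by (auto simp: has_radial_limit_def tendsto_Fin_iff q_def)
  qed
qed

section \<open>The multiplier of the radial limit\<close>

text \<open>The difference \<open>k\<close> is a continuous logarithm of \<open>\<mu>\<close>. Two
  such logarithms agree or are at least 2 pi apart, so \<open>k\<close> is constant on a connected
  set. The hypothesis \<open>near\<close> keeps the argument of \<open>Ln\<close> in the right
  half-plane.\<close>

lemma log_branch_on_connected:
  assumes S: "connected S" "S \<noteq> {}" and M: "continuous_on S M" and \<mu>: "\<mu> \<noteq> 0"
    and near: "\<And>z. z \<in> S \<Longrightarrow> cmod (exp (M z) / \<mu> - 1) < 1"
  obtains c :: complex where "exp c = \<mu>" "\<And>z. z \<in> S \<Longrightarrow> M z = c + Ln (exp (M z) / \<mu>)"
proof -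
  define k where "k = (\<lambda>z. M z - Ln (exp (M z) / \<mu>))"
  have "continuous_on S k"
    unfolding k_def
  proof (intro continuous_intros M \<mu> ballI)
    fix z assume "z \<in> S"
    have "Re (exp (M z) / \<mu>) > 0"
      using near[OF \<open>z \<in> S\<close>] abs_Re_le_cmod[of "exp (M z) / \<mu> - 1"] by (simp add: abs_less_iff)
    then show "exp (M z) / \<mu> \<notin> \<real>\<^sub>\<le>\<^sub>0" by (auto simp: complex_nonpos_Reals_iff)
  qed
  have ek: "exp (k z) = \<mu>" for z
    using \<mu> by (simp add: k_def exp_diff)
  have "k constant_on S"
  proof (rule continuous_discrete_range_constant[OF S(1) \<open>continuous_on S k\<close>])
    fix x assume "x \<in> S"
    have "2 * pi \<le> cmod (k y - k x)" if ne: "k y \<noteq> k x" for y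
    proof -
      obtain n :: int where n: "k y = k x + (of_int (2 * n) * pi) * \<i>"
        using ek[of x] ek[of y] exp_eq by metis
      then have "n \<noteq> 0" using ne by auto
      then have "1 \<le> \<bar>real_of_int n\<bar>" by linarith
      then have "2 * pi * 1 \<le> 2 * pi * \<bar>real_of_int n\<bar>" by (intro mult_left_mono) auto
      also have "\<dots> = cmod (k y - k x)" unfolding n by (simp add: norm_mult abs_mult)
      finally show ?thesis by simp
    qed
    then show "\<exists>e>0. \<forall>y. y \<in> S \<and> k y \<noteq> k x \<longrightarrow> e \<le> cmod (k y - k x)"
      by (intro exI[of _ "2 * pi"]) auto
  qed
  then obtain c where c: "\<And>z. z \<in> S \<Longrightarrow> k z = c" by (auto simp: constant_on_def)
  show ?thesis
  proof (rule that[of c])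
    from S(2) obtain z where "z \<in> S" by blast
    then show "exp c = \<mu>" using c[of z] ek[of z] by simp
    show "M z = c + Ln (exp (M z) / \<mu>)" if "z \<in> S" for z using c[OF that] by (simp add: k_def algebra_simps)
  qed
qed

text \<open>A union of pseudo-hyperbolic discs along a curve is a continuous image of the product of
  an interval and a disc. In its application it contains the curve and its image under
  \<open>g\<close>, so that one branch of the logarithm serves for both.\<close>

lemma connected_pdist_tube:
  fixes x :: "real \<Rightarrow> complex"
  assumes x: "continuous_on {r<..<1} x" "\<And>t. t \<in> {r<..<1} \<Longrightarrow> cmod (x t) < 1" and \<rho>: "\<rho> < 1"
  shows "connected {z. cmod z < 1 \<and> (\<exists>t\<in>{r<..<1}. pdist (x t) z \<le> \<rho>)}" (is "connected ?S")
proof -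
  define m where "m = (\<lambda>p. Moebius_function 0 (- x (fst p)) (snd p))"
  have in1: "cmod \<xi> < 1" if "\<xi> \<in> cball 0 \<rho>" for \<xi> :: complex using that \<rho> by auto
  have "?S = m ` ({r<..<1} \<times> cball 0 \<rho>)"
  proof (intro equalityI subsetI)
    fix z assume "z \<in> ?S"
    then obtain t where t: "cmod z < 1" "t \<in> {r<..<1}" "pdist (x t) z \<le> \<rho>" by blast
    then have "z = m (t, Moebius_function 0 (x t) z)" using Moebius_inverse x(2) by (simp add: m_def)
    then show "z \<in> m ` ({r<..<1} \<times> cball 0 \<rho>)" using t by (intro image_eqI) (auto simp: pdist_def)
  next
    fix z assume "z \<in> m ` ({r<..<1} \<times> cball 0 \<rho>)"
    then obtain t \<xi> where t: "t \<in> {r<..<1}" "\<xi> \<in> cball 0 \<rho>" "z = Moebius_function 0 (- x t) \<xi>"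
      by (auto simp: m_def)
    have "cmod z < 1" unfolding t(3) using x(2)[OF t(1)] in1[OF t(2)] by (intro Moebius_function_norm_lt_1) auto
    moreover have "Moebius_function 0 (x t) z = \<xi>"
      unfolding t(3) using x(2)[OF t(1)] in1[OF t(2)] by (intro Moebius_function_compose) auto
    ultimately show "z \<in> ?S" using t(1,2) by (auto simp: pdist_def intro!: bexI[of _ t])
  qed
  moreover have "connected (m ` ({r<..<1} \<times> cball 0 \<rho>))"
  proof (rule connected_continuous_image)
    have nz: "1 - cnj (- x (fst p)) * snd p \<noteq> 0" if "p \<in> {r<..<1} \<times> cball 0 \<rho>" for p
      using that x(2)[of "fst p"] in1[of "snd p"] by (intro one_minus_cnj_mult_neq_0) auto
    have "continuous_on ({r<..<1} \<times> cball 0 \<rho>) (\<lambda>p. x (fst p))"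
      by (rule continuous_on_compose2[OF x(1)]) (auto intro: continuous_intros)
    then show "continuous_on ({r<..<1} \<times> cball 0 \<rho>) m"
      unfolding m_def Moebius_function_simple using nz by (intro continuous_intros) auto
    show "connected ({r<..<1} \<times> (cball 0 \<rho> :: complex set))"
      by (intro connected_Times convex_connected convex_cball convex_real_interval)
  qed
  ultimately show ?thesis by simp
qed

text \<open>The exponential of the increment \<open>M\<close> is the difference quotient of
  \<open>F\<close> at \<open>a\<close>, taken at \<open>\<phi> z\<close>, so it tends to
  \<open>\<mu>\<close>. The point is that the same logarithm \<open>c\<close> occurs along
  \<open>x\<close> and along its image, which lets an induction over the orbit keep \<open>c\<close>
  fixed.\<close>

lemma log_increment_tendsto:
  fixes r :: real and x :: "real \<Rightarrow> complex"
  assumes rm: "riemann_map \<phi> U" and a: "a \<notin> U"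
    and g: "g holomorphic_on ball 0 1" "\<And>z. cmod z < 1 \<Longrightarrow> cmod (g z) < 1"
    and F: "(F has_field_derivative \<mu>) (at a)" "F a = a" "\<mu> \<noteq> 0"
    and semi: "\<And>z. cmod z < 1 \<Longrightarrow> F (\<phi> z) = \<phi> (g z)"
    and L: "L holomorphic_on ball 0 1" "\<And>z. cmod z < 1 \<Longrightarrow> \<phi> z - a = exp (L z)"
    and \<rho>: "0 < \<rho>" "\<rho> < 1" and r: "r < 1"
    and x: "continuous_on {r<..<1} x" "\<And>t. t \<in> {r<..<1} \<Longrightarrow> cmod (x t) < 1"
      "\<And>t. t \<in> {r<..<1} \<Longrightarrow> pdist (x t) (g (x t)) \<le> \<rho>"
    and lim: "((\<lambda>t. \<phi> (x t)) \<longlongrightarrow> a) (at_left 1)"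
  obtains c where "exp c = \<mu>" "((\<lambda>t. L (g (x t)) - L (x t)) \<longlongrightarrow> c) (at_left 1)"
    "((\<lambda>t. L (g (g (x t))) - L (g (x t))) \<longlongrightarrow> c) (at_left 1)"
proof -
  define M where "M = (\<lambda>z. L (g z) - L z)"
  have hol: "\<phi> holomorphic_on ball 0 1" using rm by (simp add: riemann_map_def)
  have ne: "\<phi> z \<noteq> a" if "cmod z < 1" for z using riemann_map_image[OF rm] a that by auto
  have expM: "exp (M z) / \<mu> = (F (\<phi> z) - a) / (\<phi> z - a) / \<mu>" if "cmod z < 1" for z
    using L(2)[OF that] L(2)[OF g(2)[OF that]] semi[OF that] by (simp add: M_def exp_diff)
  have quot: "((\<lambda>w. (F w - a) / (w - a) / \<mu>) \<longlongrightarrow> \<mu> / \<mu>) (at a)"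
    using F(1) by (intro tendsto_divide tendsto_const) (simp_all add: has_field_derivative_iff F)
  have ratio: "((\<lambda>t. Ln (exp (M (y t)) / \<mu>)) \<longlongrightarrow> 0) (at_left 1)"
    if y: "eventually (\<lambda>t. cmod (y t) < 1) (at_left 1)" "((\<lambda>t. \<phi> (y t)) \<longlongrightarrow> a) (at_left 1)" for y :: "real \<Rightarrow> complex"
  proof -
    have "filterlim (\<lambda>t. \<phi> (y t)) (at a) (at_left 1)"
      using y by (intro filterlim_atI) (auto elim: eventually_mono dest: ne)
    from filterlim_compose[OF quot this]
    have "((\<lambda>t. (F (\<phi> (y t)) - a) / (\<phi> (y t) - a) / \<mu>) \<longlongrightarrow> 1) (at_left 1)" using F(3) by simp
    then have "((\<lambda>t. exp (M (y t)) / \<mu>) \<longlongrightarrow> 1) (at_left 1)"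
      by (rule Lim_transform_eventually) (use y(1) in \<open>rule eventually_mono, simp add: expM\<close>)
    from tendsto_Ln[OF this] show ?thesis by simp
  qed
  obtain \<eta> where \<eta>: "\<eta> > 0" "\<And>w. w \<noteq> a \<Longrightarrow> dist w a < \<eta> \<Longrightarrow> cmod ((F w - a) / (w - a) / \<mu> - 1) < 1"
    using tendstoD[OF quot, of 1] F(3) unfolding eventually_at by (auto simp: dist_norm)
  obtain K where K: "K \<ge> 1" "\<And>h w z. h holomorphic_on ball 0 1 \<Longrightarrow> inj_on h (ball 0 1) \<Longrightarrow>
     (\<And>z. z \<in> ball 0 1 \<Longrightarrow> h z \<noteq> 0) \<Longrightarrow> cmod w < 1 \<Longrightarrow> cmod z < 1 \<Longrightarrow> pdist w z \<le> \<rho> \<Longrightarrow>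
     cmod (h z) \<le> K * cmod (h w)"
    using univalent_nonvanishing_distortion[OF \<rho>] by metis
  have dist: "cmod (\<phi> z - a) \<le> K * cmod (\<phi> w - a)" if "cmod w < 1" "cmod z < 1" "pdist w z \<le> \<rho>" for w z
  proof (rule K(2)[of "\<lambda>z. \<phi> z - a"])
    show "(\<lambda>z. \<phi> z - a) holomorphic_on ball 0 1" by (intro holomorphic_intros hol)
    show "inj_on (\<lambda>z. \<phi> z - a) (ball 0 1)" using riemann_map_inj[OF rm] by (auto simp: inj_on_def)
  qed (use that ne in auto)
  have "((\<lambda>t. K * cmod (\<phi> (x t) - a)) \<longlongrightarrow> 0) (at_left 1)"
    by (intro tendsto_mult_right_zero tendsto_norm_zero Lim_null[THEN iffD1, OF lim])
  \<comment> \<open>Distortion spreads closeness to \<open>a\<close> from the curve to the tube: for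
    parameters beyond \<open>b\<close>, every tube point is sent by \<open>\<phi>\<close> to within
    \<open>\<eta>\<close> of \<open>a\<close>.\<close>
  from order_tendstoD(2)[OF this \<eta>(1)] obtain b where b: "b < 1" "\<And>t. b < t \<Longrightarrow> t < 1 \<Longrightarrow> K * cmod (\<phi> (x t) - a) < \<eta>"
    unfolding eventually_at_left_field by blast
  define s where "s = max r b"
  have s: "s < 1" "r \<le> s" "b \<le> s" using r b by (auto simp: s_def)
  define S where "S = {z. cmod z < 1 \<and> (\<exists>t\<in>{s<..<1}. pdist (x t) z \<le> \<rho>)}"
  have xS: "x t \<in> S" "g (x t) \<in> S" if "t \<in> {s<..<1}" for t
  proof -
    have t: "t \<in> {r<..<1}" using that s by auto
    show "x t \<in> S" "g (x t) \<in> S"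
      using that x(2,3)[OF t] g(2) \<rho> by (auto simp: S_def pdist_def Moebius_function_eq_zero intro!: bexI[of _ t])
  qed
  have "connected S"
    unfolding S_def
    by (rule connected_pdist_tube[OF continuous_on_subset[OF x(1)] x(2) \<rho>(2)]) (use s in auto)
  moreover have "S \<noteq> {}" using xS(1)[of "(s + 1) / 2"] s by auto
  moreover have "continuous_on S M"
  proof -
    have "continuous_on (ball 0 1) L" using L(1) by (rule holomorphic_on_imp_continuous_on)
    moreover from this have "continuous_on (ball 0 1) (\<lambda>z. L (g z))"
      by (rule continuous_on_compose2) (use g holomorphic_on_imp_continuous_on in auto)
    ultimately have "continuous_on (ball 0 1) M" unfolding M_def by (intro continuous_intros)
    then show ?thesis by (rule continuous_on_subset) (auto simp: S_def)
  qed
  moreover have "cmod (exp (M z) / \<mu> - 1) < 1" if zS: "z \<in> S" for z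
  proof -
    obtain t where t: "cmod z < 1" "t \<in> {s<..<1}" "pdist (x t) z \<le> \<rho>" using zS by (auto simp: S_def)
    have "cmod (\<phi> z - a) \<le> K * cmod (\<phi> (x t) - a)" using t s x(2)[of t] by (intro dist) auto
    also have "\<dots> < \<eta>" using b(2)[of t] t s by auto
    finally show ?thesis using \<eta>(2)[of "\<phi> z"] ne[OF t(1)] expM[OF t(1)] by (simp add: dist_norm)
  qed
  ultimately obtain c where c: "exp c = \<mu>" "\<And>z. z \<in> S \<Longrightarrow> M z = c + Ln (exp (M z) / \<mu>)"
    using log_branch_on_connected[of S M \<mu>] F(3) by metis
  have Mlim: "((\<lambda>t. M (y t)) \<longlongrightarrow> c) (at_left 1)"
    if y: "\<And>t. t \<in> {s<..<1} \<Longrightarrow> y t \<in> S" "((\<lambda>t. \<phi> (y t)) \<longlongrightarrow> a) (at_left 1)" for y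
  proof -
    have ev: "eventually (\<lambda>t. y t \<in> S) (at_left 1)"
      using eventually_at_left_real[OF s(1)] by (rule eventually_mono) (rule y(1))
    then have "eventually (\<lambda>t. cmod (y t) < 1) (at_left 1)" by (rule eventually_mono) (simp add: S_def)
    from tendsto_add[OF tendsto_const ratio[OF this y(2)], of c]
    have "((\<lambda>t. c + Ln (exp (M (y t)) / \<mu>)) \<longlongrightarrow> c) (at_left 1)" by simp
    then show ?thesis
      by (rule Lim_transform_eventually) (use ev in \<open>rule eventually_mono, simp flip: c(2)\<close>)
  qed
  have "isCont F a" using F(1) by (rule DERIV_isCont)
  from isCont_tendsto_compose[OF this lim] have "((\<lambda>t. F (\<phi> (x t))) \<longlongrightarrow> a) (at_left 1)" using F(2) by simp
  then have "((\<lambda>t. \<phi> (g (x t))) \<longlongrightarrow> a) (at_left 1)"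
    by (rule Lim_transform_eventually)
      (use eventually_at_left_real[OF r] in \<open>rule eventually_mono, simp add: semi x(2)\<close>)
  then show ?thesis
    using that[OF c(1)] Mlim[of x] Mlim[of "\<lambda>t. g (x t)"] xS lim unfolding M_def by blast
qed

text \<open>Along the orbit of the radius the logarithm \<open>L\<close> of \<open>\<phi> - a\<close> moves by almost \<open>c\<close> in each
  step, where \<open>c\<close> is purely imaginary. After suitably many steps the translate of the orbit by a
  multiple of \<open>2 pi i\<close> is close to the starting point, hence in the image of \<open>L\<close> by the distortion
  estimate, contradicting the injectivity of \<open>exp\<close> on that image.\<close>

lemma neutral_multiplier_eq_1:
  assumes rm: "riemann_map \<phi> U" and a: "a \<notin> U"
    and g: "g holomorphic_on ball 0 1" "\<And>z. cmod z < 1 \<Longrightarrow> cmod (g z) < 1"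
    and F: "(F has_field_derivative \<mu>) (at a)" "F a = a" "cmod \<mu> = 1"
    and semi: "\<And>z. cmod z < 1 \<Longrightarrow> F (\<phi> z) = \<phi> (g z)"
    and \<rho>: "0 < \<rho>" "\<rho> < 1" and r: "0 \<le> r" "r < 1" and \<zeta>: "cmod \<zeta> = 1"
    and pd: "\<And>t::real. r < t \<Longrightarrow> t < 1 \<Longrightarrow> pdist (of_real t * \<zeta>) (g (of_real t * \<zeta>)) \<le> \<rho>"
    and lim: "((\<lambda>t::real. \<phi> (of_real t * \<zeta>)) \<longlongrightarrow> a) (at_left 1)"
  shows "\<mu> = 1"
proof (rule ccontr)
  assume "\<mu> \<noteq> 1"
  have "\<mu> \<noteq> 0" using F(3) by auto
  have hol: "\<phi> holomorphic_on ball 0 1" using rm by (simp add: riemann_map_def)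
  have ne: "\<phi> z - a \<noteq> 0" if "z \<in> ball 0 1" for z using riemann_map_image[OF rm] a that by auto
  have hol': "(\<lambda>z. \<phi> z - a) holomorphic_on ball 0 1" by (intro holomorphic_intros hol)
  obtain L where L: "L holomorphic_on ball 0 1" "\<And>z. z \<in> ball 0 1 \<Longrightarrow> \<phi> z - a = exp (L z)"
    using contractible_imp_holomorphic_log[OF hol' convex_imp_contractible[OF convex_ball] ne] by metis
  have L2: "\<phi> z - a = exp (L z)" if "cmod z < 1" for z using L(2) that by simp
  define M where "M = (\<lambda>z. L (g z) - L z)"
  define x where "x = (\<lambda>j (t::real). (g ^^ j) (of_real t * \<zeta>))"
  have step: "\<exists>c. exp c = \<mu> \<and> ((\<lambda>t. M (y t)) \<longlongrightarrow> c) (at_left 1) \<and> ((\<lambda>t. M (g (y t))) \<longlongrightarrow> c) (at_left 1)"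
    if y: "continuous_on {r<..<1} y" "\<And>t. t \<in> {r<..<1} \<Longrightarrow> cmod (y t) < 1"
      "\<And>t. t \<in> {r<..<1} \<Longrightarrow> pdist (y t) (g (y t)) \<le> \<rho>" "((\<lambda>t. \<phi> (y t)) \<longlongrightarrow> a) (at_left 1)" for y
  proof (rule log_increment_tendsto[of \<phi> U a g F \<mu> L \<rho> r y])
    fix c assume "exp c = \<mu>" "((\<lambda>t. L (g (y t)) - L (y t)) \<longlongrightarrow> c) (at_left 1)"
      "((\<lambda>t. L (g (g (y t))) - L (g (y t))) \<longlongrightarrow> c) (at_left 1)"
    then show ?thesis unfolding M_def by (intro exI[of _ c] conjI)
  qed (fact rm a g F(1,2) \<open>\<mu> \<noteq> 0\<close> semi L(1) L2 \<rho> r(2) y)+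
  have base: "continuous_on {r<..<1} (x 0)" "\<And>t. t \<in> {r<..<1} \<Longrightarrow> cmod (x 0 t) < 1"
    "\<And>t. t \<in> {r<..<1} \<Longrightarrow> pdist (x 0 t) (g (x 0 t)) \<le> \<rho>" "((\<lambda>t. \<phi> (x 0 t)) \<longlongrightarrow> a) (at_left 1)"
    using pd lim \<zeta> r by (auto simp: x_def norm_mult intro!: continuous_intros)
  obtain c where c: "exp c = \<mu>" "((\<lambda>t. M (x 0 t)) \<longlongrightarrow> c) (at_left 1)"
    using step[of "x 0"] base by blast
  have orbit: "continuous_on {r<..<1} (x j) \<and> (\<forall>t\<in>{r<..<1}. cmod (x j t) < 1) \<and>
      (\<forall>t\<in>{r<..<1}. pdist (x j t) (g (x j t)) \<le> \<rho>) \<and> ((\<lambda>t. \<phi> (x j t)) \<longlongrightarrow> a) (at_left 1) \<and>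
      ((\<lambda>t. M (x j t)) \<longlongrightarrow> c) (at_left 1)" for j
  proof (induction j)
    case 0
    then show ?case using base c(2) by auto
  next
    case (Suc j)
    then have j: "continuous_on {r<..<1} (x j)" "\<And>t. t \<in> {r<..<1} \<Longrightarrow> cmod (x j t) < 1"
      "\<And>t. t \<in> {r<..<1} \<Longrightarrow> pdist (x j t) (g (x j t)) \<le> \<rho>" "((\<lambda>t. \<phi> (x j t)) \<longlongrightarrow> a) (at_left 1)"
      "((\<lambda>t. M (x j t)) \<longlongrightarrow> c) (at_left 1)" by auto
    have xS: "x (Suc j) t = g (x j t)" for t by (simp add: x_def)
    obtain c' where c': "((\<lambda>t. M (x j t)) \<longlongrightarrow> c') (at_left 1)" "((\<lambda>t. M (g (x j t))) \<longlongrightarrow> c') (at_left 1)"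
      using step[of "x j"] j(1-4) by blast
    \<comment> \<open>The limit along \<open>x j\<close> is already known to be \<open>c\<close>,
      and \<open>c'\<close> is shared by \<open>x j\<close> and \<open>x (Suc j)\<close>.\<close>
    have "c' = c" using tendsto_unique[OF trivial_limit_at_left_real c'(1) j(5)] .
    then have "((\<lambda>t. M (x (Suc j) t)) \<longlongrightarrow> c) (at_left 1)" using c'(2) by (simp add: xS)
    moreover have "continuous_on {r<..<1} (x (Suc j))"
      unfolding xS by (rule continuous_on_compose2[OF holomorphic_on_imp_continuous_on[OF g(1)] j(1)]) (use j(2) in auto)
    moreover have "cmod (x (Suc j) t) < 1" if "t \<in> {r<..<1}" for t using g(2) j(2)[OF that] by (simp add: xS)
    moreover have "pdist (x (Suc j) t) (g (x (Suc j) t)) \<le> \<rho>" if "t \<in> {r<..<1}" for t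
      using Schwarz_Pick[OF g j(2)[OF that] g(2)[OF j(2)[OF that]]] j(3)[OF that] by (simp add: xS)
    moreover have "((\<lambda>t. \<phi> (x (Suc j) t)) \<longlongrightarrow> a) (at_left 1)"
    proof -
      have "isCont F a" using F(1) by (rule DERIV_isCont)
      from isCont_tendsto_compose[OF this j(4)] have "((\<lambda>t. F (\<phi> (x j t))) \<longlongrightarrow> a) (at_left 1)" using F(2) by simp
      then show ?thesis
        by (rule Lim_transform_eventually)
          (use eventually_at_left_real[OF r(2)] in \<open>rule eventually_mono, simp add: semi j(2) xS\<close>)
    qed
    ultimately show ?case by blast
  qed
  define \<theta> where "\<theta> = Im c"
  have "exp (Re c) = 1" using c(1) F(3) by (metis norm_exp_eq_Re)
  then have c_eq: "c = \<i> * of_real \<theta>" by (simp add: complex_eq_iff \<theta>_def)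
  have "c \<noteq> 0" using c(1) \<open>\<mu> \<noteq> 1\<close> by auto
  have c_norm: "cmod c = \<bar>\<theta>\<bar>" unfolding c_eq by (simp add: norm_mult)
  obtain K where K: "K \<ge> 1" "\<And>h w z. h holomorphic_on ball 0 1 \<Longrightarrow> inj_on h (ball 0 1) \<Longrightarrow>
     (\<And>z. z \<in> ball 0 1 \<Longrightarrow> h z \<noteq> 0) \<Longrightarrow> cmod w < 1 \<Longrightarrow> cmod z < 1 \<Longrightarrow> pdist w z \<le> \<rho> \<Longrightarrow>
     cmod (h z) \<le> K * cmod (h w)"
    using univalent_nonvanishing_distortion[OF \<rho>] by metis
  have L_inj: "z = w" if "cmod z < 1" "cmod w < 1" "exp (L z) = exp (L w)" for z w
  proof -
    have "\<phi> z - a = \<phi> w - a" using L2[OF that(1)] L2[OF that(2)] that(3) by simp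
    then show ?thesis using inj_onD[OF riemann_map_inj[OF rm], of z w] that by simp
  qed
  \<comment> \<open>If \<open>L\<close> omits \<open>u\<close>, distortion for \<open>L - u\<close>
    bounds the increment \<open>M\<close> by \<open>K + 1\<close> times the distance from
    \<open>L (x 0 t)\<close> to \<open>u\<close>. Near the end of the radius the increment exceeds
    |c|/2, so \<open>L\<close> takes all values within \<open>\<kappa>\<close> of
    \<open>L (x 0 t)\<close>.\<close>
  define \<kappa> where "\<kappa> = cmod c / (2 * (K + 1))"
  have "\<kappa> > 0" using K(1) \<open>c \<noteq> 0\<close> by (simp add: \<kappa>_def)
  have \<kappa>_le: "\<kappa> \<le> \<bar>\<theta>\<bar>"
  proof -
    have "\<bar>\<theta>\<bar> * 1 \<le> \<bar>\<theta>\<bar> * (2 * (K + 1))" using K(1) by (intro mult_left_mono) auto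
    then show ?thesis using K(1) by (simp add: \<kappa>_def c_norm divide_le_eq)
  qed
  have omit: "\<kappa> \<le> cmod (L (x 0 t) - u)"
    if t: "t \<in> {r<..<1}" "cmod c / 2 < cmod (M (x 0 t))" and u: "u \<notin> L ` ball 0 1" for t u
  proof -
    have "cmod (L (g (x 0 t)) - u) \<le> K * cmod (L (x 0 t) - u)"
    proof (rule K(2)[of "\<lambda>z. L z - u"])
      show "(\<lambda>z. L z - u) holomorphic_on ball 0 1" by (intro holomorphic_intros L(1))
      show "inj_on (\<lambda>z. L z - u) (ball 0 1)" using L_inj by (auto simp: inj_on_def)
    qed (use u base t(1) g(2) in auto)
    moreover have "cmod (M (x 0 t)) \<le> cmod (L (g (x 0 t)) - u) + cmod (L (x 0 t) - u)"
      using norm_triangle_ineq4[of "L (g (x 0 t)) - u" "L (x 0 t) - u"] by (simp add: M_def)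
    ultimately have "cmod c / 2 \<le> (K + 1) * cmod (L (x 0 t) - u)" using t(2) by (simp add: algebra_simps)
    then show ?thesis using K(1) by (simp add: \<kappa>_def pos_divide_le_eq algebra_simps)
  qed
  \<comment> \<open>Dirichlet's theorem finds \<open>p\<close> steps whose total rotation
    \<open>p * \<theta>\<close> is within 2 pi / N < \<kappa>/2 of a multiple of 2 pi; the other
    half of \<open>\<kappa>\<close> absorbs the error of the increments.\<close>
  obtain N :: nat where N: "4 * pi / \<kappa> < real N" using reals_Archimedean2 by blast
  have "4 * pi / \<kappa> > 0" using \<open>\<kappa> > 0\<close> by simp
  then have "N > 0" using N by (cases N) auto
  have N2: "2 * pi * (1 / real N) < \<kappa> / 2" using N \<open>N > 0\<close> \<open>\<kappa> > 0\<close> by (simp add: field_simps)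
  obtain h k :: int where hk: "0 < k" "\<bar>of_int k * (\<theta> / (2 * pi)) - of_int h\<bar> < 1 / real N"
    using Dirichlet_approx[OF \<open>N > 0\<close>, of "\<theta> / (2 * pi)"] by metis
  define p where "p = nat k"
  have p: "p \<ge> 1" "of_int k = real p" using hk(1) by (auto simp: p_def)
  have "\<bar>real p * \<theta> - 2 * pi * of_int h\<bar> = 2 * pi * \<bar>of_int k * (\<theta> / (2 * pi)) - of_int h\<bar>"
  proof -
    have "real p * \<theta> - 2 * pi * of_int h = 2 * pi * (of_int k * (\<theta> / (2 * pi)) - of_int h)"
      by (simp add: p right_diff_distrib)
    then show ?thesis by (simp only: abs_mult) simp
  qed
  also have "\<dots> < 2 * pi * (1 / real N)" using hk(2) by (intro mult_strict_left_mono) auto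
  also note N2
  finally have near: "\<bar>real p * \<theta> - 2 * pi * of_int h\<bar> < \<kappa> / 2" .
  have "((\<lambda>t. \<Sum>j<p. M (x j t)) \<longlongrightarrow> (\<Sum>j<p. c)) (at_left 1)" using orbit by (intro tendsto_sum) auto
  from tendstoD[OF this, of "\<kappa> / 2"] \<open>\<kappa> > 0\<close>
  have "eventually (\<lambda>t. dist (\<Sum>j<p. M (x j t)) (of_nat p * c) < \<kappa> / 2) (at_left 1)" by simp
  moreover have "eventually (\<lambda>t. cmod c / 2 < cmod (M (x 0 t))) (at_left 1)"
    using order_tendstoD(1)[OF tendsto_norm[OF c(2)], of "cmod c / 2"] \<open>c \<noteq> 0\<close> by simp
  moreover note eventually_at_left_real[OF r(2)]
  ultimately have "eventually (\<lambda>t. dist (\<Sum>j<p. M (x j t)) (of_nat p * c) < \<kappa> / 2 \<and>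
      cmod c / 2 < cmod (M (x 0 t)) \<and> t \<in> {r<..<1}) (at_left 1)"
    by eventually_elim auto
  then obtain t where t: "dist (\<Sum>j<p. M (x j t)) (of_nat p * c) < \<kappa> / 2"
      "cmod c / 2 < cmod (M (x 0 t))" "t \<in> {r<..<1}"
    using eventually_happens'[OF trivial_limit_at_left_real] by blast
  have "(\<Sum>j<p. M (x j t)) = (\<Sum>j<p. L (x (Suc j) t) - L (x j t))"
    by (simp add: M_def x_def)
  also have "\<dots> = L (x p t) - L (x 0 t)" by (rule sum_lessThan_telescope)
  finally have sum: "(\<Sum>j<p. M (x j t)) = L (x p t) - L (x 0 t)" .
  \<comment> \<open>Being within \<open>\<kappa>\<close> of \<open>L (x 0 t)\<close>,
    \<open>u\<close> is a value of \<open>L\<close>, and it has the same exponential as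
    \<open>L (x p t)\<close>. Injectivity forces \<open>h = 0\<close>; then p |\<theta>| would be
    below \<kappa>/2 although |\<theta>| \<ge> \<kappa>.\<close>
  define u where "u = L (x p t) - \<i> * of_real (2 * pi * of_int h)"
  have "L (x 0 t) - u = - (L (x p t) - L (x 0 t) - of_nat p * c) - (of_nat p * c - \<i> * of_real (2 * pi * of_int h))"
    by (simp add: u_def)
  then have "cmod (L (x 0 t) - u) \<le> cmod (L (x p t) - L (x 0 t) - of_nat p * c) + cmod (of_nat p * c - \<i> * of_real (2 * pi * of_int h))"
    by (metis norm_minus_cancel norm_triangle_ineq4)
  also have "cmod (L (x p t) - L (x 0 t) - of_nat p * c) < \<kappa> / 2" using t(1) by (simp add: sum dist_norm)
  also have "of_nat p * c - \<i> * of_real (2 * pi * of_int h) = \<i> * of_real (real p * \<theta> - 2 * pi * of_int h)"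
    by (simp add: c_eq algebra_simps)
  also have "cmod \<dots> < \<kappa> / 2" using near by (simp only: norm_mult norm_of_real) simp
  finally have "cmod (L (x 0 t) - u) < \<kappa>" by simp
  then have "u \<in> L ` ball 0 1" using omit[OF t(3,2)] by force
  then obtain w where w: "cmod w < 1" "u = L w" by auto
  have "exp (L (x p t)) = exp (L w)"
    unfolding w(2)[symmetric] u_def
    using exp_integer_2pi[of "of_int h"] by (simp add: exp_diff mult_ac)
  then have "x p t = w" using L_inj w(1) orbit[of p] t(3) by blast
  then have "h = 0" using w(2) by (simp add: u_def)
  then have "real p * \<bar>\<theta>\<bar> < \<kappa> / 2" using near by (simp add: abs_mult)
  moreover have "1 * \<bar>\<theta>\<bar> \<le> real p * \<bar>\<theta>\<bar>" using p(1) by (intro mult_right_mono) auto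
  ultimately show False using \<kappa>_le \<open>\<kappa> > 0\<close> by linarith
qed

section \<open>The radial access\<close>

text \<open>As in \<open>image_curve\<close>, the endpoint value is prescribed, so continuity at 1
  says that \<open>\<phi>\<close> has radial limit \<open>v\<close> at
  \<open>\<zeta>\<close>.\<close>

definition radial_access_curve :: "(complex \<Rightarrow> complex) \<Rightarrow> csphere \<Rightarrow> complex \<Rightarrow> real \<Rightarrow> csphere" where
  "radial_access_curve \<phi> v \<zeta> t = (if t < 1 then Fin (\<phi> (of_real t * \<zeta>)) else v)"

text \<open>The radius and its image under \<open>g\<close> approach \<open>\<zeta>\<close> inside a common Stolz region, so the straight
  line homotopy between them in the disc is carried by \<open>\<phi>\<close> to a homotopy of accesses.\<close>

lemma regular_radial_access_homotopic:
  assumes rm: "riemann_map \<phi> U" and v: "v \<notin> Fin ` U"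
    and g: "g holomorphic_on ball 0 1" "\<And>z. cmod z < 1 \<Longrightarrow> cmod (g z) < 1"
    and semi: "\<And>z. cmod z < 1 \<Longrightarrow> f (\<phi> z) = Fin (\<phi> (g z))"
    and reg: "regular_boundary_fixed_point g \<zeta>"
    and rad: "has_radial_limit (\<lambda>z. Fin (\<phi> z)) \<zeta> v"
  shows "access_homotopic U (\<phi> 0) v (radial_access_curve \<phi> v \<zeta>)
    ((\<lambda>t. Fin (\<phi> (linepath 0 (g 0) t))) +++ image_curve f v (radial_access_curve \<phi> v \<zeta>))"
proof -
  have \<zeta>: "cmod \<zeta> = 1" using reg by (simp add: regular_boundary_fixed_point_def boundary_fixed_point_def)
  have g0: "cmod (g 0) < 1" using g(2)[of 0] by simp
  \<comment> \<open>The joined curve before applying \<open>\<phi>\<close>: the segment from 0 to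
    \<open>g 0\<close>, then \<open>g\<close> on the radius at parameter \<open>2 * t - 1\<close>.
    \<open>Z\<close> interpolates linearly between the radius and this curve.\<close>
  define \<tau> where "\<tau> = (\<lambda>t::real. if t \<le> 1 / 2 then linepath 0 (g 0) (2 * t) else g (of_real (2 * t - 1) * \<zeta>))"
  define Z where "Z = (\<lambda>p::real \<times> real. of_real (1 - fst p) * (of_real (snd p) * \<zeta>) + of_real (fst p) * \<tau> (snd p))"
  define H where "H = (\<lambda>p. if snd p < 1 then Fin (\<phi> (Z p)) else v)"
  have \<tau>1: "cmod (\<tau> t) < 1" if "0 \<le> t" "t < 1" for t
  proof (cases "t \<le> 1 / 2")
    case True
    have "cmod (linepath 0 (g 0) (2 * t)) = 2 * t * cmod (g 0)" using that by (simp add: linepath_def)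
    also have "\<dots> \<le> 1 * cmod (g 0)" using True by (intro mult_right_mono) auto
    finally show ?thesis using g0 True by (simp add: \<tau>_def)
  next
    case False
    then show ?thesis using that \<zeta> by (simp add: \<tau>_def norm_mult g(2) del: of_real_diff of_real_mult)
  qed
  have Z_le: "cmod (Z (s, t)) \<le> (1 - s) * t + s * cmod (\<tau> t)" if "0 \<le> s" "s \<le> 1" "0 \<le> t" for s t
  proof -
    have "cmod (Z (s, t)) \<le> cmod (of_real (1 - s) * (of_real t * \<zeta>)) + cmod (of_real s * \<tau> t)"
      unfolding Z_def fst_conv snd_conv by (rule norm_triangle_ineq)
    also have "\<dots> = (1 - s) * t + s * cmod (\<tau> t)"
      using that \<zeta> by (simp only: norm_mult norm_of_real abs_of_nonneg diff_ge_0_iff_ge mult_1_right)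
    finally show ?thesis .
  qed
  have Z1: "cmod (Z (s, t)) < 1" if "0 \<le> s" "s \<le> 1" "0 \<le> t" "t < 1" for s t
  proof (rule le_less_trans[OF Z_le[OF that(1-3)]])
    show "(1 - s) * t + s * cmod (\<tau> t) < 1"
      using convex_bound_lt[of t 1 "cmod (\<tau> t)" "1 - s" s] \<tau>1[OF that(3,4)] that by simp
  qed
  have "continuous_on {0..<1} \<tau>"
  proof -
    have "{0..<1} = {0..1 / 2} \<union> {1 / 2..<1::real}" by auto
    moreover have "continuous_on ({0..1 / 2} \<union> {1 / 2..<1}) \<tau>"
      unfolding \<tau>_def
    proof (rule continuous_on_cases_local)
      show "closedin (top_of_set ({0..1 / 2} \<union> {1 / 2..<1})) {0..1 / 2::real}"
        by (intro closed_subset) auto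
      have "{1 / 2..<1::real} = ({0..1 / 2} \<union> {1 / 2..<1}) \<inter> {1 / 2..}" by auto
      then show "closedin (top_of_set ({0..1 / 2} \<union> {1 / 2..<1})) {1 / 2..<1::real}"
        by (metis closed_atLeast closedin_closed_Int)
      show "continuous_on {0..1 / 2} (\<lambda>t. linepath 0 (g 0) (2 * t))"
        unfolding linepath_def by (intro continuous_intros)
      show "continuous_on {1 / 2..<1} (\<lambda>t. g (of_real (2 * t - 1) * \<zeta>))"
        by (rule continuous_on_compose2[OF holomorphic_on_imp_continuous_on[OF g(1)]])
          (use \<zeta> in \<open>auto simp: norm_mult simp del: of_real_diff of_real_mult intro!: continuous_intros\<close>)
      fix t :: real assume "t \<in> {0..1 / 2} \<and> \<not> t \<le> 1 / 2 \<or> t \<in> {1 / 2..<1} \<and> t \<le> 1 / 2"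
      then have t: "t = 1 / 2" by auto
      show "linepath 0 (g 0) (2 * t) = g (of_real (2 * t - 1) * \<zeta>)" unfolding t by (simp add: linepath_def)
    qed
    ultimately show ?thesis by simp
  qed
  then have "continuous_on ({0..1} \<times> {0..<1}) (\<lambda>p. \<tau> (snd p))"
    by (rule continuous_on_compose2) (auto intro: continuous_intros)
  then have Z_cont: "continuous_on ({0..1} \<times> {0..<1}) Z" unfolding Z_def by (intro continuous_intros)
  have \<phi>_cont: "continuous_on (ball 0 1) (\<lambda>z. Fin (\<phi> z))"
    using rm holomorphic_on_imp_continuous_on[of \<phi> "ball 0 1"] unfolding riemann_map_def continuous_on_def
    by (auto intro!: tendsto_Fin)
  have "continuous_on ({0..1} \<times> {0..<1}) (\<lambda>p. Fin (\<phi> (Z p)))"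
    by (rule continuous_on_compose2[OF \<phi>_cont Z_cont]) (use Z1 in auto)
  then have H_cont': "continuous_on ({0..1} \<times> {0..<1}) H"
    by (rule continuous_on_eq) (auto simp: H_def)
  \<comment> \<open>The delicate place is the final parameter, where convergence must be uniform in
    \<open>s\<close>. The pseudo-hyperbolic bound makes all points \<open>Z (s, t)\<close> behave
    like the radial point with parameter \<open>t\<close>.\<close>
  have H_lim: "(H \<longlongrightarrow> v) (at (s0, 1) within {0..1} \<times> {0..<1})" for s0
  proof -
    let ?G = "at (s0, 1) within ({0..1} \<times> {0..<1}) :: (real \<times> real) filter"
    obtain c where c: "0 < c" "c \<le> 1" "\<And>z. cmod z < 1 \<Longrightarrow> c * (1 - cmod z) \<le> 1 - cmod (g z)"
      using disc_self_map_boundary_growth[OF g] by blast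
    obtain C r0 where C: "1 \<le> C" "0 \<le> r0" "r0 < 1"
      "\<And>r::real. r0 < r \<Longrightarrow> r < 1 \<Longrightarrow> cmod (g (of_real r * \<zeta>) - \<zeta>) \<le> C * (1 - r)"
      using regular_boundary_fixed_point_Lipschitz[OF reg] by blast
    \<comment> \<open>With \<open>u = 1 - t\<close> one has \<open>1 - (2 * t - 1) = 2 * u\<close>,
      so the Lipschitz bound contributes \<open>2 * C * u\<close>; one further \<open>u\<close>
      leads from \<open>\<zeta>\<close> to the radial point.\<close>
    have "0 < 2 * C + 1" using C by simp
    obtain \<rho> where \<rho>: "0 < \<rho>" "\<rho> < 1"
      "\<And>u w z. 0 < u \<Longrightarrow> c * u \<le> 1 - cmod w \<Longrightarrow> 1 - cmod w \<le> (2 * C + 1) * u \<Longrightarrow> c * u \<le> 1 - cmod z \<Longrightarrow>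
         cmod (z - w) \<le> (2 * C + 1) * u \<Longrightarrow> cmod w < 1 \<and> cmod z < 1 \<and> pdist w z \<le> \<rho>"
      using pdist_bound[OF c(1) \<open>0 < 2 * C + 1\<close>] by metis
    have ev_in: "eventually (\<lambda>p. p \<in> {0..1} \<times> {0..<1}) ?G"
      by (simp add: eventually_at_filter)
    have snd_lim: "filterlim snd (at_left 1) ?G"
    proof (rule filterlim_at_withinI)
      show "(snd \<longlongrightarrow> 1) ?G" using tendsto_snd[OF tendsto_ident_at, of "(s0, 1)"] by simp
      show "eventually (\<lambda>p. snd p \<in> {..<1} - {1}) ?G" using ev_in by (rule eventually_mono) auto
    qed
    \<comment> \<open>Beyond \<open>(1 + r0) / 2\<close> the parameter \<open>2 * t - 1\<close>
      exceeds \<open>r0\<close>, and \<open>t > 1 / 2\<close> selects the second branch of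
      \<open>\<tau>\<close>.\<close>
    have b: "(1 + r0) / 2 < 1" using C by simp
    have ev_b: "eventually (\<lambda>p. snd p \<in> {(1 + r0) / 2<..<1}) ?G"
      by (rule eventually_compose_filterlim[OF eventually_at_left_real[OF b] snd_lim])
    have pd: "cmod (of_real t * \<zeta>) < 1 \<and> cmod (Z (s, t)) < 1 \<and> pdist (of_real t * \<zeta>) (Z (s, t)) \<le> \<rho>"
      if s: "0 \<le> s" "s \<le> 1" and t: "(1 + r0) / 2 < t" "t < 1" for s t
    proof -
      define u where "u = 1 - t"
      have u: "u > 0" and t0: "t > 1 / 2" using t C by (auto simp: u_def)
      have nt: "cmod (of_real t * \<zeta>) = t" using t0 \<zeta> by (simp add: norm_mult)
      have \<tau>: "\<tau> t = g (of_real (2 * t - 1) * \<zeta>)" using t0 by (simp add: \<tau>_def)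
      have nt': "cmod (of_real (2 * t - 1) * \<zeta>) = 2 * t - 1"
        using t0 \<zeta> by (simp only: norm_mult norm_of_real) simp
      have "cmod (\<tau> t - \<zeta>) \<le> C * (1 - (2 * t - 1))"
        unfolding \<tau> by (rule C(4)) (use t in auto)
      then have \<tau>\<zeta>: "cmod (\<tau> t - \<zeta>) \<le> 2 * C * u" by (simp add: u_def algebra_simps)
      have "cmod (\<zeta> - of_real t * \<zeta>) = u"
      proof -
        have "\<zeta> - of_real t * \<zeta> = of_real u * \<zeta>" by (simp add: u_def algebra_simps)
        then show ?thesis using u \<zeta> by (simp only: norm_mult norm_of_real)
      qed
      then have \<tau>t: "cmod (\<tau> t - of_real t * \<zeta>) \<le> (2 * C + 1) * u"
        using norm_triangle_ineq[of "\<tau> t - \<zeta>" "\<zeta> - of_real t * \<zeta>"] \<tau>\<zeta> by (simp add: algebra_simps)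
      have cu: "c * u \<le> u" using c(2) u mult_right_mono[of c 1 u] by simp
      have "c * (1 - (2 * t - 1)) \<le> 1 - cmod (\<tau> t)"
        using c(3)[of "of_real (2 * t - 1) * \<zeta>"] t unfolding nt' \<tau> by simp
      then have c\<tau>: "2 * (c * u) \<le> 1 - cmod (\<tau> t)" by (simp add: u_def algebra_simps)
      have "c * u > 0" using c(1) u by simp
      have "c * u = (1 - s) * (c * u) + s * (c * u)" by (simp add: algebra_simps)
      also have "\<dots> \<le> (1 - s) * (1 - t) + s * (1 - cmod (\<tau> t))"
        using s cu c\<tau> \<open>c * u > 0\<close> by (intro add_mono mult_left_mono) (auto simp: u_def)
      also have "\<dots> = 1 - ((1 - s) * t + s * cmod (\<tau> t))" by (simp add: algebra_simps)
      also have "\<dots> \<le> 1 - cmod (Z (s, t))" using Z_le[of s t] s t0 by simp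
      finally have Zc: "c * u \<le> 1 - cmod (Z (s, t))" .
      have "Z (s, t) - of_real t * \<zeta> = of_real s * (\<tau> t - of_real t * \<zeta>)"
        by (simp add: Z_def algebra_simps)
      then have "cmod (Z (s, t) - of_real t * \<zeta>) = s * cmod (\<tau> t - of_real t * \<zeta>)"
        using s by (simp only: norm_mult norm_of_real abs_of_nonneg)
      also have "\<dots> \<le> 1 * cmod (\<tau> t - of_real t * \<zeta>)" using s by (intro mult_right_mono) auto
      finally have Zt: "cmod (Z (s, t) - of_real t * \<zeta>) \<le> (2 * C + 1) * u" using \<tau>t by simp
      have "1 * u \<le> (2 * C + 1) * u" using C(1) u by (intro mult_right_mono) auto
      then show ?thesis using \<rho>(3)[OF u _ _ Zc Zt] cu unfolding nt by (simp add: u_def)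
    qed
    have "((\<lambda>p. Fin (\<phi> (Z p))) \<longlongrightarrow> v) ?G"
    proof (rule tendsto_transfer_pdist[OF rm v \<rho>(1,2)])
      show "eventually (\<lambda>p. cmod (of_real (snd p) * \<zeta>) < 1 \<and> cmod (Z p) < 1 \<and> pdist (of_real (snd p) * \<zeta>) (Z p) \<le> \<rho>) ?G"
        using ev_in ev_b by eventually_elim (use pd in auto)
      show "((\<lambda>p. Fin (\<phi> (of_real (snd p) * \<zeta>))) \<longlongrightarrow> v) ?G"
        using filterlim_compose[OF rad[unfolded has_radial_limit_def] snd_lim] .
    qed
    then show "(H \<longlongrightarrow> v) ?G"
      by (rule Lim_transform_eventually) (use ev_in in \<open>rule eventually_mono, auto simp: H_def\<close>)
  qed
  have H_cont: "continuous_on ({0..1} \<times> {0..1}) H"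
    unfolding continuous_on_def
  proof
    fix p :: "real \<times> real" assume p: "p \<in> {0..1} \<times> {0..1}"
    have split: "{0..1} \<times> {0..1} = {0..1} \<times> {0..<1} \<union> {0..1::real} \<times> {1::real}" by auto
    show "(H \<longlongrightarrow> H p) (at p within {0..1} \<times> {0..1})"
    proof (cases "snd p < 1")
      case True
      have "at p within {0..1} \<times> {0..1} = at p within {0..1} \<times> {0..<1}"
        by (rule at_within_nhd[of _ "UNIV \<times> {..<1}"]) (use True in \<open>auto intro!: open_Times simp: mem_Times_iff\<close>)
      moreover have "p \<in> {0..1} \<times> {0..<1}" using True p by (simp add: mem_Times_iff)
      ultimately show ?thesis
        using bspec[OF H_cont'[unfolded continuous_on_def]] by (simp only:)
    next
      case False
      then have p1: "p = (fst p, 1)" "H p = v" using p by (auto simp: mem_Times_iff H_def prod_eq_iff)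
      have "(H \<longlongrightarrow> v) (at p within {0..1} \<times> {1})"
        by (rule Lim_transform_eventually[OF tendsto_const]) (auto simp: eventually_at_filter H_def mem_Times_iff intro!: always_eventually)
      moreover have "(H \<longlongrightarrow> v) (at p within {0..1} \<times> {0..<1})"
        using H_lim[of "fst p"] p1(1) by simp
      ultimately show ?thesis unfolding split p1(2) at_within_union by (intro filterlim_sup)
    qed
  qed
  have ZU: "\<phi> (Z (s, t)) \<in> U" if "0 \<le> s" "s \<le> 1" "0 \<le> t" "t < 1" for s t
    using riemann_map_image[OF rm] Z1[OF that] by auto
  have curve: "access_curve U (\<phi> 0) v (\<lambda>t. H (s, t))" if s: "s \<in> {0..1}" for s
    unfolding access_curve_def
  proof (intro conjI)
    show "path (\<lambda>t. H (s, t))" unfolding path_def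
      by (rule continuous_on_compose2[OF H_cont]) (use s in \<open>auto intro!: continuous_intros\<close>)
    show "(\<lambda>t. H (s, t)) ` {0..<1} \<subseteq> Fin ` U" using ZU s by (auto simp: H_def)
    show "pathstart (\<lambda>t. H (s, t)) = Fin (\<phi> 0)"
      by (simp add: pathstart_def H_def Z_def \<tau>_def linepath_def)
    show "pathfinish (\<lambda>t. H (s, t)) = v" by (simp add: pathfinish_def H_def)
  qed
  have H0: "H (0, t) = radial_access_curve \<phi> v \<zeta> t" for t
    by (simp add: H_def Z_def radial_access_curve_def)
  have H1: "H (1, t) = ((\<lambda>t. Fin (\<phi> (linepath 0 (g 0) t))) +++ image_curve f v (radial_access_curve \<phi> v \<zeta>)) t" for t
  proof (cases "t \<le> 1 / 2")
    case True
    then show ?thesis by (simp add: H_def Z_def \<tau>_def joinpaths_def)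
  next
    case False
    then show ?thesis using \<zeta>
      by (simp add: H_def Z_def \<tau>_def joinpaths_def image_curve_def radial_access_curve_def semi norm_mult
          del: of_real_diff of_real_mult)
  qed
  have "H \<in> {0..1} \<times> {0..1} \<rightarrow> insert v (Fin ` U)"
    using ZU by (auto simp: H_def)
  then show ?thesis
    unfolding access_homotopic_def homotopic_with_def
    using H_cont curve H0 H1 by (intro exI[of _ H]) auto
qed

section \<open>Limit, multiplier and access at a regular boundary fixed point\<close>

theorem regular_boundary_fixed_point_access:
  assumes mero: "meromorphic_map f" and comp: "invariant_fatou_component f U" and rm: "riemann_map \<phi> U"
    and g: "\<And>z. z \<in> ball 0 1 \<Longrightarrow> g z = inv_into (ball 0 1) \<phi> (to_complex (f (\<phi> z)))"
    and reg: "regular_boundary_fixed_point g \<zeta>"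
  shows "\<exists>v\<in>frontier (Fin ` U). has_radial_limit (\<lambda>z. Fin (\<phi> z)) \<zeta> v \<and>
    (v = Infty \<or> (\<exists>z. v = Fin z \<and> weakly_repelling_fixed_point f z)) \<and>
    (\<exists>\<A>. invariant_access f U (\<phi> 0) v \<A> \<and> corresponds \<phi> v \<A> \<zeta>)"
proof -
  have comp': "U \<in> components (fatou_set f)" and inv: "f ` U \<subseteq> Fin ` U"
    using comp by (auto simp: invariant_fatou_component_def)
  have G: "g holomorphic_on ball 0 1" "\<And>z. cmod z < 1 \<Longrightarrow> cmod (g z) < 1"
    "\<And>z. cmod z < 1 \<Longrightarrow> f (\<phi> z) = Fin (\<phi> (g z))"
    using inner_function_facts[OF mero inv rm, of g] g by blast+
  have \<zeta>: "cmod \<zeta> = 1" using reg by (simp add: regular_boundary_fixed_point_def boundary_fixed_point_def)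
  have phiU: "\<phi> z \<in> U" if "cmod z < 1" for z using riemann_map_image[OF rm] that by auto
  obtain \<rho> r0 where \<rho>: "0 < \<rho>" "\<rho> < 1" and r0: "0 \<le> r0" "r0 < 1"
    and pd: "\<And>r::real. r0 < r \<Longrightarrow> r < 1 \<Longrightarrow> pdist (of_real r * \<zeta>) (g (of_real r * \<zeta>)) \<le> \<rho>"
    using regular_radius_pdist[OF G(1,2) reg] by metis
  obtain v where rad: "has_radial_limit (\<lambda>z. Fin (\<phi> z)) \<zeta> v" and v: "v \<notin> Fin ` U"
    and fin: "\<And>a. v = Fin a \<Longrightarrow> a \<in> closure U \<and> a \<notin> fatou_set f \<and> f a = Fin a"
  proof (rule regular_radial_limit_exists[where g = g, OF mero comp' rm _ _ \<zeta> \<rho> r0])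
    fix w assume "has_radial_limit (\<lambda>z. Fin (\<phi> z)) \<zeta> w" "w \<notin> Fin ` U"
      "\<And>a. w = Fin a \<Longrightarrow> a \<in> closure U \<and> a \<notin> fatou_set f \<and> f a = Fin a"
    then show thesis by (rule that)
  qed (rule G(2,3) pd; assumption)+
  have ev: "eventually (\<lambda>t. t \<in> {0<..<1}) (at_left (1::real))" by (rule eventually_at_left_real) simp
  have fr: "v \<in> frontier (Fin ` U)"
  proof (rule tendsto_in_frontier[OF riemann_map_open[OF rm] v rad[unfolded has_radial_limit_def]])
    show "eventually (\<lambda>t. Fin (\<phi> (of_real t * \<zeta>)) \<in> Fin ` U) (at_left 1)"
      using ev by (rule eventually_mono) (auto intro!: imageI phiU simp: norm_mult \<zeta>)
  qed (rule trivial_limit_at_left_real)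
  have "weakly_repelling_fixed_point f a" if va: "v = Fin a" for a
  proof -
    define F where "F = (\<lambda>w. to_complex (f w))"
    note a = fin[OF va]
    have "a \<notin> U" using v va by blast
    have fa: "F a = a" using a by (simp add: F_def)
    have "F analytic_on {a}" unfolding F_def by (rule meromorphic_map_analytic[OF mero]) (use a in simp)
    then have "F field_differentiable (at a)" by (rule analytic_on_imp_differentiable_at) simp
    then have der: "(F has_field_derivative deriv F a) (at a)" by (simp add: field_differentiable_derivI)
    have ge1: "\<not> cmod (deriv F a) < 1"
      using attracting_fixed_point_in_fatou_set[OF mero, of a] a unfolding F_def by blast
    have "deriv F a = 1" if "cmod (deriv F a) = 1"
    proof (rule neutral_multiplier_eq_1[OF rm \<open>a \<notin> U\<close> G(1,2) der fa that _ \<rho> r0 \<zeta> pd])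
      show "F (\<phi> z) = \<phi> (g z)" if "cmod z < 1" for z using G(3)[OF that] by (simp add: F_def)
      show "((\<lambda>t::real. \<phi> (of_real t * \<zeta>)) \<longlongrightarrow> a) (at_left 1)"
        using rad unfolding va has_radial_limit_def tendsto_Fin_iff .
    qed
    then show ?thesis
      using ge1 a unfolding weakly_repelling_fixed_point_def fixed_point_def F_def[symmetric] Let_def
      by linarith
  qed
  then have weak: "v = Infty \<or> (\<exists>z. v = Fin z \<and> weakly_repelling_fixed_point f z)" by (cases v) auto
  define \<gamma> where "\<gamma> = radial_access_curve \<phi> v \<zeta>"
  define \<eta> where "\<eta> = (\<lambda>t. Fin (\<phi> (linepath 0 (g 0) t)))"
  define \<A> where "\<A> = {\<delta>. access_homotopic U (\<phi> 0) v \<gamma> \<delta>}"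
  have hom: "access_homotopic U (\<phi> 0) v \<gamma> (\<eta> +++ image_curve f v \<gamma>)"
    unfolding \<gamma>_def \<eta>_def by (rule regular_radial_access_homotopic[OF rm v G reg rad])
  \<comment> \<open>A homotopy starting at \<open>\<gamma>\<close>, followed by its reverse, puts
    \<open>\<gamma>\<close> into its own class.\<close>
  then have "access_homotopic U (\<phi> 0) v \<gamma> \<gamma>"
    unfolding access_homotopic_def by (meson homotopic_with_symD homotopic_with_trans)
  then have \<gamma>\<A>: "\<gamma> \<in> \<A>" by (simp add: \<A>_def)
  have \<gamma>: "access_curve U (\<phi> 0) v \<gamma>"
    using hom homotopic_with_imp_property unfolding access_homotopic_def by blast
  have g0: "cmod (g 0) < 1" using G(2)[of 0] by simp
  have seg: "cmod (linepath 0 (g 0) t) < 1" if "t \<in> {0..1}" for t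
  proof -
    have "linepath 0 (g 0) t \<in> closed_segment 0 (g 0)" using that by (rule linepath_in_path)
    moreover have "closed_segment 0 (g 0) \<subseteq> ball 0 1"
      using g0 by (intro closed_segment_subset) auto
    ultimately show ?thesis by auto
  qed
  have "path \<eta>"
    unfolding path_def \<eta>_def
  proof (rule continuous_on_compose2[of "ball 0 1" "\<lambda>z. Fin (\<phi> z)" "{0..1}" "linepath 0 (g 0)"])
    show "continuous_on (ball 0 1) (\<lambda>z. Fin (\<phi> z))"
      using rm holomorphic_on_imp_continuous_on[of \<phi> "ball 0 1"] unfolding riemann_map_def continuous_on_def
      by (auto intro!: tendsto_Fin)
    show "linepath 0 (g 0) ` {0..1} \<subseteq> ball 0 1" using seg by (auto simp del: linepath_def)
  qed (rule continuous_on_linepath)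
  moreover have "path_image \<eta> \<subseteq> Fin ` U"
    using phiU[OF seg] by (auto simp: path_image_def \<eta>_def)
  moreover have "pathstart \<eta> = Fin (\<phi> 0)" "pathfinish \<eta> = f (\<phi> 0)"
    using G(3)[of 0] by (simp_all add: \<eta>_def pathstart_def pathfinish_def linepath_def)
  moreover have "\<eta> +++ image_curve f v \<gamma> \<in> \<A>" using hom by (simp add: \<A>_def)
  ultimately have "\<exists>\<eta>. path \<eta> \<and> path_image \<eta> \<subseteq> Fin ` U \<and> pathstart \<eta> = Fin (\<phi> 0) \<and>
      pathfinish \<eta> = f (\<phi> 0) \<and> \<eta> +++ image_curve f v \<gamma> \<in> \<A>" by blast
  moreover have "is_access U (\<phi> 0) v \<A>"
    unfolding is_access_def \<A>_def using fr \<gamma> by blast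
  ultimately have "invariant_access f U (\<phi> 0) v \<A>"
    unfolding invariant_access_def using \<gamma>\<A> by blast
  moreover have "corresponds \<phi> v \<A> \<zeta>"
    unfolding \<A>_def
  proof (rule access_corresponds[OF rm v \<gamma>])
    have "((\<lambda>t::real. of_real t * \<zeta>) \<longlongrightarrow> of_real 1 * \<zeta>) (at_left 1)" by (intro tendsto_intros)
    then have "((\<lambda>t::real. of_real t * \<zeta>) \<longlongrightarrow> \<zeta>) (at_left 1)" by simp
    then show "((\<lambda>t. sphere_inv \<phi> (\<gamma> t)) \<longlongrightarrow> \<zeta>) (at_left 1)"
    proof (rule Lim_transform_eventually)
      show "eventually (\<lambda>t. of_real t * \<zeta> = sphere_inv \<phi> (\<gamma> t)) (at_left 1)"
        using ev by (rule eventually_mono) (simp add: \<gamma>_def radial_access_curve_def sphere_inv_Fin[OF rm] norm_mult \<zeta>)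
    qed
  qed
  ultimately show ?thesis using fr rad weak by blast
qed

theorem theoremA:
  fixes f :: "complex \<Rightarrow> csphere"
    and U :: "complex set"
    and \<phi> g :: "complex \<Rightarrow> complex"
  assumes "meromorphic_map f"
    and "invariant_fatou_component f U"
    and "simply_connected U"
    and "riemann_map \<phi> U"
    and "\<And>z. z \<in> ball 0 1 \<Longrightarrow> g z = inv_into (ball 0 1) \<phi> (to_complex (f (\<phi> z)))"
  shows "(\<forall>v \<A>. invariant_access f U (\<phi> 0) v \<A> \<longrightarrow>
            (v = Infty \<or> (\<exists>z. v = Fin z \<and> fixed_point f z)) \<and>
            (\<exists>\<zeta>. boundary_fixed_point g \<zeta> \<and> corresponds \<phi> v \<A> \<zeta>))
       \<and> (\<forall>\<zeta>. regular_boundary_fixed_point g \<zeta> \<longrightarrow>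
            (\<exists>v\<in>frontier (Fin ` U).
               has_radial_limit (\<lambda>z. Fin (\<phi> z)) \<zeta> v \<and>
               (v = Infty \<or> (\<exists>z. v = Fin z \<and> weakly_repelling_fixed_point f z)) \<and>
               (\<exists>\<A>. invariant_access f U (\<phi> 0) v \<A> \<and> corresponds \<phi> v \<A> \<zeta>)))"
proof -
  have inv: "f ` U \<subseteq> Fin ` U" using assms(2) by (simp add: invariant_fatou_component_def)
  have a: "(v = Infty \<or> (\<exists>z. v = Fin z \<and> fixed_point f z)) \<and>
      (\<exists>\<zeta>. boundary_fixed_point g \<zeta> \<and> corresponds \<phi> v \<A> \<zeta>)"
    if acc: "invariant_access f U (\<phi> 0) v \<A>" for v \<A>
  proof
    show "v = Infty \<or> (\<exists>z. v = Fin z \<and> fixed_point f z)"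
      by (rule invariant_access_boundary_fixed_point(1)[OF assms(1) inv assms(4) _ acc]) (rule assms(5))
    show "\<exists>\<zeta>. boundary_fixed_point g \<zeta> \<and> corresponds \<phi> v \<A> \<zeta>"
      by (rule invariant_access_boundary_fixed_point(2)[OF assms(1) inv assms(4) _ acc]) (rule assms(5))
  qed
  have b: "\<exists>v\<in>frontier (Fin ` U). has_radial_limit (\<lambda>z. Fin (\<phi> z)) \<zeta> v \<and>
      (v = Infty \<or> (\<exists>z. v = Fin z \<and> weakly_repelling_fixed_point f z)) \<and>
      (\<exists>\<A>. invariant_access f U (\<phi> 0) v \<A> \<and> corresponds \<phi> v \<A> \<zeta>)"
    if "regular_boundary_fixed_point g \<zeta>" for \<zeta>
    by (rule regular_boundary_fixed_point_access[OF assms(1,2,4) _ that]) (rule assms(5))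
  show ?thesis by (rule conjI; intro allI impI; (rule a | rule b); assumption)
qed

end
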